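(* Let $\mathbf{K}_{\mathbf{x}}$ be a fixed $N_A\times N_A$ covariance matrix (Hermitian positive semidefinite). If the ergodic channel $\mathbf{H}$ is uniformly less noisy than the ergodic channel $\mathbf{G}$, then among all input distributions $p_{(u,\mathbf{x})}$ with $\mathrm{cov}[\mathbf{x}]=\mathbf{K}_{\mathbf{x}}$, the ergodic positive secrecy rate $\mathrm{EPSR}$ is maximized by the one for which $u\equiv\mathbf{x}$ and $\mathbf{x}$ is a (circularly symmetric) complex Gaussian vector with covariance $\mathbf{K}_{\mathbf{x}}$, and $$\max_{\substack{p_{(u,\mathbf{x})}\\ \mathrm{cov}[\mathbf{x}]=\mathbf{K}_{\mathbf{x}}}}\mathrm{EPSR}=\mathbb{E}_{\mathbf{H},\mathbf{G}}\left[\log\left(\frac{\det(\mathbf{I}+\mathbf{H}\mathbf{K}_{\mathbf{x}}\mathbf{H}^\dagger)}{\det(\mathbf{I}+\mathbf{G}\mathbf{K}_{\mathbf{x}}\mathbf{G}^\dagger)}\right)\right].$$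
   Context: Channel model (MIMOME). Let $N_A,N_B,N_E\ge 1$ be integers. A message $u$, a random variable in an arbitrary set $\mathcal{U}$, is encoded into a random vector $\mathbf{x}\in\mathbb{C}^{N_A}$; the joint law $p_{(u,\mathbf{x})}$ is the input distribution (the set $\mathcal U$, the law of $u$ and the conditional law of $\mathbf{x}$ given $u$ are all free). The legitimate receiver observes $\mathbf{y}=\mathbf{H}\mathbf{x}+\mathbf{w}_B\in\mathbb{C}^{N_B}$ and the eavesdropper observes $\mathbf{z}=\mathbf{G}\mathbf{x}+\mathbf{w}_E\in\mathbb{C}^{N_E}$, where $\mathbf{H}\in\mathbb{C}^{N_B\times N_A}$ and $\mathbf{G}\in\mathbb{C}^{N_E\times N_A}$ are random matrices (with given distributions, the channel statistics) independent of $(u,\mathbf{x})$, and $\mathbf{w}_B,\mathbf{w}_E$ are circularly symmetric complex Gaussian noise vectors with identity covariance, independent of each other and of everything else. $\dagger$ is the conjugate transpose; $\log$ is base 2; $I(\cdot;\cdot)$ is Shannon mutual information in bits. Instantaneous quantities: $I(u;\mathbf{y})$ and $I(u;\mathbf{z})$ denote the mutual informations for the instantaneous channel states, i.e. $I(u;\mathbf{y}\mid\mathbf{H}=\mathbf{H}_0)$ evaluated at $\mathbf{H}_0=\mathbf{H}$ and $I(u;\mathbf{z}\mid\mathbf{G}=\mathbf{G}_0)$ evaluated at $\mathbf{G}_0=\mathbf{G}$; they are thus random variables, functions of $(\mathbf{H},\mathbf{G})$. The ergodic positive secrecy rate is $\mathrm{EPSR}=\mathbb{E}_{\mathbf{H},\mathbf{G}}\big[(I(u;\mathbf{y})-I(u;\mathbf{z}))^+\big]$,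 where $(t)^+=\max(0,t)$. Uniformly less noisy: $\mathbf{H}$ is uniformly less noisy than $\mathbf{G}$ if for every possible pair of instantaneous channels $(\mathbf{H}_0,\mathbf{G}_0)$ and every input distribution $p_{(u,\mathbf{x})}$ (every channel $u\to\mathbf{x}$), $I(u;\mathbf{y}\mid\mathbf{H}=\mathbf{H}_0)\ge I(u;\mathbf{z}\mid\mathbf{G}=\mathbf{G}_0)$. The notation $u\equiv\mathbf{x}$ means that $u$ is identified with $\mathbf{x}$ (no precoding). *)

theory Defs
  imports "HOL-Probability.Probability"
begin

section \<open>Complex matrices\<close>

definition cadjoint :: "complex ^ 'n ^ 'm \<Rightarrow> complex ^ 'm ^ 'n" where
  "cadjoint A = (\<chi> i j. cnj (A $ j $ i))"

definition hermitian :: "complex ^ 'n ^ 'n \<Rightarrow> bool" where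
  "hermitian K \<longleftrightarrow> cadjoint K = K"

definition pos_semidef :: "complex ^ 'n ^ 'n \<Rightarrow> bool" where
  "pos_semidef K \<longleftrightarrow> hermitian K \<and> (\<forall>v. 0 \<le> Re (\<Sum>i\<in>UNIV. cnj (v $ i) * (K *v v) $ i))"


section \<open>Probabilistic notions\<close>

text \<open>Expectation with values in \<^typ>\<open>ereal\<close>: both \<^const>\<open>ennreal\<close>-valued integrals truncate
  negative values to 0, so this is the integral of the positive part minus the integral of the
  negative part. Unlike the Bochner integral it is not 0 when the true value is infinite.\<close>

definition eexpectation :: "'w measure \<Rightarrow> ('w \<Rightarrow> ereal) \<Rightarrow> ereal" where
  "eexpectation M f =
     enn2ereal (\<integral>\<^sup>+\<omega>. e2ennreal (f \<omega>) \<partial>M) - enn2ereal (\<integral>\<^sup>+\<omega>. e2ennreal (- f \<omega>) \<partial>M)"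

text \<open>Mutual information in bits, with values in \<open>[0, \<infinity>]\<close>. The library's real-valued version is
  only meaningful if the joint law is absolutely continuous with respect to the product of the
  marginals and the information density is integrable. The negative part of the information
  density always has finite integral, so otherwise the value is \<open>\<infinity>\<close>.\<close>

definition mutual_info ::
  "'w measure \<Rightarrow> 'u measure \<Rightarrow> 'y measure \<Rightarrow> ('w \<Rightarrow> 'u) \<Rightarrow> ('w \<Rightarrow> 'y) \<Rightarrow> ereal" where
  "mutual_info M S T X Y =
     (let J = distr M (S \<Otimes>\<^sub>M T) (\<lambda>\<omega>. (X \<omega>, Y \<omega>));
          R = distr M S X \<Otimes>\<^sub>M distr M T Y
      in if absolutely_continuous R J \<and> integrable J (entropy_density 2 R J)
         then ereal (prob_space.mutual_information M 2 S T X Y)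
         else \<infinity>)"

text \<open>Circularly symmetric complex Gaussian with identity covariance: independent components
  with density \<open>exp (- \<bar>w\<bar>\<^sup>2) / \<pi>\<close> on the complex plane, so that \<open>E \<bar>w\<bar>\<^sup>2 = 1\<close>.\<close>

definition std_cgaussian :: "(complex ^ 'n) measure" where
  "std_cgaussian = density lborel (\<lambda>w. ennreal (exp (- (norm w)\<^sup>2) / pi ^ CARD('n)))"

text \<open>The circularly symmetric complex Gaussian law with (possibly singular) covariance \<open>K\<close>,
  as the law of \<open>A w\<close> with \<open>w\<close> standard and \<open>A A\<^sup>\<dagger> = K\<close>; it does not depend on \<open>A\<close>.\<close>

definition cgaussian :: "complex ^ 'n ^ 'n \<Rightarrow> (complex ^ 'n) measure \<Rightarrow> bool" where
  "cgaussian K \<mu> \<longleftrightarrow>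
     (\<exists>A :: complex ^ 'n ^ 'n. A ** cadjoint A = K \<and> \<mu> = distr std_cgaussian borel (\<lambda>w. A *v w))"

definition law_support :: "'w::topological_space measure \<Rightarrow> 'w set" where
  "law_support M = {c. \<forall>V. open V \<longrightarrow> c \<in> V \<longrightarrow> emeasure M V > 0}"


section \<open>The wiretap channel\<close>

text \<open>Input distributions: joint laws of the message and the transmitted vector. The message
  alphabet is an arbitrary measurable space \<open>U\<close> (only its space and \<open>\<sigma>\<close>-algebra matter).\<close>

definition input_law :: "'u measure \<Rightarrow> ('u \<times> (complex ^ 'a)) measure \<Rightarrow> bool" where
  "input_law U p \<longleftrightarrow> prob_space p \<and> sets p = sets (U \<Otimes>\<^sub>M borel)"

definition has_cov :: "'w measure \<Rightarrow> ('w \<Rightarrow> complex ^ 'n) \<Rightarrow> complex ^ 'n ^ 'n \<Rightarrow> bool" where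
  "has_cov M X K \<longleftrightarrow>
     X \<in> borel_measurable M \<and> integrable M (\<lambda>\<omega>. (norm (X \<omega>))\<^sup>2) \<and>
     (\<forall>i j. K $ i $ j =
        (\<integral>\<omega>. (X \<omega> $ i - (\<integral>\<omega>'. X \<omega>' $ i \<partial>M)) * cnj (X \<omega> $ j - (\<integral>\<omega>'. X \<omega>' $ j \<partial>M)) \<partial>M))"

definition cov_inputs :: "complex ^ 'a ^ 'a \<Rightarrow> ('u measure \<times> ('u \<times> (complex ^ 'a)) measure) set" where
  "cov_inputs K = {(U, p). input_law U p \<and> has_cov p snd K}"

text \<open>Mutual information between the message and the output \<open>H\<^sub>0 x + w\<close> of the channel with
  instantaneous state \<open>H\<^sub>0\<close>, the noise \<open>w\<close> being independent of \<open>(u, x)\<close>.\<close>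

definition inst_info ::
  "'u measure \<Rightarrow> ('u \<times> (complex ^ 'a)) measure \<Rightarrow> complex ^ 'a ^ 'r \<Rightarrow> ereal" where
  "inst_info U p H\<^sub>0 =
     mutual_info (p \<Otimes>\<^sub>M (std_cgaussian :: (complex ^ 'r) measure)) U borel
       (\<lambda>((u, x), w). u) (\<lambda>((u, x), w). H\<^sub>0 *v x + w)"

text \<open>\<open>Q\<close> is the joint law of the pair of random channel matrices \<open>(H, G)\<close>, which is independent
  of the input. The possible pairs of instantaneous channels are those in the support of \<open>Q\<close>.
  The type \<open>'u\<close> is the universe from which message alphabets are taken.\<close>

definition uniformly_less_noisy ::
  "'u itself \<Rightarrow> ((complex ^ 'a ^ 'b) \<times> (complex ^ 'a ^ 'e)) measure \<Rightarrow> bool" where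
  "uniformly_less_noisy _ Q \<longleftrightarrow>
     (\<forall>(H\<^sub>0, G\<^sub>0) \<in> law_support Q.
        \<forall>(U :: 'u measure) p. input_law U p \<longrightarrow> inst_info U p H\<^sub>0 \<ge> inst_info U p G\<^sub>0)"

text \<open>Ergodic positive secrecy rate.\<close>

definition EPSR ::
  "((complex ^ 'a ^ 'b) \<times> (complex ^ 'a ^ 'e)) measure \<Rightarrow> 'u measure \<Rightarrow> ('u \<times> (complex ^ 'a)) measure
     \<Rightarrow> ereal" where
  "EPSR Q U p = eexpectation Q (\<lambda>(H, G). max 0 (inst_info U p H - inst_info U p G))"

text \<open>Input with \<open>u \<equiv> x\<close>: the message is the transmitted vector, seen as an element of the
  message universe through an injection \<open>e\<close> (for which one may take the identity if the universe
  is the space of transmitted vectors itself).\<close>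

definition direct_alphabet :: "(complex ^ 'a \<Rightarrow> 'u) \<Rightarrow> 'u measure" where
  "direct_alphabet e = embed_measure borel e"

definition direct_input ::
  "(complex ^ 'a \<Rightarrow> 'u) \<Rightarrow> (complex ^ 'a) measure \<Rightarrow> ('u \<times> (complex ^ 'a)) measure" where
  "direct_input e \<mu> = distr \<mu> (direct_alphabet e \<Otimes>\<^sub>M borel) (\<lambda>x. (e x, x))"

end

theory Submission
  imports Defs
begin

text \<open>Testing the less-noisy hypothesis on Gaussian inputs along a single direction \<open>v\<close> gives
  \<open>\<parallel>G v\<parallel> \<le> \<parallel>H v\<parallel>\<close>. Hence \<open>G = C H\<close> with \<open>C C\<^sup>\<dagger> + D D\<^sup>\<dagger> = I\<close>, so that \<open>z\<close> may be replaced by the degraded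
  version \<open>C y + D w'\<close> of \<open>y\<close>. By data processing \<open>I(x; y | u) \<ge> I(x; z | u)\<close>, i.e.
  \<open>I(u; y) - I(u; z) \<le> I(x; y) - I(x; z)\<close>, and \<open>D(p\<^sub>y | n\<^sub>y) \<ge> D(p\<^sub>z | n\<^sub>z)\<close> for the Gaussian laws
  \<open>n\<^sub>y\<close>, \<open>n\<^sub>z\<close> with the same first and second moments. The expectations of \<open>ln n\<^sub>y\<close> and \<open>ln n\<^sub>z\<close> depend
  on the covariance only, so \<open>I(x; y) - I(x; z)\<close> is bounded by its value at the Gaussian input.
  Both data processing inequalities are instances of \<open>E \<phi> \<le> 0\<close> if \<open>E (exp \<phi>) \<le> 1\<close>, which avoids regular
  conditional distributions.\<close>

section \<open>Lebesgue measure under linear maps\<close>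

text \<open>Maximum entropy alone does not suffice: it bounds the entropies of y and z both from
  above, while I(x; y) - I(x; z) calls for the entropy of z from below. Comparing relative entropies
  to the Gaussian laws controls the difference of the two entropies at once. Replacing z by a
  degraded copy of y is harmless because each information term involves (u, x) and one output only.
  All terms are finite and can be subtracted: the noise makes every output density positive, and the
  second moments make its logarithm integrable. The hypothesis also makes the Gaussian rate
  non-negative at every state in the support of \<open>Q\<close>, which takes care of the positive
  part in \<open>EPSR\<close>. The determinants enter through the normalisation of Gaussian
  densities; complex determinants and real Lebesgue integrals are linked by congruences with shears,
  which have determinant 1 and preserve the measure.\<close>

lemma nn_integral_lborel_translate:
  fixes a :: "'a::euclidean_space"
  assumes [measurable]: "h \<in> borel_measurable borel"
  shows "(\<integral>\<^sup>+x. h (a + x) \<partial>lborel) = (\<integral>\<^sup>+x. h x \<partial>lborel)"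
proof -
  have "(\<integral>\<^sup>+x. h x \<partial>lborel) = (\<integral>\<^sup>+x. h x \<partial>(distr lborel borel ((+) a)))"
    by (simp add: lborel_distr_plus)
  then show ?thesis by (simp add: nn_integral_distr)
qed

lemma nn_integral_lborel_uminus:
  fixes h :: "'a::euclidean_space \<Rightarrow> ennreal"
  assumes [measurable]: "h \<in> borel_measurable borel"
  shows "(\<integral>\<^sup>+x. h (- x) \<partial>lborel) = (\<integral>\<^sup>+x. h x \<partial>lborel)"
proof -
  have "(\<integral>\<^sup>+x. h x \<partial>lborel) = (\<integral>\<^sup>+x. h x \<partial>(distr lborel borel uminus))"
    using lborel_affine[of "-1" "0::'a"] by (simp add: density_1)
  then show ?thesis by (simp add: nn_integral_distr)
qed

lemma linear_borel_measurable:
  fixes L :: "'a::euclidean_space \<Rightarrow> 'b::euclidean_space"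
  assumes "linear L" shows "L \<in> borel_measurable borel"
  using assms by (intro borel_measurable_continuous_onI linear_continuous_on linear_conv_bounded_linear[THEN iffD1])

text \<open>Uniqueness of the translation-invariant measure, in cross-multiplied form: both sides are the
  double integral of \<open>g x * h (x + L s)\<close>.\<close>

lemma nn_integral_lborel_linear_cross:
  fixes L :: "'a::euclidean_space \<Rightarrow> 'a"
  assumes L: "linear L" "bij L"
    and [measurable]: "g \<in> borel_measurable borel" "h \<in> borel_measurable borel"
  shows "(\<integral>\<^sup>+x. g x \<partial>lborel) * (\<integral>\<^sup>+s. h (L s) \<partial>lborel)
       = (\<integral>\<^sup>+x. h x \<partial>lborel) * (\<integral>\<^sup>+s. g (L s) \<partial>lborel)"
proof -
  note [measurable] = linear_borel_measurable[OF L(1)]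
  have ex: "\<exists>t. L t = x" for x using L(2) by (metis bij_def surj_def)
  have shift: "(\<integral>\<^sup>+s. k (x + L s) \<partial>lborel) = (\<integral>\<^sup>+s. k (L s) \<partial>lborel)"
    if [measurable]: "k \<in> borel_measurable borel" for k x
  proof -
    obtain t where "L t = x" using ex by blast
    then have "(\<integral>\<^sup>+s. k (x + L s) \<partial>lborel) = (\<integral>\<^sup>+s. k (L (t + s)) \<partial>lborel)"
      by (simp add: linear_add[OF L(1)])
    also have "\<dots> = (\<integral>\<^sup>+s. k (L s) \<partial>lborel)"
      by (rule nn_integral_lborel_translate[where h="\<lambda>s. k (L s)"]) measurable
    finally show ?thesis .
  qed
  have refl: "(\<integral>\<^sup>+s. g (x - L s) \<partial>lborel) = (\<integral>\<^sup>+s. g (L s) \<partial>lborel)" for x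
    using nn_integral_lborel_uminus[where h="\<lambda>s. g (x + L s)"] shift[of g x]
    by (simp add: linear_neg[OF L(1)])
  have "(\<integral>\<^sup>+x. g x \<partial>lborel) * (\<integral>\<^sup>+s. h (L s) \<partial>lborel)
      = (\<integral>\<^sup>+x. g x * (\<integral>\<^sup>+s. h (x + L s) \<partial>lborel) \<partial>lborel)"
    by (simp add: shift nn_integral_multc)
  also have "\<dots> = (\<integral>\<^sup>+x. (\<integral>\<^sup>+s. g x * h (x + L s) \<partial>lborel) \<partial>lborel)"
    by (simp add: nn_integral_cmult)
  also have "\<dots> = (\<integral>\<^sup>+s. (\<integral>\<^sup>+x. g x * h (x + L s) \<partial>lborel) \<partial>lborel)"
    by (rule lborel_pair.Fubini') measurable
  also have "\<dots> = (\<integral>\<^sup>+s. (\<integral>\<^sup>+x. g (x - L s) * h x \<partial>lborel) \<partial>lborel)"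
  proof (rule nn_integral_cong)
    fix s
    show "(\<integral>\<^sup>+x. g x * h (x + L s) \<partial>lborel) = (\<integral>\<^sup>+x. g (x - L s) * h x \<partial>lborel)"
      using nn_integral_lborel_translate[where a="- L s" and h="\<lambda>x. g x * h (x + L s)"] by simp
  qed
  also have "\<dots> = (\<integral>\<^sup>+x. (\<integral>\<^sup>+s. g (x - L s) * h x \<partial>lborel) \<partial>lborel)"
    by (rule lborel_pair.Fubini') measurable
  also have "\<dots> = (\<integral>\<^sup>+x. (\<integral>\<^sup>+s. g (L s) \<partial>lborel) * h x \<partial>lborel)"
    by (simp add: nn_integral_multc refl)
  finally show ?thesis by (simp add: nn_integral_multc mult.commute)
qed

lemma emeasure_lborel_open_pos:
  fixes S :: "'a::euclidean_space set"
  assumes "open S" "S \<noteq> {}" shows "0 < emeasure lborel S"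
proof -
  have "S \<notin> null_sets lborel"
    using open_not_negligible[OF assms] null_sets_completionI[of S lborel]
    by (auto simp: negligible_iff_null_sets)
  then show ?thesis using assms(1) by (auto simp: null_sets_def zero_less_iff_neq_zero)
qed

lemma nn_integral_lborel_ball: "0 < (\<integral>\<^sup>+x. indicator (ball (0::'a::euclidean_space) 1) x \<partial>lborel)"
    "(\<integral>\<^sup>+x. indicator (ball (0::'a::euclidean_space) 1) x \<partial>lborel) < \<infinity>"
proof -
  show "0 < (\<integral>\<^sup>+x. indicator (ball (0::'a::euclidean_space) 1) x \<partial>lborel)"
    by (simp add: emeasure_lborel_open_pos)
  show "(\<integral>\<^sup>+x. indicator (ball (0::'a::euclidean_space) 1) x \<partial>lborel) < \<infinity>"
    using emeasure_bounded_finite[of "ball (0::'a) 1"] by simp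
qed

text \<open>Take the unit ball as test set in the cross formula: an isometry leaves its indicator
  unchanged, so both products share the factor \<open>?m\<close>, which is positive and finite and
  cancels.\<close>

lemma nn_integral_lborel_isometry:
  fixes L :: "'a::euclidean_space \<Rightarrow> 'a"
  assumes L: "linear L" "\<And>x. norm (L x) = norm x"
    and h [measurable]: "h \<in> borel_measurable borel"
  shows "(\<integral>\<^sup>+s. h (L s) \<partial>lborel) = (\<integral>\<^sup>+x. h x \<partial>lborel)"
proof -
  have "inj L"
    using L by (metis linear_injective_0 norm_eq_zero)
  then have "bij L" using L(1) linear_injective_imp_surjective by (auto simp: bij_def)
  have *: "indicator (ball 0 1) (L s) = (indicator (ball 0 1) s :: ennreal)" for s
    by (simp add: indicator_def L(2))
  let ?m = "(\<integral>\<^sup>+x. indicator (ball (0::'a::euclidean_space) 1) x \<partial>lborel)"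
  have m: "(indicator (ball 0 1) :: 'a \<Rightarrow> ennreal) \<in> borel_measurable borel"
    by (intro borel_measurable_indicator) simp
  have "?m * (\<integral>\<^sup>+s. h (L s) \<partial>lborel) = (\<integral>\<^sup>+x. h x \<partial>lborel) * ?m"
    using nn_integral_lborel_linear_cross[OF L(1) \<open>bij L\<close> m h] by (simp add: * del: nn_integral_indicator)
  then have "?m * (\<integral>\<^sup>+s. h (L s) \<partial>lborel) = ?m * (\<integral>\<^sup>+x. h x \<partial>lborel)"
    by (simp add: mult.commute)
  then show ?thesis using nn_integral_lborel_ball[where 'a='a]
    by (subst (asm) ennreal_mult_cancel_left) auto
qed

text \<open>Solves the cross formula for one side, with the unit ball as test set. That
  \<open>c\<close> is neither 0 nor infinite allows it to be cancelled in
  \<open>unimodular_shear\<close>.\<close>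

lemma nn_integral_lborel_linear:
  fixes L :: "'a::euclidean_space \<Rightarrow> 'a"
  assumes L: "linear L" "bij L"
  obtains c where "c \<noteq> 0" "c \<noteq> \<infinity>"
    "\<And>h. h \<in> borel_measurable borel \<Longrightarrow> (\<integral>\<^sup>+s. h (L s) \<partial>lborel) = c * (\<integral>\<^sup>+x. h x \<partial>lborel)"
proof -
  let ?B = "ball (0::'a) 1"
  let ?m = "(\<integral>\<^sup>+x. indicator ?B x \<partial>lborel)"
  let ?N = "\<lambda>h. (\<integral>\<^sup>+s. h (L s) \<partial>lborel)"
  have op: "open (L ` ?B)"
    using L by (intro open_surjective_linear_image) (auto simp: bij_def)
  have LB: "indicator (L ` ?B) (L s) = (indicator ?B s :: ennreal)" for s
    using inj_image_mem_iff[OF bij_is_inj[OF L(2)]] by (simp add: indicator_def)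
  have pos: "emeasure lborel (L ` ?B) \<noteq> 0"
    using emeasure_lborel_open_pos[OF op] by simp
  have m: "(indicator ?B :: 'a \<Rightarrow> ennreal) \<in> borel_measurable borel"
    "(indicator (L ` ?B) :: 'a \<Rightarrow> ennreal) \<in> borel_measurable borel"
    using op by (auto intro!: borel_measurable_indicator)
  note cross = nn_integral_lborel_linear_cross[OF L m(1)]
  \<comment> \<open>The second test set is the image of the ball, which is open and hence of
    positive measure. Since \<open>?m * ?m\<close> is neither 0 nor infinite, the factor
    \<open>?N (indicator ?B)\<close> is neither.\<close>
  have "?m * ?m = emeasure lborel (L ` ?B) * ?N (indicator ?B)"
    using cross[OF m(2)] op by (simp add: LB)
  then have N: "?N (indicator ?B) \<noteq> 0" "?N (indicator ?B) \<noteq> \<infinity>"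
    using nn_integral_lborel_ball[where 'a='a] pos
    by (auto simp: ennreal_mult_eq_top_iff)
  show thesis
  proof
    show "?N (indicator ?B) / ?m \<noteq> 0" "?N (indicator ?B) / ?m \<noteq> \<infinity>"
      using N nn_integral_lborel_ball[where 'a='a]
      by (auto simp: ennreal_divide_eq_top_iff ennreal_divide_eq_0_iff)
    fix h :: "'a \<Rightarrow> ennreal" assume "h \<in> borel_measurable borel"
    then have "?m * ?N h = (\<integral>\<^sup>+x. h x \<partial>lborel) * ?N (indicator ?B)"
      by (rule cross)
    also have "?N (indicator ?B) = ?m * (?N (indicator ?B) / ?m)"
      using nn_integral_lborel_ball[where 'a='a]
      by (subst ennreal_times_divide, subst mult.commute, subst mult_divide_eq_ennreal) auto
    finally have "?m * ?N h = ?m * (?N (indicator ?B) / ?m * (\<integral>\<^sup>+x. h x \<partial>lborel))"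
      by (simp only: mult_ac)
    then show "?N h = ?N (indicator ?B) / ?m * (\<integral>\<^sup>+x. h x \<partial>lborel)"
      using nn_integral_lborel_ball[where 'a='a]
      by (subst (asm) ennreal_mult_cancel_left) auto
  qed
qed

section \<open>The standard Gaussian measure\<close>

text \<open>Variance 1/2 per real coordinate, so that a complex coordinate has variance 1. Over a
  general Euclidean space the law covers real marginals and product spaces as well as
  \<open>std_cgaussian\<close>.\<close>

definition gauss_density :: "'a::euclidean_space \<Rightarrow> real" where
  "gauss_density w = exp (- (norm w)\<^sup>2) / sqrt pi ^ DIM('a)"

definition gauss :: "'a::euclidean_space measure" where
  "gauss = density lborel (\<lambda>w. ennreal (gauss_density w))"

lemma gauss_density_pos: "0 < gauss_density w"
  by (simp add: gauss_density_def)

lemma gauss_density_measurable [measurable]: "gauss_density \<in> borel_measurable borel"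
  unfolding gauss_density_def[abs_def] by measurable

lemma sets_gauss [measurable_cong, simp]: "sets gauss = sets borel"
  by (simp add: gauss_def)

lemma space_gauss [simp]: "space gauss = UNIV"
  by (simp add: gauss_def)

lemma nn_integral_gauss:
  assumes [measurable]: "h \<in> borel_measurable borel"
  shows "(\<integral>\<^sup>+w. h w \<partial>gauss) = (\<integral>\<^sup>+w. ennreal (gauss_density w) * h w \<partial>lborel)"
  unfolding gauss_def by (rule nn_integral_density) measurable

lemma nn_integral_exp_square:
  fixes d :: real
  assumes "0 < d"
  shows "(\<integral>\<^sup>+x. ennreal (exp (- (d * x\<^sup>2))) \<partial>lborel) = ennreal (sqrt (pi / d))"
proof -
  \<comment> \<open>The standard deviation for which the exponent of the normal density is -d times
    the square.\<close>
  define s where "s = sqrt (1 / (2 * d))"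
  have s: "0 < s" "2 * s\<^sup>2 = 1 / d" using assms by (auto simp: s_def)
  interpret prob_space "density lborel (normal_density 0 s)"
    using s by (rule_tac prob_space_normal_density)
  have nd: "normal_density 0 s x = exp (- (d * x\<^sup>2)) / sqrt (pi / d)" for x
    using s assms by (simp add: normal_density_def mult.assoc mult.left_commute[of 2]) 
  have "1 = (\<integral>\<^sup>+x. ennreal (normal_density 0 s x) \<partial>lborel)"
    using emeasure_space_1 by (simp add: emeasure_density)
  also have "\<dots> = (\<integral>\<^sup>+x. ennreal (exp (- (d * x\<^sup>2))) \<partial>lborel) / ennreal (sqrt (pi / d))"
    using assms by (simp add: nd divide_ennreal[symmetric] nn_integral_divide)
  finally show ?thesis
    by (metis divide_eq_1_ennreal)
qed

lemma norm_square_Basis: "(norm w)\<^sup>2 = (\<Sum>b\<in>Basis. (w \<bullet> b)\<^sup>2)"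
  unfolding power2_norm_eq_inner by (subst euclidean_inner) (simp add: power2_eq_square)

lemma nn_integral_exp_diag:
  fixes d :: "'a::euclidean_space \<Rightarrow> real"
  assumes "\<And>b. b \<in> Basis \<Longrightarrow> 0 < d b"
  shows "(\<integral>\<^sup>+w. ennreal (exp (- (\<Sum>b\<in>Basis. d b * (w \<bullet> b)\<^sup>2))) \<partial>lborel)
       = ennreal (\<Prod>b\<in>Basis. sqrt (pi / d b))"
proof -
  have "(\<integral>\<^sup>+w. ennreal (exp (- (\<Sum>b\<in>Basis. d b * ((w::'a) \<bullet> b)\<^sup>2))) \<partial>lborel)
      = (\<integral>\<^sup>+w. (\<Prod>b\<in>Basis. ennreal (exp (- (d b * (w \<bullet> b)\<^sup>2)))) \<partial>lborel)"
    by (intro nn_integral_cong) (simp add: exp_sum sum_negf[symmetric] prod_ennreal)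
  also have "\<dots> = (\<Prod>b\<in>Basis. (\<integral>\<^sup>+x. ennreal (exp (- (d b * x\<^sup>2))) \<partial>lborel))"
    by (rule nn_integral_lborel_prod) auto
  also have "\<dots> = (\<Prod>b\<in>Basis. ennreal (sqrt (pi / d b)))"
    using assms by (intro prod.cong) (auto simp: nn_integral_exp_square)
  also have "\<dots> = ennreal (\<Prod>b\<in>Basis. sqrt (pi / d b))"
    using assms by (intro prod_ennreal) (simp add: less_imp_le)
  finally show ?thesis .
qed

lemma nn_integral_gauss_density: "(\<integral>\<^sup>+w. ennreal (gauss_density (w::'a::euclidean_space)) \<partial>lborel) = 1"
proof -
  have "(\<integral>\<^sup>+w. ennreal (gauss_density (w::'a)) \<partial>lborel)
      = (\<integral>\<^sup>+w. ennreal (exp (- (\<Sum>b\<in>Basis. 1 * ((w::'a) \<bullet> b)\<^sup>2))) \<partial>lborel) / ennreal (sqrt pi ^ DIM('a))"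
    by (simp add: gauss_density_def divide_ennreal[symmetric] nn_integral_divide norm_square_Basis)
  also have "\<dots> = 1"
    by (subst nn_integral_exp_diag) (auto simp: divide_ennreal)
  finally show ?thesis .
qed

lemma prob_space_gauss: "prob_space gauss"
  by (rule prob_spaceI) (simp add: gauss_def emeasure_density nn_integral_gauss_density)

interpretation gauss: prob_space gauss by (rule prob_space_gauss)

lemma distr_gauss_isometry:
  fixes L :: "'a::euclidean_space \<Rightarrow> 'a"
  assumes L: "linear L" "\<And>x. norm (L x) = norm x"
  shows "distr gauss borel L = gauss"
proof (rule measure_eqI)
  note [measurable] = linear_borel_measurable[OF L(1)]
  fix A assume "A \<in> sets (distr gauss borel L)"
  then have [measurable]: "A \<in> sets borel" by simp
  have "emeasure (distr gauss borel L) A = (\<integral>\<^sup>+w. indicator A w \<partial>distr gauss borel L)"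
    by simp
  also have "\<dots> = (\<integral>\<^sup>+w. indicator A (L w) \<partial>gauss)"
    by (subst nn_integral_distr) simp_all
  also have "\<dots> = (\<integral>\<^sup>+w. ennreal (gauss_density (L w)) * indicator A (L w) \<partial>lborel)"
    by (subst nn_integral_gauss) (simp_all add: gauss_density_def L)
  also have "\<dots> = (\<integral>\<^sup>+w. ennreal (gauss_density w) * indicator A w \<partial>lborel)"
    by (rule nn_integral_lborel_isometry[OF L, where h="\<lambda>w. ennreal (gauss_density w) * indicator A w"]) measurable
  also have "\<dots> = emeasure gauss A"
    by (simp add: gauss_def emeasure_density)
  finally show "emeasure (distr gauss borel L) A = emeasure gauss A" .
qed simp

lemma (in prob_space) distr_pair_snd:
  assumes "sigma_finite_measure N" shows "distr (M \<Otimes>\<^sub>M N) N snd = N"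
proof (rule measure_eqI)
  interpret N: sigma_finite_measure N by fact
  fix A assume "A \<in> sets (distr (M \<Otimes>\<^sub>M N) N snd)"
  then have A: "A \<in> sets N" by simp
  then have "snd -` A \<inter> space (M \<Otimes>\<^sub>M N) = space M \<times> A"
    by (auto simp: space_pair_measure dest: sets.sets_into_space)
  with A show "emeasure (distr (M \<Otimes>\<^sub>M N) N snd) A = emeasure N A"
    by (simp add: emeasure_distr N.emeasure_pair_measure_Times emeasure_space_1)
qed simp

lemma gauss_pair: "(gauss :: 'a::euclidean_space measure) \<Otimes>\<^sub>M (gauss :: 'b::euclidean_space measure) = gauss"
proof -
  have s: "sigma_finite_measure (gauss :: 'b measure)" by unfold_locales
  have "(gauss :: 'a measure) \<Otimes>\<^sub>M (gauss :: 'b measure)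
      = density (lborel \<Otimes>\<^sub>M lborel) (\<lambda>(x, y). ennreal (gauss_density x) * ennreal (gauss_density y))"
    unfolding gauss_def using s
    by (intro pair_measure_density) (auto simp: gauss_def sigma_finite_lborel)
  also have "\<dots> = density lborel (\<lambda>z. ennreal (gauss_density z))"
    unfolding lborel_prod
    by (intro arg_cong[where f="density _"] ext)
       (auto simp: gauss_density_def norm_Pair exp_add power_add ennreal_mult[symmetric] exp_minus field_simps)
  finally show ?thesis by (simp add: gauss_def)
qed

text \<open>The map \<open>(v, w) \<mapsto> (v - Q (P v) + Q w, P v)\<close> is an isometry of the product space, so \<open>P v\<close> has the
  same law as \<open>w\<close>.\<close>

lemma distr_gauss_coisometry:
  fixes P :: "'v::euclidean_space \<Rightarrow> 'w::euclidean_space"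
  assumes P: "linear P" and Q: "linear Q" and adj: "\<And>v w. P v \<bullet> w = v \<bullet> Q w"
    and PQ: "\<And>w. P (Q w) = w"
  shows "distr gauss borel P = gauss"
proof -
  define R where "R = (\<lambda>(v, w). (v - Q (P v) + Q w, P v))"
  have linR: "linear R"
    unfolding R_def
    by (intro linearI) (auto simp: linear_add[OF P] linear_add[OF Q] linear_scale[OF P] linear_scale[OF Q]
        algebra_simps)
  have nR: "norm (R z) = norm z" for z
  proof -
    obtain v w where z: "z = (v, w)" by force
    \<comment> \<open>The component of \<open>v\<close> in the kernel of \<open>P\<close>. It is
      orthogonal to the range of \<open>Q\<close>, and \<open>Q\<close> is isometric, so Pythagoras
      applies to \<open>v0 + Q x\<close>.\<close>
    define v0 where "v0 = v - Q (P v)"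
    have "P v0 = 0" by (simp add: v0_def linear_diff[OF P] PQ)
    then have o: "v0 \<bullet> Q x = 0" for x by (metis adj inner_zero_left)
    have q: "Q x \<bullet> Q x = x \<bullet> x" for x
      by (simp add: adj[symmetric] PQ)
    have n: "(norm (v0 + Q x))\<^sup>2 = (norm v0)\<^sup>2 + (norm x)\<^sup>2" for x
      by (simp add: power2_norm_eq_inner inner_add_left inner_add_right o inner_commute[of "Q x" v0] q)
    have "(norm (R z))\<^sup>2 = (norm (v0 + Q w))\<^sup>2 + (norm (P v))\<^sup>2"
      by (simp add: R_def z norm_Pair v0_def)
    also have "\<dots> = (norm (v0 + Q (P v)))\<^sup>2 + (norm w)\<^sup>2" by (simp add: n)
    also have "\<dots> = (norm z)\<^sup>2" by (simp add: z norm_Pair v0_def)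
    finally show ?thesis by simp
  qed
  note [measurable] = linear_borel_measurable[OF P] linear_borel_measurable[OF linR]
  have sndm: "(snd :: 'v \<times> 'w \<Rightarrow> 'w) \<in> borel_measurable borel"
    by (simp add: borel_prod[symmetric])
  have snd_R: "snd (R z) = P (fst z)" for z
    by (simp add: R_def split_def)
  have "gauss = distr (gauss \<Otimes>\<^sub>M gauss) borel (snd :: 'v \<times> 'w \<Rightarrow> 'w)"
    by (subst (1) prob_space.distr_pair_snd[OF prob_space_gauss gauss.sigma_finite_measure_axioms, symmetric])
      (auto intro: distr_cong)
  also have "\<dots> = distr (distr gauss borel R) borel snd"
    by (simp add: gauss_pair distr_gauss_isometry[OF linR nR])
  also have "\<dots> = distr (gauss \<Otimes>\<^sub>M gauss) borel (\<lambda>z. P (fst (z :: 'v \<times> 'w)))"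
    unfolding gauss_pair using sndm linear_borel_measurable[OF linR]
    by (subst distr_distr) (auto simp: comp_def snd_R)
  also have "\<dots> = distr (distr (gauss \<Otimes>\<^sub>M gauss) borel (fst :: 'v \<times> 'w \<Rightarrow> 'v)) borel P"
    by (subst distr_distr) (auto simp: comp_def)
  also have "distr (gauss \<Otimes>\<^sub>M gauss) borel (fst :: 'v \<times> 'w \<Rightarrow> 'v) = gauss"
    by (subst (3) prob_space.distr_pair_fst[OF prob_space_gauss, symmetric])
      (auto intro: distr_cong)
  finally show ?thesis ..
qed

lemma std_cgaussian_eq_gauss: "std_cgaussian = gauss"
  unfolding std_cgaussian_def gauss_def gauss_density_def
  by (simp add: power_mult power_mult_distrib[symmetric] power2_eq_square)

text \<open>For a unit vector the inner product is a coisometry onto the real line, so its law is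
  the one-dimensional normal law of variance 1/2. Scaling gives the other vectors.\<close>

lemma gauss_inner_square:
  fixes a :: "'a::euclidean_space"
  shows "integrable gauss (\<lambda>w. (w \<bullet> a)\<^sup>2)" "(\<integral>w. (w \<bullet> a)\<^sup>2 \<partial>gauss) = (norm a)\<^sup>2 / 2"
    "integrable gauss (\<lambda>w. w \<bullet> a)" "(\<integral>w. w \<bullet> a \<partial>gauss) = 0"
proof -
  have g: "(gauss :: real measure) = density lborel (normal_density 0 (1 / sqrt 2))"
    by (simp add: gauss_def gauss_density_def normal_density_def power_divide)
  have "has_bochner_integral gauss (\<lambda>x::real. x\<^sup>2) (1/2)"
    using integrable_normal_moment[of "1 / sqrt 2" 0 2] integral_normal_moment_even[of "1 / sqrt 2" 0 1]
    unfolding g by (auto simp: has_bochner_integral_iff integrable_real_density integral_real_density power_divide fact_numeral)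
  moreover have "has_bochner_integral gauss (\<lambda>x::real. x) 0"
    using integrable_normal_moment[of "1 / sqrt 2" 0 1] integral_normal_moment_odd[of "1 / sqrt 2" 0 0]
    unfolding g by (auto simp: has_bochner_integral_iff integrable_real_density integral_real_density)
  moreover have "distr gauss borel (\<lambda>w. w \<bullet> b) = (gauss :: real measure)" if "norm b = 1" for b :: 'a
    using that norm_eq_1[of b]
    by (intro distr_gauss_coisometry[where Q="\<lambda>r. r *\<^sub>R b"])
       (auto intro!: bounded_linear.linear bounded_linear_intros simp: mult.commute)
  ultimately have d: "has_bochner_integral (distr gauss borel (\<lambda>w. w \<bullet> b)) (\<lambda>x. x\<^sup>2) (1/2)"
      "has_bochner_integral (distr gauss borel (\<lambda>w. w \<bullet> b)) (\<lambda>x. x) 0"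
    if "norm b = 1" for b :: 'a
    using that by simp_all
  have *: "has_bochner_integral gauss (\<lambda>w. (w \<bullet> b)\<^sup>2) (1/2)" "has_bochner_integral gauss (\<lambda>w. w \<bullet> b) 0"
    if "norm b = 1" for b :: 'a
  proof -
    have m: "(\<lambda>w. w \<bullet> b) \<in> measurable gauss borel"
      "(\<lambda>x. x\<^sup>2) \<in> borel_measurable (borel :: real measure)"
      "(\<lambda>x. x) \<in> borel_measurable (borel :: real measure)" by measurable
    show "has_bochner_integral gauss (\<lambda>w. (w \<bullet> b)\<^sup>2) (1/2)"
      using d(1)[OF that] unfolding has_bochner_integral_iff integrable_distr_eq[OF m(1,2)] integral_distr[OF m(1,2)] .
    show "has_bochner_integral gauss (\<lambda>w. w \<bullet> b) 0"
      using d(2)[OF that] unfolding has_bochner_integral_iff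
        integrable_distr_eq[OF m(1,3)] integral_distr[OF m(1,3)] .
  qed
  have "has_bochner_integral gauss (\<lambda>w. (w \<bullet> a)\<^sup>2) ((norm a)\<^sup>2 / 2) \<and> has_bochner_integral gauss (\<lambda>w. w \<bullet> a) 0"
  proof (cases "a = 0")
    case False
    then have n: "norm (a /\<^sub>R norm a) = 1" by simp
    have e: "w \<bullet> a = norm a * (w \<bullet> (a /\<^sub>R norm a))" for w using False by simp
    show ?thesis
      using has_bochner_integral_mult_right[OF *(1)[OF n], of "(norm a)\<^sup>2"]
        has_bochner_integral_mult_right[OF *(2)[OF n], of "norm a"] False
      by (subst (1 2) e) (simp add: power_mult_distrib del: inner_scaleR_right)
  qed (auto simp: has_bochner_integral_zero)
  then show "integrable gauss (\<lambda>w. (w \<bullet> a)\<^sup>2)" "(\<integral>w. (w \<bullet> a)\<^sup>2 \<partial>gauss) = (norm a)\<^sup>2 / 2"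
    "integrable gauss (\<lambda>w. w \<bullet> a)" "(\<integral>w. w \<bullet> a \<partial>gauss) = 0"
    by (auto simp: has_bochner_integral_iff)
qed

lemma gauss_inner_inner:
  fixes a b :: "'a::euclidean_space"
  shows "integrable gauss (\<lambda>w. (w \<bullet> a) * (w \<bullet> b))" "(\<integral>w. (w \<bullet> a) * (w \<bullet> b) \<partial>gauss) = (a \<bullet> b) / 2"
proof -
  have e: "(w \<bullet> a) * (w \<bullet> b) = ((w \<bullet> (a + b))\<^sup>2 - (w \<bullet> (a - b))\<^sup>2) / 4" for w
    by (simp add: power2_eq_square inner_add_right inner_diff_right algebra_simps)
  show "integrable gauss (\<lambda>w. (w \<bullet> a) * (w \<bullet> b))"
    unfolding e by (intro integrable_divide Bochner_Integration.integrable_diff gauss_inner_square)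
  show "(\<integral>w. (w \<bullet> a) * (w \<bullet> b) \<partial>gauss) = (a \<bullet> b) / 2"
    unfolding e
    by (subst integral_divide_zero, subst Bochner_Integration.integral_diff)
      (simp_all only: gauss_inner_square, simp add: power2_norm_eq_inner inner_add_left inner_add_right
        inner_diff_left inner_diff_right inner_commute[of b a] field_simps)
qed

lemma gauss_norm_square:
  shows "integrable gauss (\<lambda>w::'a::euclidean_space. (norm w)\<^sup>2)"
    "(\<integral>w. (norm (w::'a))\<^sup>2 \<partial>gauss) = DIM('a) / 2"
  unfolding norm_square_Basis by (simp_all add: gauss_inner_square Bochner_Integration.integral_sum)

section \<open>Positive semidefinite complex matrices\<close>

lemma cadjoint_nth [simp]: "cadjoint A $ i $ j = cnj (A $ j $ i)"
  by (simp add: cadjoint_def)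

lemma cadjoint_mult: "cadjoint (A ** B) = cadjoint B ** cadjoint A"
  by (simp add: vec_eq_iff matrix_matrix_mult_def mult.commute)

lemma cadjoint_cadjoint [simp]: "cadjoint (cadjoint A) = A"
  by (simp add: vec_eq_iff)

lemma cadjoint_mat_1 [simp]: "cadjoint (mat 1) = mat 1"
  by (simp add: vec_eq_iff mat_def)

lemma cadjoint_add: "cadjoint (A + B) = cadjoint A + cadjoint B"
  by (simp add: vec_eq_iff)

lemma cadjoint_diff: "cadjoint (A - B) = cadjoint A - cadjoint B"
  by (simp add: vec_eq_iff)

lemma inner_complex_cnj: "z \<bullet> w = Re (cnj z * w)"
  by (simp add: inner_complex_def)

lemma cmod_mult_self: "cmod z * cmod z = Re z * Re z + Im z * Im z"
  using cmod_power2[of z] by (simp add: power2_eq_square)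

lemma inner_mult_cnj: "(a * z) \<bullet> w = z \<bullet> (cnj a * (w::complex))"
  by (simp add: inner_complex_def algebra_simps)

lemma inner_cadjoint: "(A *v x) \<bullet> y = x \<bullet> (cadjoint A *v y)"
proof -
  have "(A *v x) \<bullet> y = (\<Sum>i\<in>UNIV. \<Sum>j\<in>UNIV. (A $ i $ j * x $ j) \<bullet> y $ i)"
    by (simp add: inner_vec_def matrix_vector_mult_def inner_sum_left)
  also have "\<dots> = (\<Sum>j\<in>UNIV. \<Sum>i\<in>UNIV. x $ j \<bullet> (cnj (A $ i $ j) * y $ i))"
    by (subst sum.swap) (simp add: inner_mult_cnj)
  also have "\<dots> = x \<bullet> (cadjoint A *v y)"
    by (simp add: inner_vec_def matrix_vector_mult_def inner_sum_right)
  finally show ?thesis .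
qed

lemma pos_semidef_iff: "pos_semidef K \<longleftrightarrow> hermitian K \<and> (\<forall>v. 0 \<le> v \<bullet> (K *v v))"
  by (simp add: pos_semidef_def inner_vec_def inner_complex_cnj)

lemma det_cadjoint: "det (cadjoint A) = cnj (det (A :: complex ^ 'n ^ 'n))"
proof -
  have "det (cadjoint A) = det (transpose (cadjoint A))" by (simp add: det_transpose)
  also have "\<dots> = cnj (det A)"
    by (simp add: det_def transpose_def)
  finally show ?thesis .
qed

lemma congruence_hermitian: "hermitian T \<Longrightarrow> hermitian (cadjoint L ** T ** L)"
  by (simp add: hermitian_def cadjoint_mult matrix_mul_assoc)

lemma congruence_inner: "v \<bullet> ((cadjoint L ** T ** L) *v v) = (L *v v) \<bullet> (T *v (L *v v))"
  by (simp add: inner_cadjoint matrix_vector_mul_assoc matrix_mul_assoc)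

lemma gram_pos_semidef: "pos_semidef (A ** cadjoint A)"
proof -
  have "v \<bullet> ((A ** cadjoint A) *v v) = (cadjoint A *v v) \<bullet> (cadjoint A *v v)" for v
    by (simp add: inner_cadjoint matrix_vector_mul_assoc)
  then show ?thesis by (simp add: pos_semidef_iff hermitian_def cadjoint_mult)
qed

section \<open>Diagonalization by measure-preserving congruences\<close>

definition real_diag :: "('n \<Rightarrow> real) \<Rightarrow> complex ^ 'n ^ 'n" where
  "real_diag d = (\<chi> i j. if i = j then complex_of_real (d i) else 0)"

lemma real_diag_mult: "real_diag c ** real_diag d = real_diag (\<lambda>i. c i * d i)"
  by (auto simp: real_diag_def matrix_matrix_mult_def vec_eq_iff if_distrib[where f="\<lambda>x. x * _"]
      if_distrib[where f="\<lambda>x. _ * x"] sum.delta cong: if_cong)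

lemma cadjoint_real_diag [simp]: "cadjoint (real_diag d) = real_diag d"
  by (auto simp: real_diag_def vec_eq_iff)

lemma real_diag_vec: "(real_diag d *v v) $ i = complex_of_real (d i) * v $ i"
  by (simp add: real_diag_def matrix_vector_mult_def if_distrib[where f="\<lambda>x. x * _"] cong: if_cong)

lemma mult_real_diag: "(A ** real_diag d) $ i $ j = A $ i $ j * complex_of_real (d j)"
  by (simp add: real_diag_def matrix_matrix_mult_def if_distrib[where f="\<lambda>x. _ * x"] cong: if_cong)

lemma det_real_diag: "det (real_diag d) = complex_of_real (\<Prod>i\<in>UNIV. d i)"
  by (subst det_diagonal) (auto simp: real_diag_def)

lemma inner_real_diag: "v \<bullet> (real_diag d *v v) = (\<Sum>i\<in>UNIV. d i * (norm (v $ i))\<^sup>2)"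
  by (simp add: inner_vec_def real_diag_vec inner_complex_def cmod_mult_self algebra_simps power2_eq_square)

text \<open>The real Jacobian of a complex matrix is the squared modulus of its determinant.
  Recording both facts side by side for products of shears replaces this relation: a congruence by
  such a matrix changes neither the determinant nor a Gaussian integral.\<close>

definition unimodular :: "complex ^ 'n ^ 'n \<Rightarrow> bool" where
  "unimodular L \<longleftrightarrow> det L = 1 \<and>
     (\<forall>h \<in> borel_measurable borel. (\<integral>\<^sup>+s. h (L *v s) \<partial>lborel) = (\<integral>\<^sup>+s. h s \<partial>lborel))"

lemma matrix_borel_measurable [measurable]: "(*v) (A :: complex ^ 'n ^ 'm) \<in> borel_measurable borel"
  by (intro borel_measurable_continuous_onI linear_continuous_on linear_conv_bounded_linear[THEN iffD1]) simp

lemma unimodular_mult: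
  assumes "unimodular L" "unimodular M" shows "unimodular (L ** M)"
  unfolding unimodular_def
proof (intro conjI ballI)
  show "det (L ** M) = 1" using assms by (simp add: unimodular_def det_mul)
  fix h :: "complex ^ 'a \<Rightarrow> ennreal" assume h: "h \<in> borel_measurable borel"
  then have "(\<lambda>s. h (L *v s)) \<in> borel_measurable borel" by measurable
  then have "(\<integral>\<^sup>+s. h (L *v (M *v s)) \<partial>lborel) = (\<integral>\<^sup>+s. h (L *v s) \<partial>lborel)"
    using assms(2) unfolding unimodular_def by fast
  then show "(\<integral>\<^sup>+s. h ((L ** M) *v s) \<partial>lborel) = (\<integral>\<^sup>+s. h s \<partial>lborel)"
    using assms(1) h by (simp add: unimodular_def matrix_vector_mul_assoc)
qed

lemma unimodular_mat_1: "unimodular (mat 1)"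
  by (simp add: unimodular_def)

lemma unimodular_inverse:
  assumes "unimodular L" obtains M where "L ** M = mat 1" "M ** L = mat 1"
  using assms invertible_det_nz[of L] by (auto simp: unimodular_def invertible_def)

definition shear :: "'n \<Rightarrow> complex ^ 'n \<Rightarrow> complex ^ 'n ^ 'n" where
  "shear i r = (\<chi> k j. (if k = j then 1 else 0) + (if k = i then r $ j else 0))"

lemma shear_vec: "shear i r *v s = s + axis i (\<Sum>j\<in>UNIV. r $ j * s $ j)"
  by (auto simp: shear_def matrix_vector_mult_def vec_eq_iff axis_def distrib_right sum.distrib
      if_distrib[where f="\<lambda>x. x * _"] cong: if_cong)

lemma bij_matrix: "A ** B = mat 1 \<Longrightarrow> B ** A = mat 1 \<Longrightarrow> bij ((*v) (A :: complex ^ 'n ^ 'n))"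
  by (intro o_bij[where g="(*v) B"]) (auto simp: fun_eq_iff matrix_vector_mul_assoc)

text \<open>Cramer's rule for the identity matrix.\<close>

lemma det_column_replaced:
  fixes x :: "complex ^ 'n"
  shows "det (\<chi> i j. if j = k then x $ i else if i = j then 1 else 0) = x $ k"
proof -
  have "(\<chi> i j. if j = k then x $ i else if i = j then 1 else 0)
      = (\<chi> i j. if j = k then (mat 1 *v x) $ i else mat 1 $ i $ j)"
    unfolding matrix_vector_mul_lid by (simp add: vec_eq_iff mat_def)
  then show ?thesis by (simp only: cramer_lemma) simp
qed

text \<open>The scaling factor of a shear is 1: doubling the coordinate \<open>i\<close> conjugates the shear to its square.\<close>

lemma unimodular_shear:
  assumes "r $ i = 0" shows "unimodular (shear i r)"
proof -
  have "det (shear i r) = det (transpose (shear i r))" by (simp add: det_transpose)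
  also have "transpose (shear i r) = (\<chi> k j. if j = i then (r + axis i 1) $ k else if k = j then 1 else 0)"
    by (auto simp: vec_eq_iff shear_def transpose_def axis_def)
  also have "det \<dots> = 1" using assms by (simp only: det_column_replaced) simp
  finally have det: "det (shear i r) = 1" .
  have sum_axis: "(\<Sum>j\<in>UNIV. r $ j * (s + axis i t) $ j) = (\<Sum>j\<in>UNIV. r $ j * s $ j)" for s t
    using assms by (auto intro!: sum.cong simp: axis_def)
  have sum_axis': "(\<Sum>j\<in>UNIV. (- r) $ j * (s + axis i t) $ j) = - (\<Sum>j\<in>UNIV. r $ j * s $ j)" for s t
    using sum_axis[of s t] by (simp add: sum_negf)
  \<comment> \<open>The inverse is the shear by \<open>- r\<close>: as \<open>r $ i = 0\<close>, the
    sum that a shear adds to coordinate \<open>i\<close> does not involve that coordinate.\<close>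
  have "bij ((*v) (shear i r))"
    by (intro o_bij[where g="(*v) (shear i (- r))"])
       (simp_all only: fun_eq_iff o_def id_def shear_vec sum_axis sum_axis', simp_all add: sum_negf vec_eq_iff axis_def)
  then obtain c where c: "c \<noteq> 0" "c \<noteq> \<infinity>"
    "\<And>h. h \<in> borel_measurable borel \<Longrightarrow> (\<integral>\<^sup>+s. h (shear i r *v s) \<partial>lborel) = c * (\<integral>\<^sup>+x. h x \<partial>lborel)"
    using nn_integral_lborel_linear[of "(*v) (shear i r)"] by auto
  define D where "D = (real_diag (\<lambda>k. if k = i then 2 else 1) :: complex ^ 'a ^ 'a)"
  define D' where "D' = (real_diag (\<lambda>k. if k = i then 1/2 else 1) :: complex ^ 'a ^ 'a)"
  have "real_diag (\<lambda>k. 1) = (mat 1 :: complex ^ 'a ^ 'a)" by (auto simp: vec_eq_iff real_diag_def mat_def)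
  then have "D ** D' = mat 1" "D' ** D = mat 1"
    by (auto simp: D_def D'_def real_diag_mult if_distrib[where f="\<lambda>x. x * _"] cong: if_cong)
  then have "bij ((*v) D)" by (rule bij_matrix)
  then obtain d where d: "d \<noteq> 0" "d \<noteq> \<infinity>"
    "\<And>h. h \<in> borel_measurable borel \<Longrightarrow> (\<integral>\<^sup>+s. h (D *v s) \<partial>lborel) = d * (\<integral>\<^sup>+x. h x \<partial>lborel)"
    using nn_integral_lborel_linear[of "(*v) D"] by auto
  have conj: "D *v (shear i r *v s) = shear i r *v (shear i r *v (D *v s))" for s
  proof -
    have "(\<Sum>j\<in>UNIV. r $ j * (D *v s) $ j) = (\<Sum>j\<in>UNIV. r $ j * s $ j)"
      using assms by (auto intro!: sum.cong simp: D_def real_diag_vec)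
    then show ?thesis
      unfolding shear_vec sum_axis by (auto simp: vec_eq_iff D_def real_diag_vec axis_def algebra_simps)
  qed
  let ?g = "\<lambda>s :: complex ^ 'a. ennreal (gauss_density s)"
  \<comment> \<open>Computing the integral of the Gaussian density, which is 1, along both sides of
    \<open>conj\<close> gives \<open>c * d = d * (c * c)\<close>.\<close>
  have "c * d = (\<integral>\<^sup>+s. ?g (D *v (shear i r *v s)) \<partial>lborel)"
    using c(3)[of "\<lambda>s. ?g (D *v s)"] d(3)[of ?g] by (simp add: nn_integral_gauss_density)
  also have "\<dots> = d * (c * c)"
    using d(3)[of "\<lambda>s. ?g (shear i r *v (shear i r *v s))"] c(3)[of "\<lambda>s. ?g (shear i r *v s)"] c(3)[of ?g]
    by (simp add: conj nn_integral_gauss_density)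
  finally have "d * c * 1 = d * c * c" by (simp add: mult_ac)
  then have "c = 1"
    using c d by (subst (asm) ennreal_mult_cancel_left) (auto simp: ennreal_mult_eq_top_iff)
  then show ?thesis using det c(3) by (simp add: unimodular_def)
qed

lemma shear_congruence_nth:
  "(cadjoint (shear i r) ** T ** shear i r) $ j $ k
     = T $ j $ k + T $ j $ i * r $ k + cnj (r $ j) * T $ i $ k + cnj (r $ j) * r $ k * T $ i $ i"
proof -
  have 1: "(M ** shear i r) $ j $ k = M $ j $ k + M $ j $ i * r $ k" for M j k
    by (simp add: matrix_matrix_mult_def shear_def distrib_left sum.distrib
        if_distrib[where f="\<lambda>x. _ * x"] cong: if_cong)
  have 2: "(cadjoint (shear i r) ** M) $ j $ k = M $ j $ k + cnj (r $ j) * M $ i $ k" for M :: "complex^'a^'a" and j k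
  proof -
    have "(cadjoint (shear i r) ** M) $ j $ k = cnj ((cadjoint M ** shear i r) $ k $ j)"
      using cadjoint_nth[of "cadjoint M ** shear i r" j k] by (simp add: cadjoint_mult)
    then show ?thesis by (simp add: 1)
  qed
  show ?thesis by (simp add: 1 2 algebra_simps)
qed

lemma hermitian_nth: "hermitian T \<Longrightarrow> cnj (T $ i $ j) = T $ j $ i"
  by (metis cadjoint_nth hermitian_def)

lemma quadratic_form_two_axes:
  assumes "hermitian T" "i \<noteq> j"
  shows "(axis i a + axis j 1) \<bullet> (T *v (axis i a + axis j 1))
    = (norm a)\<^sup>2 * Re (T $ i $ i) + 2 * Re (cnj a * T $ i $ j) + Re (T $ j $ j)"
proof -
  have "T *v (axis i a + axis j 1) = (\<chi> k. T $ k $ i * a + T $ k $ j)"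
    by (auto simp: vec_eq_iff matrix_vector_mult_def axis_def distrib_left sum.distrib
        if_distrib[where f="\<lambda>x. _ * x"] cong: if_cong)
  moreover have "T $ j $ i = cnj (T $ i $ j)" using assms by (simp add: hermitian_nth)
  moreover have "Im (T $ i $ i) = 0" using hermitian_nth[OF assms(1), of i i] by (metis complex_cnj_cancel_iff Reals_cnj_iff complex_is_Real_iff)
  ultimately show ?thesis
    by (simp add: inner_add_left inner_axis' inner_complex_def cmod_mult_self algebra_simps power2_eq_square)
qed

text \<open>With \<open>T $ i $ i = 0\<close> the form at \<open>axis i a + axis j 1\<close> is
  affine in \<open>a\<close>. Moving \<open>a\<close> far enough against \<open>T $ i $ j\<close>
  would make it negative unless that entry is 0.\<close>

lemma pos_semidef_zero_row:
  assumes "pos_semidef T" "T $ i $ i = 0" shows "T $ i $ j = 0"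
proof (cases "i = j")
  case False
  let ?m = "(norm (T $ i $ j))\<^sup>2"
  have h: "hermitian T" using assms by (simp add: pos_semidef_def)
  have ineq: "0 \<le> Re (T $ j $ j) - 2 * t * ?m" for t :: real
  proof -
    have "0 \<le> 2 * Re (cnj (- complex_of_real t * T $ i $ j) * T $ i $ j) + Re (T $ j $ j)"
      using assms quadratic_form_two_axes[OF h False, of "- complex_of_real t * T $ i $ j"]
      unfolding pos_semidef_iff by (metis add_cancel_right_left mult_zero_right zero_complex.sel(1))
    then show ?thesis by (simp add: cmod_mult_self power2_eq_square algebra_simps)
  qed
  have "?m = 0"
  proof (rule ccontr)
    assume "?m \<noteq> 0"
    \<comment> \<open>For this \<open>t\<close> the right side of \<open>ineq\<close> is
      \<open>- Re (T $ j $ j) - 2\<close>.\<close>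
    then have "2 * ((Re (T $ j $ j) + 1) / ?m) * ?m = 2 * (Re (T $ j $ j) + 1)" by simp
    with ineq[of "(Re (T $ j $ j) + 1) / ?m"] have "0 \<le> Re (T $ j $ j) - 2 * (Re (T $ j $ j) + 1)"
      by (simp only:)
    moreover have "0 \<le> Re (T $ j $ j)" using ineq[of 0] by simp
    ultimately show False by simp
  qed
  then show ?thesis by simp
qed (use assms in simp)

lemma congruence_pos_semidef: "pos_semidef T \<Longrightarrow> pos_semidef (cadjoint L ** T ** L)"
  unfolding pos_semidef_iff by (auto simp: congruence_hermitian congruence_inner)

text \<open>Gaussian elimination acting on rows and columns at once, where \<open>S\<close> collects
  the indices that may still be coupled to each other. A zero pivot calls for no permutation, since
  \<open>pos_semidef_zero_row\<close> shows that its row and column are already cleared.\<close>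

lemma unimodular_diagonalization_aux:
  fixes T :: "complex ^ 'n ^ 'n"
  assumes "finite S"
  shows "pos_semidef T \<Longrightarrow> (\<And>i j. i \<noteq> j \<Longrightarrow> \<not> (i \<in> S \<and> j \<in> S) \<Longrightarrow> T $ i $ j = 0)
    \<Longrightarrow> \<exists>L. unimodular L \<and> (\<forall>i j. i \<noteq> j \<longrightarrow> (cadjoint L ** T ** L) $ i $ j = 0)"
  using assms
proof (induction S arbitrary: T rule: finite_induct)
  case empty
  then show ?case using unimodular_mat_1 by (intro exI[of _ "mat 1"]) simp
next
  case (insert i S)
  have h: "hermitian T" using insert.prems by (simp add: pos_semidef_def)
  show ?case
  proof (cases "T $ i $ i = 0")
    case True
    then have "T $ i $ j = 0" "T $ j $ i = 0" for j
      using pos_semidef_zero_row[OF insert.prems(1)] hermitian_nth[OF h] by (metis complex_cnj_zero)+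
    then show ?thesis using insert.IH[OF insert.prems(1)] insert.prems(2) by (metis insertE)
  next
    case False
    \<comment> \<open>Solves \<open>T $ i $ j + r $ j * T $ i $ i = 0\<close>, which clears row
      \<open>i\<close> off the diagonal. The entry at \<open>i\<close> itself is 0, as
      \<open>unimodular_shear\<close> demands.\<close>
    define r where "r = (\<chi> j. if j = i then 0 else - T $ i $ j / T $ i $ i)"
    define T' where "T' = cadjoint (shear i r) ** T ** shear i r"
    have T': "T' $ j $ k = T $ j $ k + T $ j $ i * r $ k + cnj (r $ j) * T $ i $ k + cnj (r $ j) * r $ k * T $ i $ i" for j k
      unfolding T'_def by (rule shear_congruence_nth)
    have herm: "cnj (T $ j $ k) = T $ k $ j" for j k by (rule hermitian_nth[OF h])
    have off: "T' $ j $ k = 0" if "j \<noteq> k" "\<not> (j \<in> S \<and> k \<in> S)" for j k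
    proof (cases "j = i \<or> k = i")
      case True
      then show ?thesis unfolding T' using False \<open>j \<noteq> k\<close> by (auto simp: r_def herm)
    next
      case nij: False
      then have "T $ j $ k = 0" "T $ j $ i * T $ i $ k = 0"
        using that insert.prems(2)[of j k] insert.prems(2)[of j i] insert.prems(2)[of i k] by auto
      then show ?thesis unfolding T' using False nij by (auto simp: r_def herm)
    qed
    have "pos_semidef T'" unfolding T'_def by (rule congruence_pos_semidef) fact
    from insert.IH[OF this off] obtain L where L: "unimodular L"
      "\<And>i j. i \<noteq> j \<Longrightarrow> (cadjoint L ** T' ** L) $ i $ j = 0" by blast
    have "unimodular (shear i r ** L)"
      using unimodular_shear[of r i] L(1) by (simp add: r_def unimodular_mult)
    moreover have "cadjoint (shear i r ** L) ** T ** (shear i r ** L) = cadjoint L ** T' ** L"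
      by (simp add: T'_def cadjoint_mult matrix_mul_assoc)
    ultimately show ?thesis using L(2) by (intro exI[of _ "shear i r ** L"]) simp
  qed
qed

lemma unimodular_diagonalization:
  fixes T :: "complex ^ 'n ^ 'n"
  assumes "pos_semidef T"
  obtains L d where "unimodular L" "cadjoint L ** T ** L = real_diag d" "\<And>i. 0 \<le> d i"
proof -
  obtain L where L: "unimodular L" "\<And>i j. i \<noteq> j \<Longrightarrow> (cadjoint L ** T ** L) $ i $ j = 0"
    using unimodular_diagonalization_aux[OF finite[of UNIV] assms] by blast
  define d where "d = (\<lambda>i. Re ((cadjoint L ** T ** L) $ i $ i))"
  have psd: "pos_semidef (cadjoint L ** T ** L)" by (rule congruence_pos_semidef[OF assms])
  then have "hermitian (cadjoint L ** T ** L)" by (simp add: pos_semidef_def)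
  then have "Im ((cadjoint L ** T ** L) $ i $ i) = 0" for i
    using hermitian_nth by (metis Reals_cnj_iff complex_is_Real_iff)
  then have eq: "cadjoint L ** T ** L = real_diag d"
    using L(2) by (auto simp: vec_eq_iff real_diag_def d_def complex_eq_iff)
  have "0 \<le> d i" for i
  proof -
    have "0 \<le> axis i 1 \<bullet> (real_diag d *v axis i 1)" using psd unfolding eq pos_semidef_iff by blast
    also have "\<dots> = (\<Sum>j\<in>UNIV. if j = i then d j else 0)"
      unfolding inner_real_diag by (intro sum.cong) (auto simp: axis_def)
    finally show ?thesis by simp
  qed
  then show ?thesis using that L(1) eq by blast
qed

text \<open>Undoing the congruence writes \<open>K\<close> as
  \<open>cadjoint M ** real_diag d ** M\<close> with \<open>M\<close> the inverse of
  \<open>L\<close>; the square root is then taken on the diagonal. Singular \<open>K\<close> is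
  covered, as zero entries of \<open>d\<close> are harmless.\<close>

lemma pos_semidef_factorization:
  fixes K :: "complex ^ 'n ^ 'n"
  assumes "pos_semidef K" obtains A :: "complex ^ 'n ^ 'n" where "A ** cadjoint A = K"
proof -
  obtain L d where L: "unimodular L" "cadjoint L ** K ** L = real_diag d" "\<And>i. 0 \<le> d i"
    using unimodular_diagonalization[OF assms] by metis
  obtain M where M: "L ** M = mat 1" "M ** L = mat 1" using unimodular_inverse[OF L(1)] by metis
  define A where "A = cadjoint M ** real_diag (\<lambda>i. sqrt (d i))"
  have "A ** cadjoint A = cadjoint M ** (real_diag (\<lambda>i. sqrt (d i)) ** real_diag (\<lambda>i. sqrt (d i))) ** M"
    by (simp add: A_def cadjoint_mult matrix_mul_assoc)
  also have "\<dots> = cadjoint M ** (cadjoint L ** K ** L) ** M"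
    using L by (simp add: real_diag_mult)
  also have "\<dots> = cadjoint (L ** M) ** K ** (L ** M)"
    by (simp add: cadjoint_mult matrix_mul_assoc)
  finally show ?thesis using that M by simp
qed

section \<open>Gaussian integrals and determinants\<close>

lemma sum_Basis_vec:
  fixes f :: "complex ^ 'n \<Rightarrow> real"
  shows "(\<Sum>b\<in>Basis. f b) = (\<Sum>i\<in>UNIV. f (axis i 1) + f (axis i \<i>))"
proof -
  have B: "Basis = (\<lambda>(i :: 'n, u). axis i u) ` (UNIV \<times> (Basis :: complex set))"
    by (auto simp: Basis_vec_def)
  have inj: "inj_on (\<lambda>(i :: 'n, u). axis i u) (UNIV \<times> (Basis :: complex set))"
    by (auto simp: inj_on_def axis_eq_axis Basis_complex_def)
  have "(\<Sum>b\<in>Basis. f b) = (\<Sum>(i, u)\<in>UNIV \<times> Basis. f (axis i u))"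
    by (subst B, subst sum.reindex[OF inj]) (simp add: split_def)
  then show ?thesis
    by (simp add: sum.cartesian_product[symmetric] Basis_complex_def)
qed

lemma prod_Basis_vec:
  fixes f :: "complex ^ 'n \<Rightarrow> real"
  shows "(\<Prod>b\<in>Basis. f b) = (\<Prod>i\<in>UNIV. f (axis i 1) * f (axis i \<i>))"
proof -
  have B: "Basis = (\<lambda>(i :: 'n, u). axis i u) ` (UNIV \<times> (Basis :: complex set))"
    by (auto simp: Basis_vec_def)
  have inj: "inj_on (\<lambda>(i :: 'n, u). axis i u) (UNIV \<times> (Basis :: complex set))"
    by (auto simp: inj_on_def axis_eq_axis Basis_complex_def)
  have "(\<Prod>b\<in>Basis. f b) = (\<Prod>(i, u)\<in>UNIV \<times> Basis. f (axis i u))"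
    by (subst B, subst prod.reindex[OF inj]) (simp add: split_def)
  then show ?thesis
    by (simp add: prod.cartesian_product[symmetric] Basis_complex_def)
qed

lemma matrix_vector_mult_axis: "((A :: complex ^ 'n ^ 'm) *v axis i 1) $ k = A $ k $ i"
  by (simp add: matrix_vector_mult_def axis_def if_distrib[where f="\<lambda>x. _ * x"] cong: if_cong)

lemma matrix_mult_add_left: "((A :: complex ^ 'n ^ 'm) + B) ** C = A ** C + B ** C"
  by (simp add: vec_eq_iff matrix_matrix_mult_def distrib_right sum.distrib)

definition posdef :: "complex ^ 'n ^ 'n \<Rightarrow> bool" where
  "posdef T \<longleftrightarrow> hermitian T \<and> (\<forall>v. v \<noteq> 0 \<longrightarrow> 0 < v \<bullet> (T *v v))"

lemma posdef_imp_pos_semidef: "posdef T \<Longrightarrow> pos_semidef T"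
  unfolding posdef_def pos_semidef_iff by (metis inner_zero_left less_eq_real_def)

text \<open>A unimodular change of variables preserves the integral and the determinant, which
  reduces everything to a diagonal form. Positive definiteness keeps the diagonal entries away from
  0, as \<open>L\<close> is injective.\<close>

lemma posdef_gaussian_integral:
  fixes T :: "complex ^ 'n ^ 'n"
  assumes "posdef T"
  shows "det T = complex_of_real (Re (det T))" "0 < Re (det T)"
    "(\<integral>\<^sup>+s. ennreal (exp (- (s \<bullet> (T *v s)))) \<partial>lborel) = ennreal (pi ^ CARD('n) / Re (det T))"
proof -
  obtain L d where L: "unimodular L" "cadjoint L ** T ** L = real_diag d"
    using unimodular_diagonalization[OF posdef_imp_pos_semidef[OF assms]] by metis
  obtain M where M: "M ** L = mat 1" using unimodular_inverse[OF L(1)] by metis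
  have dpos: "0 < d i" for i
  proof -
    have "L *v axis i 1 \<noteq> 0"
      by (metis M matrix_vector_mul_assoc matrix_vector_mul_lid matrix_vector_mult_0_right axis_eq_0_iff one_neq_zero)
    then have "0 < axis i 1 \<bullet> (real_diag d *v axis i 1)"
      using assms unfolding L(2)[symmetric] congruence_inner posdef_def by blast
    also have "\<dots> = (\<Sum>j\<in>UNIV. if j = i then d j else 0)"
      unfolding inner_real_diag by (intro sum.cong) (auto simp: axis_def)
    finally show ?thesis by simp
  qed
  have "det (cadjoint L ** T ** L) = det T"
    using L(1) by (simp add: det_mul det_cadjoint unimodular_def)
  then have det: "det T = complex_of_real (\<Prod>i\<in>UNIV. d i)"
    by (simp add: L(2) det_real_diag)
  then show "det T = complex_of_real (Re (det T))" by simp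
  show "0 < Re (det T)" using dpos unfolding det by (simp only: Re_complex_of_real) (simp add: prod_pos)
  \<comment> \<open>Spreads \<open>d\<close> over the real basis: both \<open>axis i 1\<close> and
    \<open>axis i \<i>\<close> receive \<open>d i\<close>. The two factors
    \<open>sqrt (pi / d i)\<close> then multiply to \<open>pi / d i\<close>.\<close>
  define d' :: "complex ^ 'n \<Rightarrow> real" where "d' b = (\<Sum>i\<in>UNIV. d i * norm (b $ i))" for b
  have d'_axis: "d' (axis i u) = d i" if "norm u = 1" for i u
  proof -
    have "d' (axis i u) = (\<Sum>j\<in>UNIV. if j = i then d j else 0)"
      unfolding d'_def by (intro sum.cong) (auto simp: axis_def that)
    then show ?thesis by simp
  qed
  have quad: "s \<bullet> (real_diag d *v s) = (\<Sum>b\<in>Basis. d' b * (s \<bullet> b)\<^sup>2)" for s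
    by (simp add: sum_Basis_vec inner_real_diag d'_axis inner_axis inner_complex_def cmod_power2 distrib_left)
  have meas: "(\<lambda>s. ennreal (exp (- (s \<bullet> (T *v s))))) \<in> borel_measurable borel" by measurable
  have "(\<integral>\<^sup>+s. ennreal (exp (- (s \<bullet> (T *v s)))) \<partial>lborel)
      = (\<integral>\<^sup>+s. ennreal (exp (- ((L *v s) \<bullet> (T *v (L *v s))))) \<partial>lborel)"
    using bspec[OF conjunct2[OF L(1)[unfolded unimodular_def]] meas] by simp
  also have "\<dots> = (\<integral>\<^sup>+s. ennreal (exp (- (\<Sum>b\<in>Basis. d' b * (s \<bullet> b)\<^sup>2))) \<partial>lborel)"
    by (simp add: congruence_inner[symmetric] L(2) quad)
  also have "\<dots> = ennreal (\<Prod>b\<in>Basis. sqrt (pi / d' b))"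
  proof (rule nn_integral_exp_diag)
    fix b :: "complex ^ 'n" assume "b \<in> Basis"
    then obtain i u where "b = axis i u" "u \<in> Basis" by (auto simp: Basis_vec_def)
    then show "0 < d' b" using dpos by (auto simp: d'_axis Basis_complex_def)
  qed
  also have "(\<Prod>b\<in>Basis. sqrt (pi / d' b)) = (\<Prod>i\<in>UNIV. pi / d i)"
    by (simp add: prod_Basis_vec d'_axis dpos less_imp_le)
  also have "\<dots> = pi ^ CARD('n) / Re (det T)"
    by (simp only: det Re_complex_of_real) (simp add: prod_dividef)
  finally show "(\<integral>\<^sup>+s. ennreal (exp (- (s \<bullet> (T *v s)))) \<partial>lborel) = ennreal (pi ^ CARD('n) / Re (det T))" .
qed

section \<open>Rank-one covariances\<close>

definition outer :: "complex ^ 'n \<Rightarrow> complex ^ 'n ^ 'n" where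
  "outer v = (\<chi> i j. v $ i * cnj (v $ j))"

lemma outer_congruence: "H ** outer v ** cadjoint H = outer (H *v v)"
  by (simp add: vec_eq_iff outer_def matrix_matrix_mult_def matrix_vector_mult_def
      sum_distrib_left sum_distrib_right mult_ac)

lemma pos_semidef_outer: "pos_semidef (outer v)"
proof -
  have "w \<bullet> (outer v *v w) = (norm (\<Sum>j\<in>UNIV. cnj (v $ j) * w $ j))\<^sup>2" for w
  proof -
    let ?z = "\<Sum>j\<in>UNIV. cnj (v $ j) * w $ j"
    have "w \<bullet> (outer v *v w) = (\<Sum>i\<in>UNIV. w $ i \<bullet> (v $ i * ?z))"
      by (simp add: inner_vec_def outer_def matrix_vector_mult_def sum_distrib_left mult.assoc)
    also have "\<dots> = (\<Sum>i\<in>UNIV. (cnj (v $ i) * w $ i) \<bullet> ?z)"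
      by (intro sum.cong) (simp_all add: inner_mult_cnj)
    also have "\<dots> = ?z \<bullet> ?z" by (simp only: inner_sum_left)
    finally show ?thesis by (simp add: power2_norm_eq_inner)
  qed
  moreover have "hermitian (outer v)" by (simp add: hermitian_def vec_eq_iff outer_def mult.commute)
  ultimately show ?thesis by (simp add: pos_semidef_iff)
qed

text \<open>Write \<open>outer h\<close> as \<open>A ** B\<close> with \<open>h\<close> as column
  \<open>j\<close> of \<open>A\<close> and its conjugate as row \<open>j\<close> of
  \<open>B\<close>. Choosing \<open>h $ j\<close> non-zero makes \<open>A\<close> invertible, so the
  factors may be swapped. In \<open>mat 1 + B ** A\<close> only row \<open>j\<close> differs from
  the identity, and the determinant is its diagonal entry.\<close>

lemma det_one_plus_outer:
  fixes h :: "complex ^ 'n"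
  shows "det (mat 1 + outer h) = complex_of_real (1 + (norm h)\<^sup>2)"
proof (cases "h = 0")
  case True
  then have "outer h = 0" by (simp add: outer_def vec_eq_iff)
  then show ?thesis using True by simp
next
  case False
  then obtain j where j: "h $ j \<noteq> 0" by (auto simp: vec_eq_iff)
  define A :: "complex ^ 'n ^ 'n" where "A = (\<chi> i k. if k = j then h $ i else if i = k then 1 else 0)"
  define B :: "complex ^ 'n ^ 'n" where "B = (\<chi> i k. if i = j then cnj (h $ k) else 0)"
  have detA: "det A = h $ j" unfolding A_def by (rule det_column_replaced)
  have AB: "A ** B = outer h"
    by (simp add: vec_eq_iff matrix_matrix_mult_def A_def B_def outer_def
        if_distrib[where f="\<lambda>x. _ * x"] cong: if_cong)
  define x where "x = axis j 1 + (\<chi> k. \<Sum>m\<in>UNIV. cnj (h $ m) * A $ m $ k)"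
  have "mat 1 + B ** A = transpose (\<chi> k i. if i = j then x $ k else if k = i then 1 else 0)"
    by (auto simp: vec_eq_iff transpose_def x_def matrix_matrix_mult_def B_def mat_def axis_def)
  then have "det (mat 1 + B ** A) = x $ j"
    by (simp only: det_transpose det_column_replaced)
  also have "x $ j = 1 + (\<Sum>m\<in>UNIV. complex_of_real ((norm (h $ m))\<^sup>2))"
    by (simp add: x_def A_def mult.commute[of "cnj _"] complex_norm_square[symmetric])
  also have "\<dots> = complex_of_real (1 + (norm h)\<^sup>2)"
    by (simp add: norm_vec_def L2_set_def sum_nonneg)
  finally have BA: "det (mat 1 + B ** A) = complex_of_real (1 + (norm h)\<^sup>2)" .
  have "A ** (mat 1 + B ** A) = (mat 1 + A ** B) ** A"
    by (simp add: matrix_add_ldistrib matrix_mult_add_left matrix_mul_assoc)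
  then have "det A * det (mat 1 + B ** A) = det (mat 1 + A ** B) * det A"
    by (metis det_mul)
  then show ?thesis using j by (simp add: detA BA AB)
qed

text \<open>The inequality makes \<open>G *v v\<close> a function of \<open>H *v v\<close>, and
  \<open>C\<close> is that function extended by 0 to the orthogonal complement of the range of
  \<open>H\<close>. It is a contraction, so \<open>mat 1 - C ** cadjoint C\<close> is positive
  semidefinite and \<open>D\<close> is a factor of it: the extra noise restores identity
  covariance.\<close>

lemma degradation:
  fixes H :: "complex ^ 'a ^ 'b" and G :: "complex ^ 'a ^ 'e"
  assumes le: "\<And>v. norm (G *v v) \<le> norm (H *v v)"
  obtains C :: "complex ^ 'b ^ 'e" and D :: "complex ^ 'e ^ 'e"
  where "G = C ** H" "C ** cadjoint C + D ** cadjoint D = mat 1"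
proof -
  have "pos_semidef (cadjoint H ** H)" using gram_pos_semidef[of "cadjoint H"] by simp
  then obtain L d where L: "unimodular L" "cadjoint L ** (cadjoint H ** H) ** L = real_diag d"
    using unimodular_diagonalization by metis
  obtain M where M: "L ** M = mat 1" using unimodular_inverse[OF L(1)] by metis
  define H' where "H' = H ** L"
  define G' where "G' = G ** L"
  \<comment> \<open>As \<open>inverse 0 = 0\<close>, this is the pseudo-inverse of
    \<open>real_diag d\<close>. Columns of \<open>G'\<close> with \<open>d i = 0\<close> vanish by
    \<open>col\<close>, so nothing of \<open>G'\<close> is lost in \<open>C ** H'\<close>.\<close>
  define E :: "complex ^ 'a ^ 'a" where "E = real_diag (\<lambda>i. inverse (d i))"
  define C where "C = G' ** E ** cadjoint H'"
  have gram: "cadjoint H' ** H' = real_diag d"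
    using L(2) by (simp add: H'_def cadjoint_mult matrix_mul_assoc)
  have le': "norm (G' *v v) \<le> norm (H' *v v)" for v
    unfolding G'_def H'_def matrix_vector_mul_assoc[symmetric] by (rule le)
  have col: "G' $ k $ i = 0" if "d i = 0" for i k
  proof -
    have "(norm (H' *v axis i 1))\<^sup>2 = axis i 1 \<bullet> (real_diag d *v axis i 1)"
      by (simp add: power2_norm_eq_inner inner_cadjoint matrix_vector_mul_assoc gram)
    also have "\<dots> = 0"
      using that unfolding inner_real_diag by (intro sum.neutral) (auto simp: axis_def)
    finally have "G' *v axis i 1 = 0" using le'[of "axis i 1"] by simp
    then show ?thesis by (metis matrix_vector_mult_axis zero_index)
  qed
  have "C ** H' = G' ** (E ** real_diag d)"
    by (simp add: C_def matrix_mul_assoc[symmetric] gram)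
  also have "\<dots> = G'"
  proof -
    have "G' $ k $ i * complex_of_real (inverse (d i) * d i) = G' $ k $ i" for k i
      by (cases "d i = 0") (simp_all add: col)
    then show ?thesis
      by (simp add: vec_eq_iff E_def real_diag_mult mult_real_diag del: of_real_mult of_real_inverse)
  qed
  finally have "C ** H ** (L ** M) = G ** (L ** M)"
    by (simp add: G'_def H'_def matrix_mul_assoc)
  then have GC: "G = C ** H" by (simp add: M)
  have C1: "norm (C *v y) \<le> norm y" for y
  proof -
    \<comment> \<open>With this \<open>v\<close> the vector \<open>H' *v v\<close> is the orthogonal
      projection of \<open>y\<close> onto the range of \<open>H'\<close>, hence not longer than
      \<open>y\<close>, while \<open>C *v y = G' *v v\<close>.\<close>
    define v where "v = E *v (cadjoint H' *v y)"
    have E3: "E ** real_diag d ** E = E"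
    proof -
      have "inverse (d i) * d i * inverse (d i) = inverse (d i)" for i
        by (cases "d i = 0") simp_all
      then show ?thesis by (simp only: E_def real_diag_mult)
    qed
    have Eh: "cadjoint E = E" by (simp add: E_def)
    have "(norm (H' *v v))\<^sup>2 = v \<bullet> (real_diag d *v v)"
      by (simp add: power2_norm_eq_inner inner_cadjoint matrix_vector_mul_assoc gram)
    also have "\<dots> = (cadjoint H' *v y) \<bullet> ((E ** real_diag d ** E) *v (cadjoint H' *v y))"
      unfolding v_def by (simp add: inner_cadjoint Eh matrix_vector_mul_assoc matrix_mul_assoc cadjoint_mult)
    also have "\<dots> = y \<bullet> (H' *v v)"
      unfolding E3 v_def by (simp add: inner_cadjoint)
    also have "\<dots> \<le> norm y * norm (H' *v v)" by (rule norm_cauchy_schwarz)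
    finally have "norm (H' *v v) \<le> norm y"
      by (cases "H' *v v = 0") (auto simp: power2_eq_square)
    moreover have "C *v y = G' *v v"
      by (simp add: C_def v_def matrix_vector_mul_assoc matrix_mul_assoc)
    ultimately show ?thesis using le'[of v] by simp
  qed
  \<comment> \<open>The bound passes to the adjoint, because it is \<open>C ** cadjoint C\<close>
    that has to stay below the identity.\<close>
  have C2: "norm (cadjoint C *v w) \<le> norm w" for w
  proof -
    have "(norm (cadjoint C *v w))\<^sup>2 = w \<bullet> (C *v (cadjoint C *v w))"
      by (simp add: power2_norm_eq_inner inner_cadjoint)
    also have "\<dots> \<le> norm w * norm (C *v (cadjoint C *v w))" by (rule norm_cauchy_schwarz)
    also have "\<dots> \<le> norm w * norm (cadjoint C *v w)" by (intro mult_left_mono C1) simp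
    finally show ?thesis by (cases "cadjoint C *v w = 0") (auto simp: power2_eq_square)
  qed
  have "pos_semidef (mat 1 - C ** cadjoint C)"
  proof -
    have "v \<bullet> ((mat 1 - C ** cadjoint C) *v v) = (norm v)\<^sup>2 - (norm (cadjoint C *v v))\<^sup>2" for v
      by (simp add: matrix_vector_mult_diff_rdistrib inner_diff_right power2_norm_eq_inner inner_cadjoint
          matrix_vector_mul_assoc)
    moreover have "(norm (cadjoint C *v v))\<^sup>2 \<le> (norm v)\<^sup>2" for v using C2 by (simp add: power_mono)
    ultimately show ?thesis
      by (simp add: pos_semidef_iff hermitian_def cadjoint_diff cadjoint_mult)
  qed
  then obtain D :: "complex ^ 'e ^ 'e" where "D ** cadjoint D = mat 1 - C ** cadjoint C"
    using pos_semidef_factorization by metis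
  then have "C ** cadjoint C + D ** cadjoint D = mat 1" by simp
  with GC show ?thesis by (rule that)
qed

section \<open>Mutual information and data processing\<close>

text \<open>Integrate \<open>\<phi> + 1 \<le> exp \<phi>\<close>. Stating the bound with the
  non-negative integral yields the integrability of \<open>exp \<phi>\<close> along the way.\<close>

lemma (in prob_space) integral_nonpos_of_exp:
  fixes \<phi> :: "'a \<Rightarrow> real"
  assumes int: "integrable M \<phi>" and le: "(\<integral>\<^sup>+x. ennreal (exp (\<phi> x)) \<partial>M) \<le> 1"
  shows "(\<integral>x. \<phi> x \<partial>M) \<le> 0"
proof -
  have i: "integrable M (\<lambda>x. exp (\<phi> x))"
    using le int by (intro integrableI_bounded) (auto intro: le_less_trans)
  have "(\<integral>x. exp (\<phi> x) \<partial>M) \<le> 1"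
    using le by (subst (asm) nn_integral_eq_integral[OF i]) (auto simp: ennreal_le_1)
  moreover have "(\<integral>x. \<phi> x \<partial>M) \<le> (\<integral>x. exp (\<phi> x) - 1 \<partial>M)"
    using i int exp_ge_add_one_self by (intro integral_mono) (auto simp: algebra_simps add.commute)
  ultimately show ?thesis using i by (simp add: prob_space)
qed

text \<open>A fine message \<open>v\<close> of law \<open>V\<close>, a coarse message \<open>\<pi> v\<close>, an output of law \<open>P\<close>, and the density \<open>\<rho>\<close> of
  the law of (fine message, output) with respect to the product of the marginals.\<close>

locale channel_density = V: prob_space V + P: prob_space P
  for V :: "'v measure" and P :: "'y measure" +
  fixes U :: "'u measure" and \<pi> :: "'v \<Rightarrow> 'u" and \<rho> :: "'v \<times> 'y \<Rightarrow> real"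
  assumes \<pi> [measurable]: "\<pi> \<in> measurable V U"
    and \<rho> [measurable]: "\<rho> \<in> borel_measurable (V \<Otimes>\<^sub>M P)"
    and \<rho>_pos: "\<And>z. 0 < \<rho> z"
    and \<rho>_prob: "(\<integral>\<^sup>+z. ennreal (\<rho> z) \<partial>(V \<Otimes>\<^sub>M P)) = 1"
    and ln_\<rho>: "integrable (density (V \<Otimes>\<^sub>M P) (\<lambda>z. ennreal (\<rho> z))) (\<lambda>z. ln (\<rho> z))"
begin

text \<open>In nats, the integral of \<open>ln \<rho>\<close> under \<open>J\<close> is the
  information between fine message and output, and that of \<open>ln (r (coarse z))\<close> is the
  information between coarse message and output. Their difference is the conditional information of
  the fine message given the coarse one.\<close>

definition "J = density (V \<Otimes>\<^sub>M P) (\<lambda>z. ennreal (\<rho> z))"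
definition "coarse = (\<lambda>(v, y). (\<pi> v, y :: 'y))"
definition "R = distr V U \<pi> \<Otimes>\<^sub>M P"
definition "JU = distr J (U \<Otimes>\<^sub>M P) coarse"
definition "r = (\<lambda>z. enn2real (RN_deriv R JU z))"

lemma sets_J [measurable_cong, simp]: "sets J = sets (V \<Otimes>\<^sub>M P)" by (simp add: J_def)

lemma space_J [simp]: "space J = space (V \<Otimes>\<^sub>M P)" by (simp add: J_def)

sublocale J: prob_space J
  by (rule prob_spaceI) (simp add: J_def emeasure_density \<rho>_prob cong: nn_integral_cong)

lemma coarse_measurable [measurable]: "coarse \<in> measurable (V \<Otimes>\<^sub>M P) (U \<Otimes>\<^sub>M P)"
  unfolding coarse_def by measurable

sublocale PU: prob_space "distr V U \<pi>" by (rule V.prob_space_distr) simp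

lemma sets_R [measurable_cong, simp]: "sets R = sets (U \<Otimes>\<^sub>M P)"
  unfolding R_def by (intro sets_pair_measure_cong) auto

lemma sets_JU [measurable_cong, simp]: "sets JU = sets (U \<Otimes>\<^sub>M P)" by (simp add: JU_def)

sublocale R: prob_space R
  unfolding R_def by (rule prob_space_pair) unfold_locales

sublocale JU: prob_space JU unfolding JU_def by (rule J.prob_space_distr) simp

lemma R_eq_distr: "R = distr (V \<Otimes>\<^sub>M P) (U \<Otimes>\<^sub>M P) coarse"
  using pair_measure_distr[of \<pi> V U "\<lambda>y. y" P P] P.sigma_finite_measure_axioms
  by (simp add: R_def coarse_def)

lemma nn_integral_R:
  assumes [measurable]: "h \<in> borel_measurable (U \<Otimes>\<^sub>M P)"
  shows "(\<integral>\<^sup>+z. h z \<partial>R) = (\<integral>\<^sup>+z. h (coarse z) \<partial>(V \<Otimes>\<^sub>M P))"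
  unfolding R_eq_distr by (rule nn_integral_distr) auto

lemma nn_integral_JU:
  assumes [measurable]: "h \<in> borel_measurable (U \<Otimes>\<^sub>M P)"
  shows "(\<integral>\<^sup>+z. h z \<partial>JU) = (\<integral>\<^sup>+z. h (coarse z) \<partial>J)"
  unfolding JU_def by (rule nn_integral_distr) auto

lemma nn_integral_J:
  assumes [measurable]: "h \<in> borel_measurable (V \<Otimes>\<^sub>M P)"
  shows "(\<integral>\<^sup>+z. h z \<partial>J) = (\<integral>\<^sup>+z. ennreal (\<rho> z) * h z \<partial>(V \<Otimes>\<^sub>M P))"
  unfolding J_def by (rule nn_integral_density) auto

lemma ac: "absolutely_continuous R JU"
  unfolding absolutely_continuous_def
proof
  fix N assume N: "N \<in> null_sets R"
  then have [measurable]: "N \<in> sets (U \<Otimes>\<^sub>M P)" by (auto simp: null_sets_def)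
  have "AE z in R. z \<notin> N" using N by (rule AE_not_in)
  then have "AE z in V \<Otimes>\<^sub>M P. coarse z \<notin> N"
    unfolding R_eq_distr by (subst (asm) AE_distr_iff) auto
  then have "AE z in J. coarse z \<notin> N" unfolding J_def by (subst AE_density) auto
  then have "AE z in JU. z \<notin> N" unfolding JU_def by (subst AE_distr_iff) auto
  then show "N \<in> null_sets JU" by (subst (asm) AE_iff_null_sets[symmetric]) auto
qed

lemma r_measurable [measurable]: "r \<in> borel_measurable (U \<Otimes>\<^sub>M P)"
proof -
  have "r \<in> borel_measurable R" unfolding r_def by measurable
  then show ?thesis by simp
qed

lemma r_nonneg: "0 \<le> r z" by (simp add: r_def)

lemma JU_density: "JU = density R (\<lambda>z. ennreal (r z))"
proof -
  \<comment> \<open>Finiteness of \<open>JU\<close> makes the derivative finite almost everywhere,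
    so \<open>enn2real\<close> in \<open>r\<close> alters it on a null set only.\<close>
  have "finite_measure JU" "sets JU = sets R" by (unfold_locales, simp)
  then obtain D where D: "AE z in R. RN_deriv R JU z = ennreal (D z)"
    using R.real_RN_deriv[OF _ ac] by metis
  then have "AE z in R. ennreal (r z) = RN_deriv R JU z"
    by eventually_elim (simp add: r_def)
  then have "density R (\<lambda>z. ennreal (r z)) = density R (RN_deriv R JU)"
    by (intro density_cong) auto
  then show ?thesis using R.density_RN_deriv[OF ac] by simp
qed

text \<open>Unlike \<open>\<rho>\<close>, the derivative \<open>r\<close> may vanish somewhere, but
  a measure gives no mass to the zeros of its own density.\<close>

lemma AE_r_pos: "AE z in J. 0 < r (coarse z)"
proof -
  have "AE z in density R (\<lambda>z. ennreal (r z)). 0 < r z"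
    by (subst AE_density) auto
  then have "AE z in JU. 0 < r z" by (subst JU_density)
  then show ?thesis unfolding JU_def by (subst (asm) AE_distr_iff) auto
qed

lemma nn_integral_r: "(\<integral>\<^sup>+z. ennreal (r (coarse z)) \<partial>(V \<Otimes>\<^sub>M P)) = 1"
proof -
  have "1 = (\<integral>\<^sup>+z. 1 \<partial>JU)" by (simp add: JU.emeasure_space_1)
  also have "\<dots> = (\<integral>\<^sup>+z. ennreal (r z) * 1 \<partial>R)"
    unfolding JU_density by (rule nn_integral_density) auto
  finally show ?thesis by (simp add: nn_integral_R)
qed

text \<open>Below, \<open>- ln r \<le> inverse r - 1\<close>, and \<open>inverse r\<close> has mean
  at most 1 since its denominator is the density of the law it is averaged over. Above,
  \<open>ln r\<close> splits into \<open>ln (r / \<rho>) + ln \<rho>\<close>, where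
  \<open>r / \<rho>\<close> has mean 1 under \<open>J\<close>. Thus finite information of the fine
  message passes to the coarse one.\<close>

lemma integrable_ln_r: "integrable J (\<lambda>z. ln (r (coarse z)))"
proof -
  define b where "b z = inverse (r (coarse z)) + r (coarse z) / \<rho> z + \<bar>ln (\<rho> z)\<bar>" for z
  have i1: "integrable J (\<lambda>z. inverse (r (coarse z)))"
  proof (rule integrableI_bounded)
    have "(\<integral>\<^sup>+z. ennreal (norm (inverse (r (coarse z)))) \<partial>J) = (\<integral>\<^sup>+z. ennreal (inverse (r z)) \<partial>JU)"
      by (simp add: nn_integral_JU r_nonneg)
    also have "\<dots> = (\<integral>\<^sup>+z. ennreal (r z) * ennreal (inverse (r z)) \<partial>R)"
      unfolding JU_density by (rule nn_integral_density) auto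
    also have "\<dots> \<le> (\<integral>\<^sup>+z. 1 \<partial>R)"
      by (intro nn_integral_mono) (auto simp: ennreal_mult[symmetric] r_nonneg field_simps ennreal_le_1)
    also have "\<dots> < \<infinity>" by (simp add: R.emeasure_space_1)
    finally show "(\<integral>\<^sup>+z. ennreal (norm (inverse (r (coarse z)))) \<partial>J) < \<infinity>" .
  qed auto
  have i2: "integrable J (\<lambda>z. r (coarse z) / \<rho> z)"
  proof (rule integrableI_bounded)
    have "(\<integral>\<^sup>+z. ennreal (norm (r (coarse z) / \<rho> z)) \<partial>J) = (\<integral>\<^sup>+z. ennreal (r (coarse z)) \<partial>(V \<Otimes>\<^sub>M P))"
      using \<rho>_pos by (subst nn_integral_J)
        (auto intro!: nn_integral_cong simp: ennreal_mult[symmetric] r_nonneg less_imp_le less_imp_neq[symmetric])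
    then show "(\<integral>\<^sup>+z. ennreal (norm (r (coarse z) / \<rho> z)) \<partial>J) < \<infinity>" by (simp add: nn_integral_r)
  qed auto
  have "integrable J b"
    unfolding b_def using i1 i2 ln_\<rho> by (intro Bochner_Integration.integrable_add integrable_abs) (auto simp: J_def)
  then show ?thesis
  proof (rule Bochner_Integration.integrable_bound)
    show "AE z in J. norm (ln (r (coarse z))) \<le> norm (b z)"
      using AE_r_pos
    proof eventually_elim
      case (elim z)
      let ?r = "r (coarse z)"
      have b0: "0 \<le> b z" using \<rho>_pos[of z] elim by (simp add: b_def)
      have "\<bar>ln ?r\<bar> \<le> b z"
      proof (cases "?r \<le> 1")
        case True
        have "- ln ?r = ln (inverse ?r)" using elim by (simp add: ln_inverse)
        also have "\<dots> \<le> inverse ?r - 1" using elim by (intro ln_le_minus_one) simp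
        finally show ?thesis using True elim \<rho>_pos[of z] unfolding b_def
          by (auto simp: abs_of_nonpos intro!: add_increasing2)
      next
        case False
        have "ln ?r = ln (?r / \<rho> z) + ln (\<rho> z)" using elim \<rho>_pos[of z] by (simp add: ln_div)
        also have "\<dots> \<le> (?r / \<rho> z - 1) + \<bar>ln (\<rho> z)\<bar>"
          using elim \<rho>_pos[of z] by (intro add_mono ln_le_minus_one) auto
        finally have "ln ?r \<le> ?r / \<rho> z + \<bar>ln (\<rho> z)\<bar>" by simp
        moreover have "0 \<le> inverse ?r" "0 \<le> ln ?r" using False elim by auto
        ultimately show ?thesis unfolding b_def by linarith
      qed
      then show ?case using b0 by simp
    qed
  qed auto
qed

text \<open>Conditional independence of fine message and output given the coarse message: in the law with density \<open>r\<close>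
  the fine message enters only through the conditional probability \<open>q\<close> of \<open>S\<close> given the coarse message.\<close>

lemma nn_integral_r_conditional:
  assumes [measurable]: "S \<in> sets V" and q [measurable]: "q \<in> borel_measurable U"
    and q_eq: "\<And>\<phi>. \<phi> \<in> borel_measurable U \<Longrightarrow>
      (\<integral>\<^sup>+v. indicator S v * \<phi> (\<pi> v) \<partial>V) = (\<integral>\<^sup>+v. q (\<pi> v) * \<phi> (\<pi> v) \<partial>V)"
    and [measurable]: "\<psi> \<in> borel_measurable P"
  shows "(\<integral>\<^sup>+z. ennreal (r (coarse z)) * (indicator S (fst z) * \<psi> (snd z)) \<partial>(V \<Otimes>\<^sub>M P))
    = (\<integral>\<^sup>+z. q (\<pi> (fst z)) * \<psi> (snd z) \<partial>J)"
proof -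
  define \<phi> where "\<phi> u = (\<integral>\<^sup>+y. ennreal (r (u, y)) * \<psi> y \<partial>P)" for u
  have [measurable]: "\<phi> \<in> borel_measurable U" unfolding \<phi>_def by measurable
  have "(\<integral>\<^sup>+z. ennreal (r (coarse z)) * (indicator S (fst z) * \<psi> (snd z)) \<partial>(V \<Otimes>\<^sub>M P))
      = (\<integral>\<^sup>+v. \<integral>\<^sup>+y. ennreal (r (\<pi> v, y)) * (indicator S v * \<psi> y) \<partial>P \<partial>V)"
    by (subst P.nn_integral_fst[symmetric]) (auto simp: coarse_def)
  also have "\<dots> = (\<integral>\<^sup>+v. indicator S v * \<phi> (\<pi> v) \<partial>V)"
  proof (intro nn_integral_cong)
    fix v assume [measurable]: "v \<in> space V"
    show "(\<integral>\<^sup>+y. ennreal (r (\<pi> v, y)) * (indicator S v * \<psi> y) \<partial>P) = indicator S v * \<phi> (\<pi> v)"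
      unfolding \<phi>_def by (subst nn_integral_cmult[symmetric]) (auto simp: mult_ac)
  qed
  also have "\<dots> = (\<integral>\<^sup>+v. q (\<pi> v) * \<phi> (\<pi> v) \<partial>V)" by (rule q_eq) simp
  also have "\<dots> = (\<integral>\<^sup>+v. \<integral>\<^sup>+y. ennreal (r (\<pi> v, y)) * (q (\<pi> v) * \<psi> y) \<partial>P \<partial>V)"
  proof (intro nn_integral_cong)
    fix v assume [measurable]: "v \<in> space V"
    show "q (\<pi> v) * \<phi> (\<pi> v) = (\<integral>\<^sup>+y. ennreal (r (\<pi> v, y)) * (q (\<pi> v) * \<psi> y) \<partial>P)"
      unfolding \<phi>_def by (subst nn_integral_cmult[symmetric]) (auto simp: mult_ac)
  qed
  also have "\<dots> = (\<integral>\<^sup>+z. ennreal (r (coarse z)) * (q (fst (coarse z)) * \<psi> (snd (coarse z))) \<partial>(V \<Otimes>\<^sub>M P))"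
    by (subst P.nn_integral_fst[symmetric]) (auto simp: coarse_def)
  also have "\<dots> = (\<integral>\<^sup>+z. ennreal (r z) * (q (fst z) * \<psi> (snd z)) \<partial>R)"
    by (subst nn_integral_R) auto
  also have "\<dots> = (\<integral>\<^sup>+z. q (fst z) * \<psi> (snd z) \<partial>JU)"
    unfolding JU_density by (subst nn_integral_density) auto
  also have "\<dots> = (\<integral>\<^sup>+z. q (\<pi> (fst z)) * \<psi> (snd z) \<partial>J)"
    by (subst nn_integral_JU) (auto simp: coarse_def split_def)
  finally show ?thesis .
qed

text \<open>Here \<open>q\<close> is the probability of the single event \<open>S\<close> given the
  coarse message, a Radon-Nikodym derivative on \<open>U\<close>. One event at a time suffices for
  comparing measures on rectangles, so the message space can be any measurable space.\<close>

lemma conditional_probability_exists: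
  assumes [measurable]: "S \<in> sets V"
  obtains q where "q \<in> borel_measurable U"
    "\<And>\<phi>. \<phi> \<in> borel_measurable U \<Longrightarrow>
      (\<integral>\<^sup>+v. indicator S v * \<phi> (\<pi> v) \<partial>V) = (\<integral>\<^sup>+v. q (\<pi> v) * \<phi> (\<pi> v) \<partial>V)"
proof
  define \<mu> where "\<mu> = distr (density V (indicator S)) U \<pi>"
  define q where "q = RN_deriv (distr V U \<pi>) \<mu>"
  have [measurable_cong, simp]: "sets \<mu> = sets U" by (simp add: \<mu>_def)
  have "q \<in> borel_measurable (distr V U \<pi>)" unfolding q_def by simp
  then show q [measurable]: "q \<in> borel_measurable U" by simp
  have "absolutely_continuous (distr V U \<pi>) \<mu>"
    unfolding absolutely_continuous_def
  proof
    fix N assume N: "N \<in> null_sets (distr V U \<pi>)"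
    then have [measurable]: "N \<in> sets U" by (auto simp: null_sets_def)
    have "AE u in distr V U \<pi>. u \<notin> N" using N by (rule AE_not_in)
    then have "AE v in V. \<pi> v \<notin> N" by (subst (asm) AE_distr_iff) auto
    then have "AE v in density V (indicator S). \<pi> v \<notin> N" by (subst AE_density) auto
    then have "AE u in \<mu>. u \<notin> N" unfolding \<mu>_def by (subst AE_distr_iff) auto
    then show "N \<in> null_sets \<mu>" by (subst (asm) AE_iff_null_sets[symmetric]) auto
  qed
  then have d: "density (distr V U \<pi>) q = \<mu>"
    unfolding q_def by (rule PU.density_RN_deriv) simp
  fix \<phi> :: "'u \<Rightarrow> ennreal" assume [measurable]: "\<phi> \<in> borel_measurable U"
  have "(\<integral>\<^sup>+v. indicator S v * \<phi> (\<pi> v) \<partial>V) = (\<integral>\<^sup>+v. \<phi> (\<pi> v) \<partial>density V (indicator S))"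
    by (subst nn_integral_density) auto
  also have "\<dots> = (\<integral>\<^sup>+u. \<phi> u \<partial>\<mu>)" unfolding \<mu>_def by (subst nn_integral_distr) auto
  also have "\<dots> = (\<integral>\<^sup>+u. q u * \<phi> u \<partial>distr V U \<pi>)"
    unfolding d[symmetric] by (subst nn_integral_density) auto
  also have "\<dots> = (\<integral>\<^sup>+v. q (\<pi> v) * \<phi> (\<pi> v) \<partial>V)" by (subst nn_integral_distr) auto
  finally show "(\<integral>\<^sup>+v. indicator S v * \<phi> (\<pi> v) \<partial>V) = (\<integral>\<^sup>+v. q (\<pi> v) * \<phi> (\<pi> v) \<partial>V)" .
qed

text \<open>\<open>ac\<close> and \<open>integrable_ln_r\<close> select the finite branch of
  \<open>mutual_info\<close>; dividing by \<open>ln 2\<close> passes from nats to bits.\<close>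

lemma mutual_info_eq:
  assumes M: "prob_space M" and "distr M (U \<Otimes>\<^sub>M T) (\<lambda>\<omega>. (X \<omega>, Y \<omega>)) = JU"
    and "distr M U X = distr V U \<pi>" and "distr M T Y = P"
  shows "mutual_info M U T X Y = ereal ((\<integral>z. ln (r (coarse z)) \<partial>J) / ln 2)"
proof -
  have e: "entropy_density 2 R JU = (\<lambda>z. ln (r z) / ln 2)"
    by (auto simp: entropy_density_def r_def log_def fun_eq_iff)
  have i: "integrable JU (entropy_density 2 R JU)"
    unfolding e using integrable_ln_r by (subst JU_def, subst integrable_distr_eq) auto
  have "(\<integral>z. entropy_density 2 R JU z \<partial>JU) = (\<integral>z. ln (r (coarse z)) \<partial>J) / ln 2"
    unfolding e by (subst JU_def, subst integral_distr) auto
  then show ?thesis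
    using ac i
    by (simp add: mutual_info_def assms R_def[symmetric] prob_space.mutual_information_def[OF M] KL_divergence_def)
qed

end

text \<open>\<open>\<rho>\<close> over \<open>r\<close> is the density of the joint law relative to
  the law with density \<open>r\<close>, under which fine message and output are independent given
  the coarse message. The kernel \<kappa> carries joint law to joint law by \<open>link\<close>, and
  conditionally independent law to conditionally independent law by \<open>eq\<close>; hence the
  relative entropy between the two cannot increase.\<close>

lemma data_processing:
  assumes "channel_density V P U \<pi> \<rho>" and "channel_density V P' U \<pi> \<sigma>"
    and "prob_space N" and \<kappa>: "\<kappa> \<in> measurable (P \<Otimes>\<^sub>M N) P'"
    and link: "channel_density.J V P' \<sigma> =
      distr (channel_density.J V P \<rho> \<Otimes>\<^sub>M N) (V \<Otimes>\<^sub>M P') (\<lambda>((v, y), w). (v, \<kappa> (y, w)))"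
  shows "(\<integral>z. ln (channel_density.r V P U \<pi> \<rho> (channel_density.coarse \<pi> z)) \<partial>channel_density.J V P \<rho>)
       - (\<integral>z. ln (channel_density.r V P' U \<pi> \<sigma> (channel_density.coarse \<pi> z)) \<partial>channel_density.J V P' \<sigma>)
     \<le> (\<integral>z. ln (\<rho> z) \<partial>channel_density.J V P \<rho>) - (\<integral>z. ln (\<sigma> z) \<partial>channel_density.J V P' \<sigma>)"
proof -
  interpret Y: channel_density V P U \<pi> \<rho> by fact
  interpret Z: channel_density V P' U \<pi> \<sigma> by fact
  interpret N: prob_space N by fact
  note [measurable] = \<kappa>
  define f where "f = (\<lambda>z. (fst (fst z) :: 'a, \<kappa> (snd (fst z), snd z)))"
  have f [measurable]: "f \<in> measurable ((V \<Otimes>\<^sub>M P) \<Otimes>\<^sub>M N) (V \<Otimes>\<^sub>M P')"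
    unfolding f_def by measurable
  have link: "Z.J = distr (Y.J \<Otimes>\<^sub>M N) (V \<Otimes>\<^sub>M P') f"
    using link by (simp add: f_def split_def)
  let ?R = "density (V \<Otimes>\<^sub>M P) (\<lambda>z. ennreal (Y.r (Y.coarse z)))"
  let ?S = "density (V \<Otimes>\<^sub>M P') (\<lambda>z. ennreal (Z.r (Z.coarse z)))"
  have nnR: "(\<integral>\<^sup>+z. h z \<partial>?R) = (\<integral>\<^sup>+z. ennreal (Y.r (Y.coarse z)) * h z \<partial>(V \<Otimes>\<^sub>M P))"
    if "h \<in> borel_measurable (V \<Otimes>\<^sub>M P)" for h
    using that by (intro nn_integral_density) auto
  have nnS: "(\<integral>\<^sup>+z. h z \<partial>?S) = (\<integral>\<^sup>+z. ennreal (Z.r (Z.coarse z)) * h z \<partial>(V \<Otimes>\<^sub>M P'))"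
    if "h \<in> borel_measurable (V \<Otimes>\<^sub>M P')" for h
    using that by (intro nn_integral_density) auto
  \<comment> \<open>\<open>link\<close> speaks of the joint laws only. On a rectangle
    \<open>nn_integral_r_conditional\<close> turns both sides into integrals against the joint laws,
    with the same \<open>q\<close> because both outputs share \<open>V\<close> and \<pi>; there
    \<open>link\<close> applies.\<close>
  have eq: "distr (?R \<Otimes>\<^sub>M N) (V \<Otimes>\<^sub>M P') f = ?S"
  proof (rule measure_eqI_generator_eq[OF Int_stable_pair_measure_generator[of V P'] pair_measure_closed])
    show "sets (distr (?R \<Otimes>\<^sub>M N) (V \<Otimes>\<^sub>M P') f) = sigma_sets (space V \<times> space P') {a \<times> b |a b. a \<in> sets V \<and> b \<in> sets P'}"
      "sets ?S = sigma_sets (space V \<times> space P') {a \<times> b |a b. a \<in> sets V \<and> b \<in> sets P'}"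
      by (simp_all add: sets_pair_measure)
    show "range (\<lambda>_ :: nat. space V \<times> space P') \<subseteq> {a \<times> b |a b. a \<in> sets V \<and> b \<in> sets P'}" by auto
    show "(\<Union>i :: nat. space V \<times> space P') = space V \<times> space P'" by simp
    fix X assume "X \<in> {a \<times> b |a b. a \<in> sets V \<and> b \<in> sets P'}"
    then obtain S B where X: "X = S \<times> B" and [measurable]: "S \<in> sets V" "B \<in> sets P'" by auto
    obtain q where q [measurable]: "q \<in> borel_measurable U" and q_eq:
      "\<And>\<phi>. \<phi> \<in> borel_measurable U \<Longrightarrow>
      (\<integral>\<^sup>+v. indicator S v * \<phi> (\<pi> v) \<partial>V) = (\<integral>\<^sup>+v. q (\<pi> v) * \<phi> (\<pi> v) \<partial>V)"
      using Y.conditional_probability_exists[OF \<open>S \<in> sets V\<close>] by metis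
    define \<psi> where "\<psi> y = (\<integral>\<^sup>+w. indicator B (\<kappa> (y, w)) \<partial>N)" for y
    have [measurable]: "\<psi> \<in> borel_measurable P" unfolding \<psi>_def by measurable
    have "emeasure (distr (?R \<Otimes>\<^sub>M N) (V \<Otimes>\<^sub>M P') f) X
        = (\<integral>\<^sup>+z. indicator X z \<partial>distr (?R \<Otimes>\<^sub>M N) (V \<Otimes>\<^sub>M P') f)" by (simp add: X)
    also have "\<dots> = (\<integral>\<^sup>+z. indicator X (f z) \<partial>(?R \<Otimes>\<^sub>M N))"
      by (rule nn_integral_distr) (auto simp: X)
    also have "\<dots> = (\<integral>\<^sup>+z. \<integral>\<^sup>+w. indicator X (f (z, w)) \<partial>N \<partial>?R)"
      by (subst N.nn_integral_fst) (auto simp: X)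
    also have "\<dots> = (\<integral>\<^sup>+z. indicator S (fst z) * \<psi> (snd z) \<partial>?R)"
    proof (rule nn_integral_cong)
      fix z assume "z \<in> space ?R"
      then have [measurable]: "fst z \<in> space V" "snd z \<in> space P" by (auto simp: space_pair_measure)
      show "(\<integral>\<^sup>+w. indicator X (f (z, w)) \<partial>N) = indicator S (fst z) * \<psi> (snd z)"
        unfolding \<psi>_def
        by (subst nn_integral_cmult[symmetric]) (auto simp: X f_def split_def indicator_times)
    qed
    also have "\<dots> = (\<integral>\<^sup>+z. q (\<pi> (fst z)) * \<psi> (snd z) \<partial>Y.J)"
      by (subst nnR) (simp_all add: Y.nn_integral_r_conditional[OF _ q q_eq])
    also have "\<dots> = (\<integral>\<^sup>+z. \<integral>\<^sup>+w. q (\<pi> (fst z)) * indicator B (\<kappa> (snd z, w)) \<partial>N \<partial>Y.J)"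
    proof (rule nn_integral_cong)
      fix z assume "z \<in> space Y.J"
      then have [measurable]: "fst z \<in> space V" "snd z \<in> space P" by (auto simp: space_pair_measure)
      show "q (\<pi> (fst z)) * \<psi> (snd z) = (\<integral>\<^sup>+w. q (\<pi> (fst z)) * indicator B (\<kappa> (snd z, w)) \<partial>N)"
        unfolding \<psi>_def by (subst nn_integral_cmult) auto
    qed
    also have "\<dots> = (\<integral>\<^sup>+z. q (\<pi> (fst (f z))) * indicator B (snd (f z)) \<partial>(Y.J \<Otimes>\<^sub>M N))"
      by (subst N.nn_integral_fst[symmetric]) (auto simp: f_def split_def)
    also have "\<dots> = (\<integral>\<^sup>+z. q (\<pi> (fst z)) * indicator B (snd z) \<partial>Z.J)"
      unfolding link by (rule nn_integral_distr[symmetric]) measurable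
    also have "\<dots> = (\<integral>\<^sup>+z. indicator S (fst z) * indicator B (snd z) \<partial>?S)"
      by (subst nnS) (simp_all add: Z.nn_integral_r_conditional[OF _ q q_eq])
    also have "\<dots> = (\<integral>\<^sup>+z. indicator X z \<partial>?S)"
      by (simp add: X indicator_times)
    also have "\<dots> = emeasure ?S X" by (simp add: X)
    finally show "emeasure (distr (?R \<Otimes>\<^sub>M N) (V \<Otimes>\<^sub>M P') f) X = emeasure ?S X" .
  next
    have "emeasure (distr (?R \<Otimes>\<^sub>M N) (V \<Otimes>\<^sub>M P') f) (space V \<times> space P') \<le> emeasure (?R \<Otimes>\<^sub>M N) (space (?R \<Otimes>\<^sub>M N))"
      using emeasure_space[of "?R \<Otimes>\<^sub>M N"] by (simp add: emeasure_distr)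
    also have "\<dots> = emeasure ?R (space ?R) * emeasure N (space N)"
      unfolding space_pair_measure[of ?R N] by (rule N.emeasure_pair_measure_Times) auto
    also have "\<dots> = 1"
      using nnR[of "\<lambda>_. 1"] Y.nn_integral_r by (simp add: N.emeasure_space_1)
    finally show "emeasure (distr (?R \<Otimes>\<^sub>M N) (V \<Otimes>\<^sub>M P') f) (space V \<times> space P') \<noteq> \<infinity>" for i :: nat
      by (auto simp: top_unique)
  qed
  have JN: "prob_space (Y.J \<Otimes>\<^sub>M N)" by (rule prob_space_pair) unfold_locales
  interpret JN: prob_space "Y.J \<Otimes>\<^sub>M N" by (rule JN)
  define a where "a z = ln (Y.r (Y.coarse z)) - ln (\<rho> z)" for z
  define b where "b z = ln (\<sigma> z) - ln (Z.r (Z.coarse z))" for z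
  have ia: "integrable Y.J a" and ib: "integrable Z.J b"
    unfolding a_def b_def using Y.integrable_ln_r Y.ln_\<rho> Z.integrable_ln_r Z.ln_\<rho>
    by (auto simp: Y.J_def Z.J_def)
  have [measurable]: "a \<in> borel_measurable (V \<Otimes>\<^sub>M P)" "b \<in> borel_measurable (V \<Otimes>\<^sub>M P')"
    unfolding a_def b_def by measurable
  have fst_JN: "distr (Y.J \<Otimes>\<^sub>M N) Y.J fst = Y.J" by (rule N.distr_pair_fst)
  have iA: "integrable (Y.J \<Otimes>\<^sub>M N) (\<lambda>z. a (fst z))" and IA: "(\<integral>z. a (fst z) \<partial>(Y.J \<Otimes>\<^sub>M N)) = (\<integral>z. a z \<partial>Y.J)"
    using ia integrable_distr_eq[of fst "Y.J \<Otimes>\<^sub>M N" Y.J a] integral_distr[of fst "Y.J \<Otimes>\<^sub>M N" Y.J a]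
    by (simp_all add: fst_JN)
  have iB: "integrable (Y.J \<Otimes>\<^sub>M N) (\<lambda>z. b (f z))" and IB: "(\<integral>z. b (f z) \<partial>(Y.J \<Otimes>\<^sub>M N)) = (\<integral>z. b z \<partial>Z.J)"
    using ib integrable_distr_eq[of f "Y.J \<Otimes>\<^sub>M N" "V \<Otimes>\<^sub>M P'" b] integral_distr[of f "Y.J \<Otimes>\<^sub>M N" "V \<Otimes>\<^sub>M P'" b]
    by (simp_all add: link[symmetric])
  define h where "h z = ennreal (\<sigma> z / Z.r (Z.coarse z))" for z
  have [measurable]: "h \<in> borel_measurable (V \<Otimes>\<^sub>M P')" unfolding h_def by measurable
  have AE1: "AE z in Y.J \<Otimes>\<^sub>M N. 0 < Y.r (Y.coarse (fst z))"
  proof -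
    have "AE z in distr (Y.J \<Otimes>\<^sub>M N) Y.J fst. 0 < Y.r (Y.coarse z)" unfolding fst_JN by (rule Y.AE_r_pos)
    then show ?thesis by (subst (asm) AE_distr_iff) auto
  qed
  have AE2: "AE z in Y.J \<Otimes>\<^sub>M N. 0 < Z.r (Z.coarse (f z))"
  proof -
    have "AE z in distr (Y.J \<Otimes>\<^sub>M N) (V \<Otimes>\<^sub>M P') f. 0 < Z.r (Z.coarse z)" unfolding link[symmetric] by (rule Z.AE_r_pos)
    then show ?thesis by (subst (asm) AE_distr_iff) auto
  qed
  have "(\<integral>z. a (fst z) + b (f z) \<partial>(Y.J \<Otimes>\<^sub>M N)) \<le> 0"
  proof (rule JN.integral_nonpos_of_exp)
    show "integrable (Y.J \<Otimes>\<^sub>M N) (\<lambda>z. a (fst z) + b (f z))" using iA iB by simp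
    have "(\<integral>\<^sup>+z. ennreal (exp (a (fst z) + b (f z))) \<partial>(Y.J \<Otimes>\<^sub>M N))
        = (\<integral>\<^sup>+z. ennreal (Y.r (Y.coarse (fst z)) / \<rho> (fst z)) * h (f z) \<partial>(Y.J \<Otimes>\<^sub>M N))"
    proof (rule nn_integral_cong_AE, use AE1 AE2 in eventually_elim)
      case (elim z)
      then show ?case
        using Y.\<rho>_pos[of "fst z"] Z.\<rho>_pos[of "f z"]
        by (simp add: a_def b_def h_def exp_add exp_diff ennreal_mult[symmetric])
    qed
    also have "\<dots> = (\<integral>\<^sup>+z. \<integral>\<^sup>+w. ennreal (Y.r (Y.coarse z) / \<rho> z) * h (f (z, w)) \<partial>N \<partial>Y.J)"
      by (subst N.nn_integral_fst[symmetric]) auto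
    also have "\<dots> = (\<integral>\<^sup>+z. ennreal (Y.r (Y.coarse z) / \<rho> z) * (\<integral>\<^sup>+w. h (f (z, w)) \<partial>N) \<partial>Y.J)"
    proof (intro nn_integral_cong nn_integral_cmult)
      fix z assume "z \<in> space Y.J"
      then have [measurable]: "z \<in> space (V \<Otimes>\<^sub>M P)" by simp
      show "(\<lambda>w. h (f (z, w))) \<in> borel_measurable N" by measurable
    qed
    \<comment> \<open>The weight \<open>r / \<rho>\<close> cancels the density of \<open>Y.J\<close>
      and leaves \<open>?R\<close>, whose image under the kernel is known from
      \<open>eq\<close>.\<close>
    also have "\<dots> = (\<integral>\<^sup>+z. ennreal (Y.r (Y.coarse z)) * (\<integral>\<^sup>+w. h (f (z, w)) \<partial>N) \<partial>(V \<Otimes>\<^sub>M P))"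
    proof (subst Y.nn_integral_J, measurable, intro nn_integral_cong)
      fix z
      have "ennreal (\<rho> z) * ennreal (Y.r (Y.coarse z) / \<rho> z) = ennreal (Y.r (Y.coarse z))"
        using Y.\<rho>_pos[of z] by (simp add: ennreal_mult[symmetric] Y.r_nonneg)
      then show "ennreal (\<rho> z) * (ennreal (Y.r (Y.coarse z) / \<rho> z) * (\<integral>\<^sup>+w. h (f (z, w)) \<partial>N))
          = ennreal (Y.r (Y.coarse z)) * (\<integral>\<^sup>+w. h (f (z, w)) \<partial>N)"
        by (simp add: mult.assoc[symmetric])
    qed
    also have "\<dots> = (\<integral>\<^sup>+z. \<integral>\<^sup>+w. h (f (z, w)) \<partial>N \<partial>?R)" by (subst nnR) auto
    also have "\<dots> = (\<integral>\<^sup>+z. h (f z) \<partial>(?R \<Otimes>\<^sub>M N))" by (subst N.nn_integral_fst) auto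
    also have "\<dots> = (\<integral>\<^sup>+z. h z \<partial>?S)" unfolding eq[symmetric] by (rule nn_integral_distr[symmetric]) auto
    also have "\<dots> = (\<integral>\<^sup>+z. ennreal (Z.r (Z.coarse z)) * h z \<partial>(V \<Otimes>\<^sub>M P'))" by (rule nnS) simp
    \<comment> \<open>An inequality and not an equation: where \<open>Z.r\<close> vanishes the left
      side is 0, and the mass of \<sigma> there is dropped.\<close>
    also have "\<dots> \<le> (\<integral>\<^sup>+z. ennreal (\<sigma> z) \<partial>(V \<Otimes>\<^sub>M P'))"
    proof (rule nn_integral_mono)
      fix z
      show "ennreal (Z.r (Z.coarse z)) * h z \<le> ennreal (\<sigma> z)"
        using Z.\<rho>_pos[of z] Z.r_nonneg[of "Z.coarse z"]
        by (cases "Z.r (Z.coarse z) = 0") (auto simp: h_def ennreal_mult[symmetric])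
    qed
    also have "\<dots> = 1" by (rule Z.\<rho>_prob)
    finally show "(\<integral>\<^sup>+z. ennreal (exp (a (fst z) + b (f z))) \<partial>(Y.J \<Otimes>\<^sub>M N)) \<le> 1" .
  qed
  also have "(\<integral>z. a (fst z) + b (f z) \<partial>(Y.J \<Otimes>\<^sub>M N)) = (\<integral>z. a z \<partial>Y.J) + (\<integral>z. b z \<partial>Z.J)"
    using iA iB by (simp add: IA IB)
  also have "(\<integral>z. a z \<partial>Y.J) = (\<integral>z. ln (Y.r (Y.coarse z)) \<partial>Y.J) - (\<integral>z. ln (\<rho> z) \<partial>Y.J)"
    unfolding a_def using Y.integrable_ln_r Y.ln_\<rho> by (intro Bochner_Integration.integral_diff) (auto simp: Y.J_def)
  also have "(\<integral>z. b z \<partial>Z.J) = (\<integral>z. ln (\<sigma> z) \<partial>Z.J) - (\<integral>z. ln (Z.r (Z.coarse z)) \<partial>Z.J)"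
    unfolding b_def using Z.integrable_ln_r Z.ln_\<rho> by (intro Bochner_Integration.integral_diff) (auto simp: Z.J_def)
  finally show ?thesis by linarith
qed

section \<open>Additive Gaussian noise\<close>

lemma ln_gauss_density: "ln (gauss_density (w :: 'a::euclidean_space)) = - (norm w)\<^sup>2 - DIM('a) * ln pi / 2"
  by (simp add: gauss_density_def ln_div ln_realpow ln_sqrt)

lemma gauss_density_nonneg [simp]: "0 \<le> gauss_density w"
  by (simp add: gauss_density_pos less_imp_le)

lemma exp_ln_gauss_density [simp]: "exp (ln (gauss_density w)) = gauss_density w"
  by (simp add: gauss_density_pos)

lemma norm_diff_square_le: "(norm (a - b))\<^sup>2 \<le> 2 * (norm a)\<^sup>2 + 2 * (norm (b :: 'b::real_inner))\<^sup>2"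
proof -
  have "(norm (a + b))\<^sup>2 + (norm (a - b))\<^sup>2 = 2 * (norm a)\<^sup>2 + 2 * (norm b)\<^sup>2"
    by (simp add: power2_norm_eq_inner algebra_simps)
  then show ?thesis using zero_le_power2[of "norm (a + b)"] by linarith
qed

text \<open>\<open>s v\<close> is the received signal before the noise is added. Whatever the law of
  \<open>s\<close>, the noise makes the output density \<open>f\<close> positive and bounded; the
  second moment makes \<open>ln f\<close> integrable. \<open>\<rho>\<close> is then the likelihood
  ratio that \<open>channel_density\<close> asks for.\<close>

locale gaussian_channel = V: prob_space V
  for V :: "'v measure" +
  fixes s :: "'v \<Rightarrow> 'b::euclidean_space"
  assumes s [measurable]: "s \<in> borel_measurable V"
    and s_square: "integrable V (\<lambda>v. (norm (s v))\<^sup>2)"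
begin

definition "f y = (\<integral>v. gauss_density (y - s v) \<partial>V)"
definition "P = density lborel (\<lambda>y. ennreal (f y))"
definition "\<rho> = (\<lambda>(v, y). gauss_density (y - s v) / f y)"

lemma sets_P [measurable_cong, simp]: "sets P = sets borel" by (simp add: P_def)

lemma space_P [simp]: "space P = UNIV" by (simp add: P_def)

lemma gauss_density_le: "gauss_density (w :: 'b) \<le> 1 / sqrt pi ^ DIM('b)"
  by (simp add: gauss_density_def divide_right_mono)

lemma integrable_gauss_density: "integrable V (\<lambda>v. gauss_density (y - s v))"
  using gauss_density_le gauss_density_pos
  by (intro V.integrable_const_bound[where B="1 / sqrt pi ^ DIM('b)"]) (auto simp: less_imp_le)

lemma f_measurable [measurable]: "f \<in> borel_measurable borel"
  unfolding f_def[abs_def] by measurable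

lemma f_pos: "0 < f y"
  unfolding f_def using integrable_gauss_density gauss_density_pos
  by (intro V.expectation_greater) auto

lemma ennreal_f: "ennreal (f y) = (\<integral>\<^sup>+v. ennreal (gauss_density (y - s v)) \<partial>V)"
  unfolding f_def using integrable_gauss_density gauss_density_pos
  by (intro nn_integral_eq_integral[symmetric]) (auto simp: less_imp_le)

lemma f_le: "f y \<le> 1 / sqrt pi ^ DIM('b)"
  unfolding f_def using gauss_density_le by (intro V.integral_le_const integrable_gauss_density) auto

lemma \<rho>_measurable [measurable]: "\<rho> \<in> borel_measurable (V \<Otimes>\<^sub>M borel)"
  unfolding \<rho>_def by measurable

lemma \<rho>_pos: "0 < \<rho> z"
  by (simp add: \<rho>_def split_def gauss_density_pos f_pos)

lemma nn_integral_P: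
  assumes [measurable]: "h \<in> borel_measurable borel"
  shows "(\<integral>\<^sup>+y. h y \<partial>P) = (\<integral>\<^sup>+y. ennreal (f y) * h y \<partial>lborel)"
  unfolding P_def by (rule nn_integral_density) auto

lemma nn_integral_output:
  assumes [measurable]: "h \<in> borel_measurable (V \<Otimes>\<^sub>M borel)"
  shows "(\<integral>\<^sup>+z. h (fst z, s (fst z) + snd z) \<partial>(V \<Otimes>\<^sub>M gauss))
    = (\<integral>\<^sup>+v. \<integral>\<^sup>+y. ennreal (gauss_density (y - s v)) * h (v, y) \<partial>lborel \<partial>V)"
proof -
  have "(\<integral>\<^sup>+z. h (fst z, s (fst z) + snd z) \<partial>(V \<Otimes>\<^sub>M gauss)) = (\<integral>\<^sup>+v. \<integral>\<^sup>+w. h (v, s v + w) \<partial>gauss \<partial>V)"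
    by (subst gauss.nn_integral_fst[symmetric]) auto
  also have "\<dots> = (\<integral>\<^sup>+v. \<integral>\<^sup>+y. ennreal (gauss_density (y - s v)) * h (v, y) \<partial>lborel \<partial>V)"
  proof (rule nn_integral_cong)
    fix v assume [measurable]: "v \<in> space V"
    have "(\<integral>\<^sup>+w. h (v, s v + w) \<partial>gauss) = (\<integral>\<^sup>+w. ennreal (gauss_density w) * h (v, s v + w) \<partial>lborel)"
      by (rule nn_integral_gauss) measurable
    also have "\<dots> = (\<integral>\<^sup>+y. ennreal (gauss_density (y - s v)) * h (v, y) \<partial>lborel)"
      using nn_integral_lborel_translate[of "\<lambda>y. ennreal (gauss_density (y - s v)) * h (v, y)" "s v"] by simp
    finally show "(\<integral>\<^sup>+w. h (v, s v + w) \<partial>gauss) = (\<integral>\<^sup>+y. ennreal (gauss_density (y - s v)) * h (v, y) \<partial>lborel)" .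
  qed
  finally show ?thesis .
qed

lemma nn_integral_output_P:
  assumes [measurable]: "h \<in> borel_measurable borel"
  shows "(\<integral>\<^sup>+z. h (s (fst z) + snd z) \<partial>(V \<Otimes>\<^sub>M gauss)) = (\<integral>\<^sup>+y. h y \<partial>P)"
proof -
  interpret VL: pair_sigma_finite V lborel by unfold_locales
  have "(\<integral>\<^sup>+z. h (s (fst z) + snd z) \<partial>(V \<Otimes>\<^sub>M gauss))
      = (\<integral>\<^sup>+v. \<integral>\<^sup>+y. ennreal (gauss_density (y - s v)) * h y \<partial>lborel \<partial>V)"
    using nn_integral_output[of "\<lambda>z. h (snd z)"] by simp
  also have "\<dots> = (\<integral>\<^sup>+y. \<integral>\<^sup>+v. ennreal (gauss_density (y - s v)) * h y \<partial>V \<partial>lborel)"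
    by (rule VL.Fubini'[symmetric]) measurable
  also have "\<dots> = (\<integral>\<^sup>+y. h y \<partial>P)"
    by (simp add: nn_integral_multc ennreal_f[symmetric] nn_integral_P)
  finally show ?thesis .
qed

lemma distr_output: "distr (V \<Otimes>\<^sub>M gauss) borel (\<lambda>z. s (fst z) + snd z) = P"
proof (rule measure_eqI)
  fix A assume "A \<in> sets (distr (V \<Otimes>\<^sub>M gauss) borel (\<lambda>z. s (fst z) + snd z))"
  then have [measurable]: "A \<in> sets borel" by simp
  have "emeasure (distr (V \<Otimes>\<^sub>M gauss) borel (\<lambda>z. s (fst z) + snd z)) A
     = (\<integral>\<^sup>+y. indicator A y \<partial>distr (V \<Otimes>\<^sub>M gauss) borel (\<lambda>z. s (fst z) + snd z))" by simp
  also have "\<dots> = (\<integral>\<^sup>+z. indicator A (s (fst z) + snd z) \<partial>(V \<Otimes>\<^sub>M gauss))"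
    by (rule nn_integral_distr) auto
  also have "\<dots> = emeasure P A"
    by (subst nn_integral_output_P) auto
  finally show "emeasure (distr (V \<Otimes>\<^sub>M gauss) borel (\<lambda>z. s (fst z) + snd z)) A = emeasure P A" .
qed simp

lemma prob_space_VG: "prob_space (V \<Otimes>\<^sub>M gauss)"
  by (rule prob_space_pair) unfold_locales

sublocale P: prob_space P
  unfolding distr_output[symmetric] by (rule prob_space.prob_space_distr[OF prob_space_VG]) measurable

lemma sets_VP [measurable_cong, simp]: "sets (V \<Otimes>\<^sub>M P) = sets (V \<Otimes>\<^sub>M borel)"
  by (intro sets_pair_measure_cong) auto

lemma nn_integral_joint:
  assumes [measurable]: "h \<in> borel_measurable (V \<Otimes>\<^sub>M borel)"
  shows "(\<integral>\<^sup>+z. ennreal (\<rho> z) * h z \<partial>(V \<Otimes>\<^sub>M P)) = (\<integral>\<^sup>+z. h (fst z, s (fst z) + snd z) \<partial>(V \<Otimes>\<^sub>M gauss))"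
proof -
  have "(\<integral>\<^sup>+z. ennreal (\<rho> z) * h z \<partial>(V \<Otimes>\<^sub>M P)) = (\<integral>\<^sup>+v. \<integral>\<^sup>+y. ennreal (\<rho> (v, y)) * h (v, y) \<partial>P \<partial>V)"
    by (subst P.nn_integral_fst[symmetric]) auto
  also have "\<dots> = (\<integral>\<^sup>+v. \<integral>\<^sup>+y. ennreal (gauss_density (y - s v)) * h (v, y) \<partial>lborel \<partial>V)"
  proof (rule nn_integral_cong)
    fix v assume [measurable]: "v \<in> space V"
    have "(\<integral>\<^sup>+y. ennreal (\<rho> (v, y)) * h (v, y) \<partial>P) = (\<integral>\<^sup>+y. ennreal (f y) * (ennreal (\<rho> (v, y)) * h (v, y)) \<partial>lborel)"
      by (rule nn_integral_P) measurable
    also have "\<dots> = (\<integral>\<^sup>+y. ennreal (gauss_density (y - s v)) * h (v, y) \<partial>lborel)"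
    proof (rule nn_integral_cong)
      fix y
      have "ennreal (f y) * ennreal (\<rho> (v, y)) = ennreal (gauss_density (y - s v))"
        using f_pos[of y] gauss_density_pos[of "y - s v"] by (simp add: \<rho>_def ennreal_mult[symmetric])
      then show "ennreal (f y) * (ennreal (\<rho> (v, y)) * h (v, y)) = ennreal (gauss_density (y - s v)) * h (v, y)"
        by (simp add: mult.assoc[symmetric])
    qed
    finally show "(\<integral>\<^sup>+y. ennreal (\<rho> (v, y)) * h (v, y) \<partial>P)
      = (\<integral>\<^sup>+y. ennreal (gauss_density (y - s v)) * h (v, y) \<partial>lborel)" .
  qed
  finally show ?thesis by (simp add: nn_integral_output)
qed

definition "out = (\<lambda>z. (fst z, s (fst z) + snd z))"

lemma out_measurable [measurable]: "out \<in> measurable (V \<Otimes>\<^sub>M gauss) (V \<Otimes>\<^sub>M borel)"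
  unfolding out_def by measurable

lemma joint_law: "density (V \<Otimes>\<^sub>M P) (\<lambda>z. ennreal (\<rho> z)) = distr (V \<Otimes>\<^sub>M gauss) (V \<Otimes>\<^sub>M borel) out"
proof (rule measure_eqI)
  fix A assume "A \<in> sets (density (V \<Otimes>\<^sub>M P) (\<lambda>z. ennreal (\<rho> z)))"
  then have A [measurable]: "A \<in> sets (V \<Otimes>\<^sub>M borel)" by simp
  then have "emeasure (density (V \<Otimes>\<^sub>M P) (\<lambda>z. ennreal (\<rho> z))) A = (\<integral>\<^sup>+z. ennreal (\<rho> z) * indicator A z \<partial>(V \<Otimes>\<^sub>M P))"
    by (intro emeasure_density) auto
  also have "\<dots> = (\<integral>\<^sup>+z. indicator A (out z) \<partial>(V \<Otimes>\<^sub>M gauss))"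
    unfolding out_def by (rule nn_integral_joint) measurable
  also have "\<dots> = (\<integral>\<^sup>+z. indicator A z \<partial>distr (V \<Otimes>\<^sub>M gauss) (V \<Otimes>\<^sub>M borel) out)"
    by (rule nn_integral_distr[symmetric]) auto
  also have "\<dots> = emeasure (distr (V \<Otimes>\<^sub>M gauss) (V \<Otimes>\<^sub>M borel) out) A" by simp
  finally show "emeasure (density (V \<Otimes>\<^sub>M P) (\<lambda>z. ennreal (\<rho> z))) A = emeasure (distr (V \<Otimes>\<^sub>M gauss) (V \<Otimes>\<^sub>M borel) out) A" .
qed simp

lemma integral_fst_VG:
  fixes h :: "'v \<Rightarrow> real"
  assumes "integrable V h"
  shows "integrable (V \<Otimes>\<^sub>M gauss) (\<lambda>z :: 'v \<times> 'b. h (fst z))" "(\<integral>z. h (fst z) \<partial>(V \<Otimes>\<^sub>M (gauss :: 'b measure))) = (\<integral>v. h v \<partial>V)"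
proof -
  have d: "distr (V \<Otimes>\<^sub>M (gauss :: 'b measure)) V fst = V"
    by (rule prob_space.distr_pair_fst[OF prob_space_gauss])
  have m: "fst \<in> measurable (V \<Otimes>\<^sub>M (gauss :: 'b measure)) V" "h \<in> borel_measurable V" using assms by auto
  show "integrable (V \<Otimes>\<^sub>M gauss) (\<lambda>z :: 'v \<times> 'b. h (fst z))"
    using assms integrable_distr_eq[OF m] by (simp add: d)
  show "(\<integral>z. h (fst z) \<partial>(V \<Otimes>\<^sub>M (gauss :: 'b measure))) = (\<integral>v. h v \<partial>V)"
    using integral_distr[OF m] by (simp add: d)
qed

lemma integral_snd_VG:
  fixes h :: "'b \<Rightarrow> real"
  assumes "integrable gauss h"
  shows "integrable (V \<Otimes>\<^sub>M gauss) (\<lambda>z. h (snd z))" "(\<integral>z. h (snd z) \<partial>(V \<Otimes>\<^sub>M gauss)) = (\<integral>w. h w \<partial>gauss)"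
proof -
  have d: "distr (V \<Otimes>\<^sub>M (gauss :: 'b measure)) gauss snd = gauss"
    by (rule V.distr_pair_snd) unfold_locales
  have m: "snd \<in> measurable (V \<Otimes>\<^sub>M (gauss :: 'b measure)) gauss" "h \<in> borel_measurable gauss" using assms by auto
  show "integrable (V \<Otimes>\<^sub>M gauss) (\<lambda>z. h (snd z))"
    using assms integrable_distr_eq[OF m] by (simp add: d)
  show "(\<integral>z. h (snd z) \<partial>(V \<Otimes>\<^sub>M gauss)) = (\<integral>w. h w \<partial>gauss)"
    using integral_distr[OF m] by (simp add: d)
qed

lemma integrable_P_iff:
  fixes h :: "'b \<Rightarrow> real"
  assumes [measurable]: "h \<in> borel_measurable borel"
  shows "integrable P h \<longleftrightarrow> integrable (V \<Otimes>\<^sub>M gauss) (\<lambda>z. h (s (fst z) + snd z))"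
  unfolding distr_output[symmetric] by (rule integrable_distr_eq) auto

lemma integral_P:
  fixes h :: "'b \<Rightarrow> real"
  assumes [measurable]: "h \<in> borel_measurable borel"
  shows "(\<integral>y. h y \<partial>P) = (\<integral>z. h (s (fst z) + snd z) \<partial>(V \<Otimes>\<^sub>M gauss))"
  unfolding distr_output[symmetric] by (rule integral_distr) auto

lemma integrable_P_square: "integrable P (\<lambda>y. (norm y)\<^sup>2)"
proof -
  have "integrable (V \<Otimes>\<^sub>M gauss) (\<lambda>z. 2 * (norm (s (fst z)))\<^sup>2 + 2 * (norm (snd z :: 'b))\<^sup>2)"
    using integral_fst_VG(1)[OF s_square] integral_snd_VG(1)[OF gauss_norm_square(1)] by simp
  then have "integrable (V \<Otimes>\<^sub>M gauss) (\<lambda>z. (norm (s (fst z) + snd z))\<^sup>2)"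
    by (rule Bochner_Integration.integrable_bound) (use norm_diff_square_le[of "s _" "- _"] in auto)
  then show ?thesis by (subst integrable_P_iff) auto
qed

text \<open>Lower bound on \<open>ln (f y)\<close> by Jensen's inequality.\<close>

lemma integrable_ln_f: "integrable P (\<lambda>y. ln (f y))"
proof -
  define c where "c = DIM('b) * ln pi / 2"
  define m where "m = (\<integral>v. (norm (s v))\<^sup>2 \<partial>V)"
  have m0: "0 \<le> m" unfolding m_def by (intro Bochner_Integration.integral_nonneg) simp
  have upper: "ln (f y) \<le> - c" for y
  proof -
    have "ln (f y) \<le> ln (1 / sqrt pi ^ DIM('b))" using f_pos f_le by (subst ln_le_cancel_iff) auto
    also have "\<dots> = - c" by (simp add: c_def ln_div ln_realpow ln_sqrt)
    finally show ?thesis .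
  qed
  have lower: "- 2 * (norm y)\<^sup>2 - 2 * m - c \<le> ln (f y)" for y
  proof -
    have int: "integrable V (\<lambda>v. (norm (y - s v))\<^sup>2)"
    proof (rule Bochner_Integration.integrable_bound)
      show "integrable V (\<lambda>v. 2 * (norm y)\<^sup>2 + 2 * (norm (s v))\<^sup>2)" using s_square by simp
      show "AE v in V. norm ((norm (y - s v))\<^sup>2) \<le> norm (2 * (norm y)\<^sup>2 + 2 * (norm (s v))\<^sup>2)"
        using norm_diff_square_le[of y "s _"] by auto
    qed measurable
    \<comment> \<open>For fixed \<open>y\<close> the ratio of \<open>gauss_density (y - s v)\<close>
      to \<open>f y\<close> has mean 1 under \<open>V\<close>, so its logarithm has mean at most
      0.\<close>
    have "(\<integral>v. ln (gauss_density (y - s v)) - ln (f y) \<partial>V) \<le> 0"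
    proof (rule V.integral_nonpos_of_exp)
      show "integrable V (\<lambda>v. ln (gauss_density (y - s v)) - ln (f y))"
        using int by (simp add: ln_gauss_density)
      have "(\<integral>\<^sup>+v. ennreal (exp (ln (gauss_density (y - s v)) - ln (f y))) \<partial>V)
          = (\<integral>\<^sup>+v. ennreal (gauss_density (y - s v)) / ennreal (f y) \<partial>V)"
        using f_pos[of y] gauss_density_pos
        by (intro nn_integral_cong) (simp add: exp_diff divide_ennreal less_imp_le)
      also have "\<dots> = 1" using f_pos[of y] by (simp add: nn_integral_divide ennreal_f[symmetric])
      finally show "(\<integral>\<^sup>+v. ennreal (exp (ln (gauss_density (y - s v)) - ln (f y))) \<partial>V) \<le> 1" by simp
    qed
    then have "(\<integral>v. - (norm (y - s v))\<^sup>2 - (c + ln (f y)) \<partial>V) \<le> 0"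
      by (simp add: ln_gauss_density c_def algebra_simps)
    moreover have "(\<integral>v. - 2 * (norm y)\<^sup>2 - 2 * (norm (s v))\<^sup>2 - (c + ln (f y)) \<partial>V)
        \<le> (\<integral>v. - (norm (y - s v))\<^sup>2 - (c + ln (f y)) \<partial>V)"
    proof (intro integral_mono)
      fix v
      show "- 2 * (norm y)\<^sup>2 - 2 * (norm (s v))\<^sup>2 - (c + ln (f y)) \<le> - (norm (y - s v))\<^sup>2 - (c + ln (f y))"
        using norm_diff_square_le[of y "s v"] by simp
    qed (use int s_square in auto)
    moreover have "(\<integral>v. - 2 * (norm y)\<^sup>2 - 2 * (norm (s v))\<^sup>2 - (c + ln (f y)) \<partial>V)
        = - 2 * (norm y)\<^sup>2 - 2 * m - (c + ln (f y))"
      using s_square by (simp add: m_def V.prob_space)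
    ultimately show ?thesis by simp
  qed
  have "integrable P (\<lambda>y. \<bar>c\<bar> + 2 * (norm y)\<^sup>2 + 2 * m)"
    using integrable_P_square by simp
  then show ?thesis
  proof (rule Bochner_Integration.integrable_bound)
    have "norm (ln (f y)) \<le> norm (\<bar>c\<bar> + 2 * (norm y)\<^sup>2 + 2 * m)" for y
    proof -
      have "0 \<le> (norm y)\<^sup>2" by simp
      then show ?thesis using upper[of y] lower[of y] m0 unfolding real_norm_def by linarith
    qed
    then show "AE y in P. norm (ln (f y)) \<le> norm (\<bar>c\<bar> + 2 * (norm y)\<^sup>2 + 2 * m)" by simp
  qed measurable
qed

lemma ln_\<rho>_out: "ln (\<rho> (out z)) = - (norm (snd z))\<^sup>2 - DIM('b) * ln pi / 2 - ln (f (s (fst z) + snd z))"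
  using f_pos[of "s (fst z) + snd z"] gauss_density_pos[of "snd z"]
  by (simp add: \<rho>_def out_def ln_div ln_gauss_density)

text \<open>Information is output entropy minus noise entropy. The constant is the entropy of the
  noise, where the mean of the squared norm contributes \<open>DIM('b) / 2\<close>.\<close>

lemma integral_ln_\<rho>:
  "integrable (density (V \<Otimes>\<^sub>M P) (\<lambda>z. ennreal (\<rho> z))) (\<lambda>z. ln (\<rho> z))"
  "(\<integral>z. ln (\<rho> z) \<partial>density (V \<Otimes>\<^sub>M P) (\<lambda>z. ennreal (\<rho> z)))
    = - (DIM('b) * (1 + ln pi) / 2) - (\<integral>y. ln (f y) \<partial>P)"
proof -
  interpret VG: prob_space "V \<Otimes>\<^sub>M (gauss :: 'b measure)" by (rule prob_space_VG)
  have i1: "integrable (V \<Otimes>\<^sub>M gauss) (\<lambda>z. (norm (snd z :: 'b))\<^sup>2)"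
    by (rule integral_snd_VG(1)[OF gauss_norm_square(1)])
  have i2: "integrable (V \<Otimes>\<^sub>M gauss) (\<lambda>z. ln (f (s (fst z) + snd z)))"
    using integrable_ln_f by (subst (asm) integrable_P_iff) auto
  show "integrable (density (V \<Otimes>\<^sub>M P) (\<lambda>z. ennreal (\<rho> z))) (\<lambda>z. ln (\<rho> z))"
    unfolding joint_law using i1 i2 by (subst integrable_distr_eq) (auto simp: ln_\<rho>_out)
  have "(\<integral>z. ln (\<rho> z) \<partial>density (V \<Otimes>\<^sub>M P) (\<lambda>z. ennreal (\<rho> z))) = (\<integral>z. ln (\<rho> (out z)) \<partial>(V \<Otimes>\<^sub>M gauss))"
    unfolding joint_law by (rule integral_distr) auto
  also have "\<dots> = - (\<integral>z. (norm (snd z :: 'b))\<^sup>2 \<partial>(V \<Otimes>\<^sub>M gauss)) - DIM('b) * ln pi / 2 - (\<integral>y. ln (f y) \<partial>P)"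
    unfolding ln_\<rho>_out using i1 i2 by (simp add: integral_P VG.prob_space[simplified])
  also have "(\<integral>z. (norm (snd z :: 'b))\<^sup>2 \<partial>(V \<Otimes>\<^sub>M gauss)) = DIM('b) / 2"
    using integral_snd_VG(2)[OF gauss_norm_square(1)] gauss_norm_square(2)[where 'a='b] by simp
  finally show "(\<integral>z. ln (\<rho> z) \<partial>density (V \<Otimes>\<^sub>M P) (\<lambda>z. ennreal (\<rho> z)))
    = - (DIM('b) * (1 + ln pi) / 2) - (\<integral>y. ln (f y) \<partial>P)" by (simp add: algebra_simps add_divide_distrib)
qed

lemma channel_density_output:
  assumes "\<pi> \<in> measurable V U"
  shows "channel_density V P U \<pi> \<rho>"
proof
  show "(\<integral>\<^sup>+z. ennreal (\<rho> z) \<partial>(V \<Otimes>\<^sub>M P)) = 1"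
    using nn_integral_joint[of "\<lambda>_. 1"] prob_space.emeasure_space_1[OF prob_space_VG] by simp
  show "\<rho> \<in> borel_measurable (V \<Otimes>\<^sub>M P)" by measurable
qed (use assms \<rho>_pos integral_ln_\<rho>(1) in auto)

end

section \<open>Covariance and Gaussian inputs\<close>

text \<open>Both sides are relative entropies, split into differences so that the terms with
  \<open>g\<close> and \<open>g'\<close> can be evaluated separately. Reweighting the law of
  \<open>f\<close> by \<open>g / f\<close> gives the law of \<open>g\<close>, which \<kappa> carries
  to that of \<open>g'\<close>; under the latter \<open>f' / g'\<close> has integral 1.\<close>

lemma kl_data_processing:
  fixes f g :: "'b::euclidean_space \<Rightarrow> real" and f' g' :: "'c::euclidean_space \<Rightarrow> real"
  assumes meas [measurable]: "f \<in> borel_measurable borel" "g \<in> borel_measurable borel"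
      "f' \<in> borel_measurable borel" "g' \<in> borel_measurable borel"
    and pos: "\<And>y. 0 < f y" "\<And>y. 0 < g y" "\<And>z. 0 < f' z" "\<And>z. 0 < g' z"
    and N: "prob_space N" and \<kappa> [measurable]: "\<kappa> \<in> measurable (borel \<Otimes>\<^sub>M N) borel"
    and prob: "prob_space (density lborel (\<lambda>y. ennreal (f y)))" "prob_space (density lborel (\<lambda>y. ennreal (g y)))"
      "prob_space (density lborel (\<lambda>z. ennreal (f' z)))"
    and link: "distr (density lborel (\<lambda>y. ennreal (f y)) \<Otimes>\<^sub>M N) borel \<kappa> = density lborel (\<lambda>z. ennreal (f' z))"
      "distr (density lborel (\<lambda>y. ennreal (g y)) \<Otimes>\<^sub>M N) borel \<kappa> = density lborel (\<lambda>z. ennreal (g' z))"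
    and int: "integrable (density lborel (\<lambda>y. ennreal (f y))) (\<lambda>y. ln (f y))"
      "integrable (density lborel (\<lambda>y. ennreal (f y))) (\<lambda>y. ln (g y))"
      "integrable (density lborel (\<lambda>z. ennreal (f' z))) (\<lambda>z. ln (f' z))"
      "integrable (density lborel (\<lambda>z. ennreal (f' z))) (\<lambda>z. ln (g' z))"
  shows "(\<integral>z. ln (f' z) \<partial>density lborel (\<lambda>z. ennreal (f' z))) - (\<integral>z. ln (g' z) \<partial>density lborel (\<lambda>z. ennreal (f' z)))
    \<le> (\<integral>y. ln (f y) \<partial>density lborel (\<lambda>y. ennreal (f y))) - (\<integral>y. ln (g y) \<partial>density lborel (\<lambda>y. ennreal (f y)))"
proof -
  let ?F = "density lborel (\<lambda>y. ennreal (f y))" and ?G = "density lborel (\<lambda>y. ennreal (g y))"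
  let ?F' = "density lborel (\<lambda>z. ennreal (f' z))" and ?G' = "density lborel (\<lambda>z. ennreal (g' z))"
  interpret N: prob_space N by fact
  interpret F: prob_space ?F by fact
  interpret F': prob_space ?F' by fact
  interpret FN: prob_space "?F \<Otimes>\<^sub>M N" by (rule prob_space_pair) unfold_locales
  have fst_FN: "distr (?F \<Otimes>\<^sub>M N) ?F fst = ?F" by (rule N.distr_pair_fst)
  define a where "a y = ln (g y) - ln (f y)" for y
  define b where "b z = ln (f' z) - ln (g' z)" for z
  have [measurable]: "a \<in> borel_measurable borel" "b \<in> borel_measurable borel"
    unfolding a_def b_def by measurable
  have ia: "integrable ?F a" and ib: "integrable ?F' b" using int by (auto simp: a_def[abs_def] b_def[abs_def])
  have iA: "integrable (?F \<Otimes>\<^sub>M N) (\<lambda>z. a (fst z))" and IA: "(\<integral>z. a (fst z) \<partial>(?F \<Otimes>\<^sub>M N)) = (\<integral>y. a y \<partial>?F)"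
    using ia integrable_distr_eq[of fst "?F \<Otimes>\<^sub>M N" ?F a] integral_distr[of fst "?F \<Otimes>\<^sub>M N" ?F a]
    by (simp_all add: fst_FN)
  have iB: "integrable (?F \<Otimes>\<^sub>M N) (\<lambda>z. b (\<kappa> z))" and IB: "(\<integral>z. b (\<kappa> z) \<partial>(?F \<Otimes>\<^sub>M N)) = (\<integral>z. b z \<partial>?F')"
    using ib integrable_distr_eq[of \<kappa> "?F \<Otimes>\<^sub>M N" borel b] integral_distr[of \<kappa> "?F \<Otimes>\<^sub>M N" borel b]
    by (simp_all add: link)
  define h where "h z = ennreal (f' z / g' z)" for z
  have [measurable]: "h \<in> borel_measurable borel" unfolding h_def by measurable
  have "(\<integral>z. a (fst z) + b (\<kappa> z) \<partial>(?F \<Otimes>\<^sub>M N)) \<le> 0"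
  proof (rule FN.integral_nonpos_of_exp)
    show "integrable (?F \<Otimes>\<^sub>M N) (\<lambda>z. a (fst z) + b (\<kappa> z))" using iA iB by simp
    have "(\<integral>\<^sup>+z. ennreal (exp (a (fst z) + b (\<kappa> z))) \<partial>(?F \<Otimes>\<^sub>M N))
        = (\<integral>\<^sup>+z. ennreal (g (fst z) / f (fst z)) * h (\<kappa> z) \<partial>(?F \<Otimes>\<^sub>M N))"
      using pos by (intro nn_integral_cong) (simp add: a_def b_def h_def exp_add exp_diff ennreal_mult[symmetric] less_imp_le)
    also have "\<dots> = (\<integral>\<^sup>+y. \<integral>\<^sup>+w. ennreal (g y / f y) * h (\<kappa> (y, w)) \<partial>N \<partial>?F)"
      by (subst N.nn_integral_fst[symmetric]) auto
    also have "\<dots> = (\<integral>\<^sup>+y. ennreal (g y / f y) * (\<integral>\<^sup>+w. h (\<kappa> (y, w)) \<partial>N) \<partial>?F)"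
      by (intro nn_integral_cong nn_integral_cmult) measurable
    also have "\<dots> = (\<integral>\<^sup>+y. ennreal (f y) * (ennreal (g y / f y) * (\<integral>\<^sup>+w. h (\<kappa> (y, w)) \<partial>N)) \<partial>lborel)"
      by (rule nn_integral_density) measurable
    also have "\<dots> = (\<integral>\<^sup>+y. ennreal (g y) * (\<integral>\<^sup>+w. h (\<kappa> (y, w)) \<partial>N) \<partial>lborel)"
    proof (intro nn_integral_cong)
      fix y
      have "ennreal (f y) * ennreal (g y / f y) = ennreal (g y)"
        using pos(1)[of y] pos(2)[of y] by (simp add: ennreal_mult[symmetric])
      then show "ennreal (f y) * (ennreal (g y / f y) * (\<integral>\<^sup>+w. h (\<kappa> (y, w)) \<partial>N)) = ennreal (g y) * (\<integral>\<^sup>+w. h (\<kappa> (y, w)) \<partial>N)"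
        by (simp add: mult.assoc[symmetric])
    qed
    also have "\<dots> = (\<integral>\<^sup>+y. \<integral>\<^sup>+w. h (\<kappa> (y, w)) \<partial>N \<partial>?G)"
      by (rule nn_integral_density[symmetric]) measurable
    also have "\<dots> = (\<integral>\<^sup>+z. h (\<kappa> z) \<partial>(?G \<Otimes>\<^sub>M N))" by (subst N.nn_integral_fst) auto
    also have "\<dots> = (\<integral>\<^sup>+z. h z \<partial>?G')" unfolding link[symmetric] by (rule nn_integral_distr[symmetric]) auto
    also have "\<dots> = (\<integral>\<^sup>+z. ennreal (g' z) * h z \<partial>lborel)" by (rule nn_integral_density) measurable
    also have "\<dots> = (\<integral>\<^sup>+z. ennreal (f' z) \<partial>lborel)"
      using pos by (intro nn_integral_cong) (simp add: h_def ennreal_mult[symmetric] less_imp_le less_imp_neq[symmetric])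
    also have "\<dots> = (\<integral>\<^sup>+z. 1 \<partial>?F')" by (subst nn_integral_density) auto
    also have "\<dots> = 1" using F'.emeasure_space_1 by simp
    finally show "(\<integral>\<^sup>+z. ennreal (exp (a (fst z) + b (\<kappa> z))) \<partial>(?F \<Otimes>\<^sub>M N)) \<le> 1" by simp
  qed
  also have "(\<integral>z. a (fst z) + b (\<kappa> z) \<partial>(?F \<Otimes>\<^sub>M N)) = (\<integral>y. a y \<partial>?F) + (\<integral>z. b z \<partial>?F')"
    using iA iB by (simp add: IA IB)
  also have "(\<integral>y. a y \<partial>?F) = (\<integral>y. ln (g y) \<partial>?F) - (\<integral>y. ln (f y) \<partial>?F)"
    unfolding a_def by (intro Bochner_Integration.integral_diff int)
  also have "(\<integral>z. b z \<partial>?F') = (\<integral>z. ln (f' z) \<partial>?F') - (\<integral>z. ln (g' z) \<partial>?F')"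
    unfolding b_def by (intro Bochner_Integration.integral_diff int)
  finally show ?thesis by linarith
qed

section \<open>Means, covariances and quadratic forms\<close>

definition mean :: "'w measure \<Rightarrow> ('w \<Rightarrow> complex ^ 'n) \<Rightarrow> complex ^ 'n" where
  "mean V X = (\<chi> i. \<integral>\<omega>. X \<omega> $ i \<partial>V)"

lemma component_measurable [measurable]: "(\<lambda>x :: complex ^ 'n. x $ i) \<in> borel_measurable borel"
  by (intro borel_measurable_continuous_onI continuous_intros)

lemma cnj_measurable [measurable]: "cnj \<in> borel_measurable borel"
  by (intro borel_measurable_continuous_onI continuous_intros)

lemma integrable_centered_square:
  fixes X :: "'w \<Rightarrow> complex ^ 'n"
  assumes "prob_space V" "X \<in> borel_measurable V" "integrable V (\<lambda>v. (norm (X v))\<^sup>2)"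
  shows "integrable V (\<lambda>v. (norm (X v - m))\<^sup>2)"
proof (rule Bochner_Integration.integrable_bound)
  interpret prob_space V by fact
  show "integrable V (\<lambda>v. 2 * (norm (X v))\<^sup>2 + 2 * (norm m)\<^sup>2)" using assms by simp
  show "(\<lambda>v. (norm (X v - m))\<^sup>2) \<in> borel_measurable V" using assms(2) by measurable
qed (auto simp: norm_diff_square_le)

lemma trace_mult_commute:
  fixes A :: "complex ^ 'n ^ 'm" and B :: "complex ^ 'm ^ 'n"
  shows "trace (A ** B) = trace (B ** A)"
  by (simp add: trace_def matrix_matrix_mult_def, subst sum.swap, simp add: mult.commute)

lemma has_cov_quadratic:
  fixes X :: "'w \<Rightarrow> complex ^ 'n" and T :: "complex ^ 'n ^ 'n"
  assumes V: "prob_space V" and cov: "has_cov V X K"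
  defines "Y v \<equiv> X v - mean V X"
  shows "integrable V (\<lambda>v. Y v \<bullet> (T *v Y v))" "(\<integral>v. Y v \<bullet> (T *v Y v) \<partial>V) = Re (trace (T ** K))"
proof -
  have X [measurable]: "X \<in> borel_measurable V" and sq: "integrable V (\<lambda>v. (norm (X v))\<^sup>2)"
    and K: "K $ i $ j = (\<integral>v. Y v $ i * cnj (Y v $ j) \<partial>V)" for i j
    using cov by (auto simp: has_cov_def Y_def mean_def)
  have [measurable]: "Y \<in> borel_measurable V" unfolding Y_def by measurable
  have sqY: "integrable V (\<lambda>v. (norm (Y v))\<^sup>2)"
    unfolding Y_def by (rule integrable_centered_square[OF V X sq])
  have int: "integrable V (\<lambda>v. Y v $ i * cnj (Y v $ j))" for i j
  proof (rule Bochner_Integration.integrable_bound[OF sqY])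
    have "norm (Y v $ i * cnj (Y v $ j)) \<le> (norm (Y v))\<^sup>2" for v
      unfolding norm_mult complex_mod_cnj power2_eq_square
      by (intro mult_mono) (simp_all add: Finite_Cartesian_Product.norm_nth_le)
    then show "AE v in V. norm (Y v $ i * cnj (Y v $ j)) \<le> norm ((norm (Y v))\<^sup>2)" by simp
  qed measurable
  have e: "Y v \<bullet> (T *v Y v) = (\<Sum>i\<in>UNIV. \<Sum>j\<in>UNIV. Re (T $ i $ j * (Y v $ j * cnj (Y v $ i))))" for v
    by (simp add: inner_vec_def inner_complex_cnj matrix_vector_mult_def sum_distrib_left mult_ac)
  have t: "integrable V (\<lambda>v. Re (T $ i $ j * (Y v $ j * cnj (Y v $ i))))"
    "(\<integral>v. Re (T $ i $ j * (Y v $ j * cnj (Y v $ i))) \<partial>V) = Re (T $ i $ j * K $ j $ i)" for i j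
  proof -
    have i: "integrable V (\<lambda>v. T $ i $ j * (Y v $ j * cnj (Y v $ i)))"
      by (intro integrable_mult_right int)
    show "integrable V (\<lambda>v. Re (T $ i $ j * (Y v $ j * cnj (Y v $ i))))" using i by (rule integrable_Re)
    show "(\<integral>v. Re (T $ i $ j * (Y v $ j * cnj (Y v $ i))) \<partial>V) = Re (T $ i $ j * K $ j $ i)"
      unfolding integral_Re[OF i] by (simp only: integral_mult_right_zero K)
  qed
  show "integrable V (\<lambda>v. Y v \<bullet> (T *v Y v))"
    unfolding e by (intro Bochner_Integration.integrable_sum t)
  have "(\<integral>v. Y v \<bullet> (T *v Y v) \<partial>V) = (\<Sum>i\<in>UNIV. \<Sum>j\<in>UNIV. Re (T $ i $ j * K $ j $ i))"
    unfolding e by (simp only: Bochner_Integration.integral_sum Bochner_Integration.integrable_sum t)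
  then show "(\<integral>v. Y v \<bullet> (T *v Y v) \<partial>V) = Re (trace (T ** K))"
    by (simp add: trace_def matrix_matrix_mult_def)
qed

lemma gauss_component_moments:
  fixes k l :: "'n::finite"
  shows "integrable gauss (\<lambda>w :: complex ^ 'n. w $ k)" "(\<integral>w. (w :: complex ^ 'n) $ k \<partial>gauss) = 0"
    "integrable gauss (\<lambda>w :: complex ^ 'n. w $ k * cnj (w $ l))"
    "(\<integral>w. (w :: complex ^ 'n) $ k * cnj (w $ l) \<partial>gauss) = (if k = l then 1 else 0)"
proof -
  let ?c = "\<lambda>i u (w :: complex ^ 'n). complex_of_real (w \<bullet> axis i u)"
  have c: "w $ i = ?c i 1 w + \<i> * ?c i \<i> w" for w i
    by (simp add: inner_axis inner_complex_def complex_eq_iff)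
  have i1: "integrable gauss (?c i u)" "(\<integral>w. ?c i u w \<partial>gauss) = 0" for i u
    by (simp_all add: gauss_inner_square)
  show "integrable gauss (\<lambda>w :: complex ^ 'n. w $ k)" "(\<integral>w. (w :: complex ^ 'n) $ k \<partial>gauss) = 0"
    unfolding c[of _ k] using i1 by simp_all
  \<comment> \<open>In real coordinates the mixed terms pair orthogonal axes and average to 0; for
    \<open>k = l\<close> the other two contribute 1/2 each.\<close>
  have e: "w $ k * cnj (w $ l) = complex_of_real ((w \<bullet> axis k 1) * (w \<bullet> axis l 1)) + complex_of_real ((w \<bullet> axis k \<i>) * (w \<bullet> axis l \<i>))
      + \<i> * complex_of_real ((w \<bullet> axis k \<i>) * (w \<bullet> axis l 1)) - \<i> * complex_of_real ((w \<bullet> axis k 1) * (w \<bullet> axis l \<i>))" for w :: "complex ^ 'n"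
    unfolding c[of w k] c[of w l] by (simp add: algebra_simps)
  have i2: "integrable gauss (\<lambda>w :: complex ^ 'n. complex_of_real ((w \<bullet> axis i u) * (w \<bullet> axis j u')))"
    "(\<integral>w. complex_of_real (((w :: complex ^ 'n) \<bullet> axis i u) * (w \<bullet> axis j u')) \<partial>gauss) = complex_of_real ((axis i u \<bullet> (axis j u' :: complex ^ 'n)) / 2)" for i j u u'
    by (simp_all add: gauss_inner_inner del: of_real_mult)
  show "integrable gauss (\<lambda>w :: complex ^ 'n. w $ k * cnj (w $ l))"
    unfolding e by (intro Bochner_Integration.integrable_add Bochner_Integration.integrable_diff integrable_mult_right i2)
  show "(\<integral>w. (w :: complex ^ 'n) $ k * cnj (w $ l) \<partial>gauss) = (if k = l then 1 else 0)"
    unfolding e using i2(1)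
    by (simp add: i2 gauss_inner_inner inner_axis_axis inner_complex_def del: of_real_mult)
qed

lemma integrable_gauss_linear_square:
  fixes A :: "complex ^ 'k ^ 'n"
  shows "integrable gauss (\<lambda>w. (norm (A *v w))\<^sup>2)"
proof -
  obtain B where B: "\<And>w. norm (A *v w) \<le> B * norm w"
    using linear_bounded[OF matrix_vector_mul_linear[of A]] by blast
  have "integrable gauss (\<lambda>w :: complex ^ 'k. B\<^sup>2 * (norm w)\<^sup>2)" by (simp add: gauss_norm_square)
  then show ?thesis
  proof (rule Bochner_Integration.integrable_bound)
    have "(norm (A *v w))\<^sup>2 \<le> (B * norm w)\<^sup>2" for w using B[of w] by (intro power_mono) auto
    then show "AE w in gauss. norm ((norm (A *v w))\<^sup>2) \<le> norm (B\<^sup>2 * (norm w)\<^sup>2)"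
      by (simp add: power_mult_distrib)
  qed measurable
qed

lemma gauss_linear_cov:
  fixes A :: "complex ^ 'k ^ 'n"
  shows "mean gauss ((*v) A) = 0" "has_cov gauss ((*v) A) (A ** cadjoint A)"
proof -
  have m: "(\<integral>w. (A *v w) $ i \<partial>gauss) = 0" for i
    by (simp add: matrix_vector_mult_def gauss_component_moments Bochner_Integration.integral_sum)
  then show "mean gauss ((*v) A) = 0" by (simp add: mean_def vec_eq_iff)
  have "(A ** cadjoint A) $ i $ j = (\<integral>w. (A *v w) $ i * cnj ((A *v w) $ j) \<partial>gauss)" for i j
  proof -
    have e: "(A *v w) $ i * cnj ((A *v w) $ j) = (\<Sum>k\<in>UNIV. \<Sum>l\<in>UNIV. (A $ i $ k * cnj (A $ j $ l)) * (w $ k * cnj (w $ l)))" for w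
      by (simp add: matrix_vector_mult_def sum_product mult_ac)
    have "(\<integral>w. (A *v w) $ i * cnj ((A *v w) $ j) \<partial>gauss)
        = (\<Sum>k\<in>UNIV. \<Sum>l\<in>UNIV. (A $ i $ k * cnj (A $ j $ l)) * (if k = l then 1 else 0))"
      unfolding e
      by (simp only: Bochner_Integration.integral_sum gauss_component_moments integral_mult_right_zero Bochner_Integration.integrable_sum integrable_mult_right)
    then show ?thesis by (simp add: matrix_matrix_mult_def if_distrib[where f="\<lambda>x. _ * x"] cong: if_cong)
  qed
  then show "has_cov gauss ((*v) A) (A ** cadjoint A)"
    unfolding has_cov_def m by (simp add: integrable_gauss_linear_square measurable_cong_sets[OF sets_gauss refl])
qed

section \<open>Densities and moments of Gaussian channel outputs\<close>

lemma posdef_one_plus_gram: "posdef (mat 1 + A ** cadjoint A)"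
proof -
  have "v \<bullet> ((mat 1 + A ** cadjoint A) *v v) = (norm v)\<^sup>2 + (norm (cadjoint A *v v))\<^sup>2" for v
    by (simp add: matrix_vector_mult_add_rdistrib inner_add_right power2_norm_eq_inner inner_cadjoint
        matrix_vector_mul_assoc)
  then show ?thesis
    by (simp add: posdef_def hermitian_def cadjoint_add cadjoint_mult add_pos_nonneg)
qed

lemma posdef_inverse:
  fixes T :: "complex ^ 'n ^ 'n"
  assumes "posdef T" obtains S where "T ** S = mat 1" "S ** T = mat 1" "posdef S"
proof -
  have "det T \<noteq> 0" using posdef_gaussian_integral(2)[OF assms] by auto
  then obtain S where S: "T ** S = mat 1" "S ** T = mat 1"
    using invertible_det_nz[of T] by (auto simp: invertible_def)
  have hT: "cadjoint T = T" using assms by (simp add: posdef_def hermitian_def)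
  have "cadjoint S ** T = mat 1" using arg_cong[OF S(1), of cadjoint] by (simp add: cadjoint_mult hT)
  then have "cadjoint S ** T ** S = S" by simp
  then have hS: "cadjoint S = S" by (simp add: matrix_mul_assoc[symmetric] S(1))
  have "0 < v \<bullet> (S *v v)" if "v \<noteq> 0" for v
  proof -
    have v: "T *v (S *v v) = v" by (simp add: matrix_vector_mul_assoc S)
    then have "S *v v \<noteq> 0" using that by (metis matrix_vector_mult_0_right)
    then have "0 < (S *v v) \<bullet> (T *v (S *v v))" using assms by (simp add: posdef_def)
    then show ?thesis by (simp only: v inner_commute)
  qed
  then show ?thesis using that[OF S] hS by (simp add: posdef_def hermitian_def)
qed

lemma gauss_density_complex: "gauss_density (w :: complex ^ 'n) = exp (- (norm w)\<^sup>2) / pi ^ CARD('n)"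
  by (simp add: gauss_density_def power_mult power_mult_distrib[symmetric] power2_eq_square)

lemma gaussian_channel_linear:
  fixes A :: "complex ^ 'k ^ 'n"
  shows "gaussian_channel gauss (\<lambda>w. m + A *v w)"
proof
  have "integrable gauss (\<lambda>w. (norm (A *v w - (- m)))\<^sup>2)"
    by (intro integrable_centered_square prob_space_gauss integrable_gauss_linear_square)
      (simp add: measurable_cong_sets[OF sets_gauss refl])
  then show "integrable gauss (\<lambda>w. (norm (m + A *v w))\<^sup>2)" by (simp add: add.commute)
qed measurable

text \<open>Completing the square: with \<open>q = S (y - m)\<close> and \<open>w = A\<^sup>\<dagger> q + t\<close> the exponent becomes
  \<open>(y - m) \<bullet> q + t \<bullet> (I + A\<^sup>\<dagger> A) t\<close>. The normalising constant is found from the total mass.\<close>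

lemma gaussian_density:
  fixes A :: "complex ^ 'k ^ 'n"
  assumes S: "(mat 1 + A ** cadjoint A) ** S = mat 1"
  shows "gaussian_channel.f gauss (\<lambda>w. m + A *v w) y
    = exp (- ((y - m) \<bullet> (S *v (y - m)))) / (pi ^ CARD('n) * Re (det (mat 1 + A ** cadjoint A)))"
proof -
  let ?\<Sigma> = "mat 1 + A ** cadjoint A" and ?T = "mat 1 + cadjoint A ** A"
  interpret gaussian_channel gauss "\<lambda>w. m + A *v w" by (rule gaussian_channel_linear)
  have \<Sigma>: "posdef ?\<Sigma>" by (rule posdef_one_plus_gram)
  have T: "posdef ?T" using posdef_one_plus_gram[of "cadjoint A"] by simp
  obtain S' where S': "?\<Sigma> ** S' = mat 1" "S' ** ?\<Sigma> = mat 1" "posdef S'" using posdef_inverse[OF \<Sigma>] .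
  have "S = S' ** ?\<Sigma> ** S" using S'(2) by simp
  also have "\<dots> = S'" unfolding matrix_mul_assoc[symmetric] S by simp
  finally have Spos: "posdef S" using S'(3) by simp
  define dT where "dT = Re (det ?T)"
  have dT: "0 < dT" using posdef_gaussian_integral(2)[OF T] by (simp add: dT_def)
  have dens: "f y = exp (- ((y - m) \<bullet> (S *v (y - m)))) / (pi ^ CARD('n) * dT)" for y
  proof -
    define q where "q = S *v (y - m)"
    have "?\<Sigma> *v q = y - m" by (simp add: q_def matrix_vector_mul_assoc S)
    then have ym: "y - m = q + A *v (cadjoint A *v q)"
      by (simp add: matrix_vector_mult_add_rdistrib matrix_vector_mul_assoc)
    have sq: "(norm (cadjoint A *v q + t))\<^sup>2 + (norm (y - (m + A *v (cadjoint A *v q + t))))\<^sup>2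
        = (y - m) \<bullet> q + t \<bullet> (?T *v t)" for t
    proof -
      have e: "y - (m + A *v (cadjoint A *v q + t)) = q - A *v t"
        using ym by (simp add: matrix_vector_right_distrib algebra_simps)
      have "(q + A *v (cadjoint A *v q)) \<bullet> q = q \<bullet> q + (cadjoint A *v q) \<bullet> (cadjoint A *v q)"
        by (simp add: inner_add_left inner_cadjoint)
      moreover have "q \<bullet> (A *v t) = (cadjoint A *v q) \<bullet> t" by (simp add: inner_cadjoint)
      moreover have "t \<bullet> (?T *v t) = t \<bullet> t + (A *v t) \<bullet> (A *v t)"
        by (simp add: matrix_vector_mult_add_rdistrib inner_add_right inner_cadjoint matrix_vector_mul_assoc)
      ultimately show ?thesis
        unfolding e ym power2_norm_eq_inner
        by (simp add: inner_add_left inner_add_right inner_diff_left inner_diff_right inner_commute)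
    qed
    have "ennreal (f y) = (\<integral>\<^sup>+w. ennreal (gauss_density w) * ennreal (gauss_density (y - (m + A *v w))) \<partial>lborel)"
      unfolding ennreal_f by (rule nn_integral_gauss) measurable
    also have "\<dots> = (\<integral>\<^sup>+t. ennreal (gauss_density (cadjoint A *v q + t))
        * ennreal (gauss_density (y - (m + A *v (cadjoint A *v q + t)))) \<partial>lborel)"
      by (rule nn_integral_lborel_translate[symmetric,
          where h="\<lambda>w. ennreal (gauss_density w) * ennreal (gauss_density (y - (m + A *v w)))"]) measurable
    also have "\<dots> = (\<integral>\<^sup>+t. ennreal (exp (- ((y - m) \<bullet> q)) / (pi ^ CARD('n) * pi ^ CARD('k)))
        * ennreal (exp (- (t \<bullet> (?T *v t)))) \<partial>lborel)"
    proof (rule nn_integral_cong)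
      fix t
      have "gauss_density (cadjoint A *v q + t) * gauss_density (y - (m + A *v (cadjoint A *v q + t)))
          = exp (- ((norm (cadjoint A *v q + t))\<^sup>2 + (norm (y - (m + A *v (cadjoint A *v q + t))))\<^sup>2))
            / (pi ^ CARD('n) * pi ^ CARD('k))"
        unfolding gauss_density_complex by (simp add: exp_add[symmetric] mult.commute)
      also have "\<dots> = exp (- ((y - m) \<bullet> q)) / (pi ^ CARD('n) * pi ^ CARD('k)) * exp (- (t \<bullet> (?T *v t)))"
        unfolding sq by (simp add: exp_add[symmetric])
      finally show "ennreal (gauss_density (cadjoint A *v q + t))
        * ennreal (gauss_density (y - (m + A *v (cadjoint A *v q + t))))
        = ennreal (exp (- ((y - m) \<bullet> q)) / (pi ^ CARD('n) * pi ^ CARD('k))) * ennreal (exp (- (t \<bullet> (?T *v t))))"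
        by (simp add: ennreal_mult[symmetric])
    qed
    also have "\<dots> = ennreal (exp (- ((y - m) \<bullet> q)) / (pi ^ CARD('n) * pi ^ CARD('k))) * ennreal (pi ^ CARD('k) / dT)"
      unfolding dT_def posdef_gaussian_integral(3)[OF T, symmetric] by (rule nn_integral_cmult) measurable
    also have "\<dots> = ennreal (exp (- ((y - m) \<bullet> q)) / (pi ^ CARD('n) * dT))"
      using dT by (simp add: ennreal_mult[symmetric] less_imp_le)
    finally show ?thesis
      using f_pos[of y] dT by (subst (asm) ennreal_inj) (auto simp: q_def less_imp_le)
  qed
  \<comment> \<open>Integrating over \<open>w\<close> has produced the determinant of
    \<open>?T\<close>, of the size of the input. Total mass 1 gives
    \<open>dT * Re (det S) = 1\<close>; compared with \<open>det ?\<Sigma> * det S = 1\<close> this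
    is Sylvester's identity for \<open>?T\<close> and \<open>?\<Sigma>\<close>.\<close>
  have "1 = (\<integral>\<^sup>+y. 1 \<partial>P)" using P.emeasure_space_1 by simp
  also have "\<dots> = (\<integral>\<^sup>+y. ennreal (f y) \<partial>lborel)" by (subst nn_integral_P) auto
  also have "\<dots> = (\<integral>\<^sup>+y. ennreal (f (m + y)) \<partial>lborel)"
    by (rule nn_integral_lborel_translate[symmetric]) measurable
  also have "\<dots> = (\<integral>\<^sup>+y. ennreal (1 / (pi ^ CARD('n) * dT)) * ennreal (exp (- (y \<bullet> (S *v y)))) \<partial>lborel)"
    using dT by (intro nn_integral_cong) (simp add: dens ennreal_mult[symmetric] less_imp_le)
  also have "\<dots> = ennreal (1 / (pi ^ CARD('n) * dT)) * ennreal (pi ^ CARD('n) / Re (det S))"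
    unfolding posdef_gaussian_integral(3)[OF Spos, symmetric] by (rule nn_integral_cmult) measurable
  also have "\<dots> = ennreal (1 / (dT * Re (det S)))"
    using dT posdef_gaussian_integral(2)[OF Spos] by (simp add: ennreal_mult[symmetric] less_imp_le)
  finally have "ennreal (1 / (dT * Re (det S))) = ennreal 1" by simp
  then have 1: "dT * Re (det S) = 1"
    using dT posdef_gaussian_integral(2)[OF Spos] by (subst (asm) ennreal_inj) auto
  have "det ?\<Sigma> * det S = 1" using arg_cong[OF S, of det] by (simp add: det_mul)
  then have "complex_of_real (Re (det ?\<Sigma>) * Re (det S)) = 1"
    using posdef_gaussian_integral(1)[OF \<Sigma>] posdef_gaussian_integral(1)[OF Spos] by (metis of_real_mult)
  then have 2: "Re (det ?\<Sigma>) * Re (det S) = 1" by (metis of_real_eq_1_iff)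
  have "dT = Re (det ?\<Sigma>)"
    using 1 2 posdef_gaussian_integral(2)[OF Spos] by (metis mult_right_cancel less_irrefl)
  then show ?thesis using dens by simp
qed

lemma gaussian_channel_input:
  fixes X :: "'v \<Rightarrow> complex ^ 'a" and H :: "complex ^ 'a ^ 'b"
  assumes V: "prob_space V" and X [measurable]: "X \<in> borel_measurable V" and sq: "integrable V (\<lambda>v. (norm (X v))\<^sup>2)"
  shows "gaussian_channel V (\<lambda>v. H *v X v)"
proof -
  interpret prob_space V by fact
  show ?thesis
  proof
    obtain B where B: "\<And>w. norm (H *v w) \<le> B * norm w"
      using linear_bounded[OF matrix_vector_mul_linear[of H]] by blast
    have "integrable V (\<lambda>v. B\<^sup>2 * (norm (X v))\<^sup>2)" using sq by simp
    then show "integrable V (\<lambda>v. (norm (H *v X v))\<^sup>2)"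
    proof (rule Bochner_Integration.integrable_bound)
      have "(norm (H *v w))\<^sup>2 \<le> (B * norm w)\<^sup>2" for w using B[of w] by (intro power_mono) auto
      then show "AE v in V. norm ((norm (H *v X v))\<^sup>2) \<le> norm (B\<^sup>2 * (norm (X v))\<^sup>2)"
        by (simp add: power_mult_distrib)
    qed measurable
  qed measurable
qed

text \<open>The centred output is the image of the centred input plus noise. The cross term averages
  to 0 because the noise is centred and independent, and the two remaining traces combine to the
  output covariance.\<close>

lemma output_quadratic:
  fixes X :: "'v \<Rightarrow> complex ^ 'a" and H :: "complex ^ 'a ^ 'b"
  assumes V: "prob_space V" and cov: "has_cov V X K"
  defines "m \<equiv> H *v mean V X" and "Py \<equiv> gaussian_channel.P V (\<lambda>v. H *v X v)"
  shows "integrable Py (\<lambda>y. (y - m) \<bullet> (S *v (y - m)))"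
    "(\<integral>y. (y - m) \<bullet> (S *v (y - m)) \<partial>Py) = Re (trace (S ** (mat 1 + H ** K ** cadjoint H)))"
proof -
  have X [measurable]: "X \<in> borel_measurable V" and sq: "integrable V (\<lambda>v. (norm (X v))\<^sup>2)"
    using cov by (auto simp: has_cov_def)
  interpret gaussian_channel V "\<lambda>v. H *v X v" by (rule gaussian_channel_input[OF V X sq])
  interpret VG: prob_space "V \<Otimes>\<^sub>M (gauss :: (complex ^ 'b) measure)" by (rule prob_space_VG)
  define Y where "Y v = X v - mean V X" for v
  \<comment> \<open>The two cross terms merged into one inner product with the noise; as
    \<open>S\<close> need not be Hermitian, its adjoint appears beside it.\<close>
  define B where "B v = (cadjoint S + S) *v (H *v Y v)" for v
  have [measurable]: "Y \<in> borel_measurable V" unfolding Y_def[abs_def] by measurable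
  have [measurable]: "B \<in> borel_measurable V" unfolding B_def[abs_def] by measurable
  note q1 = has_cov_quadratic[OF V cov, of "cadjoint H ** S ** H", folded Y_def]
  have "has_cov gauss ((*v) (mat 1)) (mat 1 ** cadjoint (mat 1) :: complex ^ 'b ^ 'b)" by (rule gauss_linear_cov)
  from has_cov_quadratic[OF prob_space_gauss this, of S]
  have q2: "integrable gauss (\<lambda>w :: complex ^ 'b. w \<bullet> (S *v w))" "(\<integral>w. w \<bullet> (S *v w) \<partial>gauss) = Re (trace S)"
    using gauss_linear_cov(1)[of "mat 1 :: complex ^ 'b ^ 'b"] by simp_all
  have sqY: "integrable V (\<lambda>v. (norm (Y v))\<^sup>2)"
    unfolding Y_def by (rule integrable_centered_square[OF V X sq])
  interpret Bc: gaussian_channel V "\<lambda>v. ((cadjoint S + S) ** H) *v Y v"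
    by (rule gaussian_channel_input[OF V _ sqY]) measurable
  have sqB: "integrable V (\<lambda>v. (norm (B v))\<^sup>2)"
    using Bc.s_square by (simp add: B_def matrix_vector_mul_assoc)
  have cross_int: "integrable (V \<Otimes>\<^sub>M gauss) (\<lambda>z. snd z \<bullet> B (fst z))"
  proof (rule Bochner_Integration.integrable_bound)
    show "integrable (V \<Otimes>\<^sub>M gauss) (\<lambda>z. (norm (B (fst z)))\<^sup>2 + (norm (snd z :: complex ^ 'b))\<^sup>2)"
      using integral_fst_VG(1)[OF sqB] integral_snd_VG(1)[OF gauss_norm_square(1)] by simp
    have "\<bar>w \<bullet> b\<bar> \<le> (norm b)\<^sup>2 + (norm w)\<^sup>2" for w b :: "complex ^ 'b"
    proof -
      have "\<bar>w \<bullet> b\<bar> \<le> norm w * norm b" by (rule Cauchy_Schwarz_ineq2)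
      also have "\<dots> \<le> (norm b)\<^sup>2 + (norm w)\<^sup>2"
        using sum_squares_bound[of "norm w" "norm b"] mult_nonneg_nonneg[OF norm_ge_zero[of w] norm_ge_zero[of b]]
        by linarith
      finally show ?thesis .
    qed
    then show "AE z in V \<Otimes>\<^sub>M gauss. norm (snd z \<bullet> B (fst z)) \<le> norm ((norm (B (fst z)))\<^sup>2 + (norm (snd z :: complex ^ 'b))\<^sup>2)"
      by simp
  qed measurable
  interpret VGp: pair_sigma_finite V "gauss :: (complex ^ 'b) measure" by unfold_locales
  have cross: "(\<integral>z. snd z \<bullet> B (fst z) \<partial>(V \<Otimes>\<^sub>M gauss)) = 0"
  proof -
    have "(\<integral>v. (\<integral>w. w \<bullet> B v \<partial>gauss) \<partial>V) = (\<integral>z. snd z \<bullet> B (fst z) \<partial>(V \<Otimes>\<^sub>M gauss))"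
      using VGp.integral_fst'[of "\<lambda>z. snd z \<bullet> B (fst z)"] cross_int by simp
    then show ?thesis by (simp add: gauss_inner_square)
  qed
  have split: "(H *v X v + w - m) \<bullet> (S *v (H *v X v + w - m))
      = Y v \<bullet> ((cadjoint H ** S ** H) *v Y v) + w \<bullet> (S *v w) + w \<bullet> B v" for v w
  proof -
    have "H *v X v + w - m = H *v Y v + w"
      by (simp add: m_def Y_def matrix_vector_mult_diff_distrib)
    moreover have "(a + w) \<bullet> (S *v (a + w)) = a \<bullet> (S *v a) + w \<bullet> (S *v w) + w \<bullet> ((cadjoint S + S) *v a)" for a
    proof -
      have "a \<bullet> (S *v w) = w \<bullet> (cadjoint S *v a)"
        using inner_cadjoint[of S w a] by (simp only: inner_commute)
      then show ?thesis
        by (simp add: matrix_vector_right_distrib matrix_vector_mult_add_rdistrib inner_add_left inner_add_right)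
    qed
    ultimately show ?thesis by (simp only: congruence_inner B_def)
  qed
  have i: "integrable (V \<Otimes>\<^sub>M gauss) (\<lambda>z. Y (fst z) \<bullet> ((cadjoint H ** S ** H) *v Y (fst z)) + snd z \<bullet> (S *v snd z) + snd z \<bullet> B (fst z))"
    using integral_fst_VG(1)[OF q1(1)] integral_snd_VG(1)[OF q2(1)] cross_int by simp
  then show "integrable Py (\<lambda>y. (y - m) \<bullet> (S *v (y - m)))"
    unfolding Py_def by (subst integrable_P_iff) (simp_all add: split)
  have "(\<integral>y. (y - m) \<bullet> (S *v (y - m)) \<partial>Py)
      = (\<integral>z. Y (fst z) \<bullet> ((cadjoint H ** S ** H) *v Y (fst z)) + snd z \<bullet> (S *v snd z) + snd z \<bullet> B (fst z) \<partial>(V \<Otimes>\<^sub>M gauss))"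
    unfolding Py_def by (subst integral_P) (simp_all add: split)
  also have "\<dots> = Re (trace (cadjoint H ** S ** H ** K)) + Re (trace S)"
    using integral_fst_VG[OF q1(1)] integral_snd_VG[OF q2(1)] cross_int cross q1(2) q2(2) by simp
  also have "trace (cadjoint H ** S ** H ** K) = trace (S ** (H ** K ** cadjoint H))"
    using trace_mult_commute[of "cadjoint H" "S ** H ** K"] by (simp add: matrix_mul_assoc)
  finally show "(\<integral>y. (y - m) \<bullet> (S *v (y - m)) \<partial>Py) = Re (trace (S ** (mat 1 + H ** K ** cadjoint H)))"
    by (simp add: matrix_add_ldistrib trace_add)
qed

text \<open>\<open>g\<close> is the Gaussian density with the mean and covariance of the actual
  output, so its exponent averages to the trace of the identity. The value is the negative entropy
  of that Gaussian law and is common to all inputs of this covariance; for a centred Gaussian input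
  \<open>A w\<close> it is also the integral of the logarithm of the true output density.\<close>

lemma integral_ln_gaussian_density:
  fixes X :: "'v \<Rightarrow> complex ^ 'a" and H :: "complex ^ 'a ^ 'b" and A :: "complex ^ 'a ^ 'a"
  assumes V: "prob_space V" and cov: "has_cov V X (A ** cadjoint A)"
  defines "m \<equiv> H *v mean V X" and "Py \<equiv> gaussian_channel.P V (\<lambda>v. H *v X v)"
    and "g \<equiv> gaussian_channel.f gauss (\<lambda>w. H *v mean V X + (H ** A) *v w)"
  shows "integrable Py (\<lambda>y. ln (g y))"
    "(\<integral>y. ln (g y) \<partial>Py) = - (CARD('b) * (1 + ln pi)) - ln (Re (det (mat 1 + H ** (A ** cadjoint A) ** cadjoint H)))"
proof -
  let ?\<Sigma> = "mat 1 + H ** (A ** cadjoint A) ** cadjoint H"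
  have \<Sigma>: "?\<Sigma> = mat 1 + (H ** A) ** cadjoint (H ** A)"
    by (simp add: cadjoint_mult matrix_mul_assoc)
  have pd: "posdef ?\<Sigma>" unfolding \<Sigma> by (rule posdef_one_plus_gram)
  obtain S where S: "?\<Sigma> ** S = mat 1" "S ** ?\<Sigma> = mat 1" using posdef_inverse[OF pd] by metis
  have d: "0 < Re (det ?\<Sigma>)" by (rule posdef_gaussian_integral(2)[OF pd])
  have X: "X \<in> borel_measurable V" and sq: "integrable V (\<lambda>v. (norm (X v))\<^sup>2)"
    using cov by (auto simp: has_cov_def)
  interpret gaussian_channel V "\<lambda>v. H *v X v" by (rule gaussian_channel_input[OF V X sq])
  have P1: "measure Py (space Py) = 1" "integrable Py (\<lambda>_. c)" for c :: real
    unfolding Py_def using P.prob_space by simp_all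
  have lng: "ln (g y) = - ((y - m) \<bullet> (S *v (y - m))) - (CARD('b) * ln pi + ln (Re (det ?\<Sigma>)))" for y
    using d unfolding g_def m_def gaussian_density[OF S(1)[unfolded \<Sigma>]] \<Sigma>[symmetric]
    by (simp add: ln_div ln_mult ln_realpow)
  note q = output_quadratic[OF V cov, of H S, folded m_def Py_def]
  show "integrable Py (\<lambda>y. ln (g y))" unfolding lng using q(1) P1 by simp
  have "(\<integral>y. ln (g y) \<partial>Py) = - Re (trace (S ** ?\<Sigma>)) - (CARD('b) * ln pi + ln (Re (det ?\<Sigma>)))"
    unfolding lng using q P1 by simp
  also have "trace (S ** ?\<Sigma>) = of_nat CARD('b)" unfolding S(2) by (simp add: trace_def mat_def)
  finally show "(\<integral>y. ln (g y) \<partial>Py) = - (CARD('b) * (1 + ln pi)) - ln (Re (det ?\<Sigma>))"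
    by (simp add: algebra_simps)
qed

section \<open>Degraded channels\<close>

text \<open>A density that sees the fine message only through the coarse one is already the density
  of \<open>JU\<close>, and Radon-Nikodym derivatives are unique almost everywhere.\<close>

lemma (in channel_density) integral_ln_r_eq:
  assumes \<rho>' [measurable]: "\<rho>' \<in> borel_measurable (U \<Otimes>\<^sub>M P)" and eq: "\<And>z. \<rho> z = \<rho>' (coarse z)"
  shows "(\<integral>z. ln (r (coarse z)) \<partial>J) = (\<integral>z. ln (\<rho> z) \<partial>J)"
proof -
  have "density R (\<lambda>z. ennreal (\<rho>' z)) = JU"
  proof (rule measure_eqI)
    fix A assume "A \<in> sets (density R (\<lambda>z. ennreal (\<rho>' z)))"
    then have A [measurable]: "A \<in> sets (U \<Otimes>\<^sub>M P)" by simp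
    have "emeasure (density R (\<lambda>z. ennreal (\<rho>' z))) A = (\<integral>\<^sup>+z. ennreal (\<rho>' z) * indicator A z \<partial>R)"
      by (rule emeasure_density) auto
    also have "\<dots> = (\<integral>\<^sup>+z. ennreal (\<rho> z) * indicator A (coarse z) \<partial>(V \<Otimes>\<^sub>M P))"
      by (subst nn_integral_R) (auto simp: eq)
    also have "\<dots> = (\<integral>\<^sup>+z. indicator A (coarse z) \<partial>J)"
      by (rule nn_integral_J[symmetric]) measurable
    also have "\<dots> = (\<integral>\<^sup>+z. indicator A z \<partial>JU)"
      by (rule nn_integral_JU[symmetric]) measurable
    also have "\<dots> = emeasure JU A" by simp
    finally show "emeasure (density R (\<lambda>z. ennreal (\<rho>' z))) A = emeasure JU A" .
  qed simp
  then have "AE z in R. ennreal (\<rho>' z) = RN_deriv R JU z"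
    by (intro R.RN_deriv_unique) auto
  then have "AE z in V \<Otimes>\<^sub>M P. ennreal (\<rho>' (coarse z)) = RN_deriv R JU (coarse z)"
    unfolding R_eq_distr by (subst (asm) AE_distr_iff) (auto simp: R_eq_distr[symmetric])
  then have "AE z in V \<Otimes>\<^sub>M P. r (coarse z) = \<rho> z"
  proof eventually_elim
    case (elim z)
    then show ?case using \<rho>_pos[of z] by (simp add: r_def eq less_imp_le flip: elim)
  qed
  then have "AE z in J. r (coarse z) = \<rho> z" unfolding J_def by (subst AE_density) auto
  then show ?thesis by (intro integral_cong_AE) auto
qed

text \<open>The mutual information, in nats, between the message \<open>\<pi> v\<close> and the
  signal \<open>s v\<close> with Gaussian noise added.\<close>

definition nat_info :: "'v measure \<Rightarrow> 'u measure \<Rightarrow> ('v \<Rightarrow> 'u) \<Rightarrow> ('v \<Rightarrow> 'b::euclidean_space) \<Rightarrow> real" where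
  "nat_info V U \<pi> s =
    (\<integral>z. ln (channel_density.r V (gaussian_channel.P V s) U \<pi> (gaussian_channel.\<rho> V s) (channel_density.coarse \<pi> z))
      \<partial>channel_density.J V (gaussian_channel.P V s) (gaussian_channel.\<rho> V s))"

text \<open>The fine message can be any source \<open>V\<close> of both message and input. For a
  general input it is the pair (u, x) itself; for the Gaussian input it is the standard vector from
  which x is formed.\<close>

lemma inst_info_eq:
  fixes X :: "'v \<Rightarrow> complex ^ 'a" and H :: "complex ^ 'a ^ 'r"
  assumes V: "prob_space V" and \<pi> [measurable]: "\<pi> \<in> measurable V U"
    and X [measurable]: "X \<in> borel_measurable V" and sq: "integrable V (\<lambda>v. (norm (X v))\<^sup>2)"
  shows "inst_info U (distr V (U \<Otimes>\<^sub>M borel) (\<lambda>v. (\<pi> v, X v))) H = ereal (nat_info V U \<pi> (\<lambda>v. H *v X v) / ln 2)"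
proof -
  let ?p = "distr V (U \<Otimes>\<^sub>M borel) (\<lambda>v. (\<pi> v, X v))"
  let ?g = "gauss :: (complex ^ 'r) measure"
  interpret gaussian_channel V "\<lambda>v. H *v X v" by (rule gaussian_channel_input[OF V X sq])
  interpret channel_density V P U \<pi> \<rho> by (rule channel_density_output[OF \<pi>])
  define \<Phi> where "\<Phi> = (\<lambda>z :: 'v \<times> (complex ^ 'r). ((\<pi> (fst z), X (fst z)), snd z))"
  have [measurable]: "\<Phi> \<in> measurable (V \<Otimes>\<^sub>M ?g) ((U \<Otimes>\<^sub>M borel) \<Otimes>\<^sub>M borel)" unfolding \<Phi>_def by measurable
  have M: "?p \<Otimes>\<^sub>M ?g = distr (V \<Otimes>\<^sub>M ?g) ((U \<Otimes>\<^sub>M borel) \<Otimes>\<^sub>M borel) \<Phi>"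
  proof -
    have "?p \<Otimes>\<^sub>M ?g = ?p \<Otimes>\<^sub>M distr ?g borel (\<lambda>w. w)" by (simp add: distr_id2)
    also have "\<dots> = distr (V \<Otimes>\<^sub>M ?g) ((U \<Otimes>\<^sub>M borel) \<Otimes>\<^sub>M borel) (\<lambda>(x, y). ((\<pi> x, X x), y))"
      by (rule pair_measure_distr) (auto simp: distr_id2 gauss.sigma_finite_measure_axioms)
    finally show ?thesis by (simp add: \<Phi>_def split_def)
  qed
  have pM: "prob_space (?p \<Otimes>\<^sub>M ?g)"
    unfolding M by (rule prob_space.prob_space_distr[OF prob_space_VG]) measurable
  have fst_VG: "distr (V \<Otimes>\<^sub>M ?g) V fst = V"
    by (rule prob_space.distr_pair_fst[OF prob_space_gauss])
  have 1: "distr (?p \<Otimes>\<^sub>M ?g) (U \<Otimes>\<^sub>M borel) (\<lambda>\<omega>. ((\<lambda>((u, x), w). u) \<omega>, (\<lambda>((u, x), w). H *v x + w) \<omega>)) = JU"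
  proof -
    have "distr (?p \<Otimes>\<^sub>M ?g) (U \<Otimes>\<^sub>M borel) (\<lambda>\<omega>. ((\<lambda>((u, x), w). u) \<omega>, (\<lambda>((u, x), w). H *v x + w) \<omega>))
        = distr (V \<Otimes>\<^sub>M ?g) (U \<Otimes>\<^sub>M borel) (\<lambda>z. (\<pi> (fst z), H *v X (fst z) + snd z))"
      unfolding M by (subst distr_distr) (auto simp: \<Phi>_def comp_def split_def)
    also have "\<dots> = distr (distr (V \<Otimes>\<^sub>M ?g) (V \<Otimes>\<^sub>M borel) out) (U \<Otimes>\<^sub>M borel) coarse"
      by (subst distr_distr) (auto simp: out_def coarse_def comp_def)
    also have "\<dots> = JU"
      unfolding JU_def J_def joint_law by (intro distr_cong refl sets_pair_measure_cong) auto
    finally show ?thesis .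
  qed
  have 2: "distr (?p \<Otimes>\<^sub>M ?g) U (\<lambda>((u, x), w). u) = distr V U \<pi>"
  proof -
    have "distr (?p \<Otimes>\<^sub>M ?g) U (\<lambda>((u, x), w). u) = distr (V \<Otimes>\<^sub>M ?g) U (\<lambda>z. \<pi> (fst z))"
      unfolding M by (subst distr_distr) (auto simp: \<Phi>_def comp_def split_def)
    also have "\<dots> = distr (distr (V \<Otimes>\<^sub>M ?g) V fst) U \<pi>" by (subst distr_distr) (auto simp: comp_def)
    finally show ?thesis by (simp add: fst_VG)
  qed
  have 3: "distr (?p \<Otimes>\<^sub>M ?g) borel (\<lambda>((u, x), w). H *v x + w) = P"
    unfolding M distr_output[symmetric] by (subst distr_distr) (auto simp: \<Phi>_def comp_def split_def)
  show ?thesis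
    unfolding inst_info_def std_cgaussian_eq_gauss nat_info_def
    by (rule mutual_info_eq[OF pM 1 2 3])
qed

text \<open>The condition says that the block row of \<open>C\<close> and \<open>D\<close> has its
  adjoint as right inverse, so \<open>distr_gauss_coisometry\<close> applies on the product
  space.\<close>

lemma distr_gauss_degraded:
  fixes C :: "complex ^ 'b ^ 'e" and D :: "complex ^ 'd ^ 'e"
  assumes CD: "C ** cadjoint C + D ** cadjoint D = mat 1"
  shows "distr (gauss \<Otimes>\<^sub>M gauss) borel (\<lambda>z. C *v fst z + D *v snd z) = gauss"
  unfolding gauss_pair
proof (rule distr_gauss_coisometry[where Q="\<lambda>w. (cadjoint C *v w, cadjoint D *v w)"])
  show "linear (\<lambda>z. C *v fst z + D *v snd z)"
    by (intro linearI) (simp_all add: matrix_vector_right_distrib linear_scale[OF matrix_vector_mul_linear] scaleR_right_distrib)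
  show "linear (\<lambda>w. (cadjoint C *v w, cadjoint D *v w))"
    by (intro linearI) (simp_all add: matrix_vector_right_distrib linear_scale[OF matrix_vector_mul_linear])
  show "C *v fst (cadjoint C *v w, cadjoint D *v w) + D *v snd (cadjoint C *v w, cadjoint D *v w) = w" for w
    by (simp add: matrix_vector_mul_assoc matrix_vector_mult_add_rdistrib[symmetric] CD)
qed (simp add: inner_add_left inner_cadjoint inner_prod_def)

text \<open>By linearity the degraded output is \<open>C *v s v\<close> plus the combined noise
  \<open>C *v y + D *v w\<close>, which is standard again.\<close>

lemma nn_integral_degraded:
  fixes C :: "complex ^ 'b ^ 'e" and D :: "complex ^ 'd ^ 'e"
  assumes CD: "C ** cadjoint C + D ** cadjoint D = mat 1"
    and V: "prob_space V" and s [measurable]: "s \<in> borel_measurable V"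
    and h [measurable]: "h \<in> borel_measurable (V \<Otimes>\<^sub>M borel)"
  shows "(\<integral>\<^sup>+z. \<integral>\<^sup>+w. h (fst z, C *v (s (fst z) + snd z) + D *v w) \<partial>gauss \<partial>(V \<Otimes>\<^sub>M gauss))
    = (\<integral>\<^sup>+z. h (fst z, C *v s (fst z) + snd z) \<partial>(V \<Otimes>\<^sub>M gauss))"
proof -
  have "(\<integral>\<^sup>+z. \<integral>\<^sup>+w. h (fst z, C *v (s (fst z) + snd z) + D *v w) \<partial>gauss \<partial>(V \<Otimes>\<^sub>M gauss))
      = (\<integral>\<^sup>+v. \<integral>\<^sup>+y. \<integral>\<^sup>+w. h (v, C *v s v + (C *v y + D *v w)) \<partial>gauss \<partial>gauss \<partial>V)"
    by (subst gauss.nn_integral_fst[symmetric]) (auto simp: matrix_vector_right_distrib add.assoc)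
  also have "\<dots> = (\<integral>\<^sup>+v. \<integral>\<^sup>+w. h (v, C *v s v + w) \<partial>gauss \<partial>V)"
  proof (rule nn_integral_cong)
    fix v assume [measurable]: "v \<in> space V"
    have "(\<integral>\<^sup>+y. \<integral>\<^sup>+w. h (v, C *v s v + (C *v y + D *v w)) \<partial>gauss \<partial>gauss)
        = (\<integral>\<^sup>+z. h (v, C *v s v + (C *v fst z + D *v snd z)) \<partial>(gauss \<Otimes>\<^sub>M gauss))"
      by (subst gauss.nn_integral_fst[symmetric]) auto
    also have "\<dots> = (\<integral>\<^sup>+w. h (v, C *v s v + w) \<partial>distr (gauss \<Otimes>\<^sub>M gauss) borel (\<lambda>z. C *v fst z + D *v snd z))"
      by (rule nn_integral_distr[symmetric]) measurable
    finally show "(\<integral>\<^sup>+y. \<integral>\<^sup>+w. h (v, C *v s v + (C *v y + D *v w)) \<partial>gauss \<partial>gauss)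
        = (\<integral>\<^sup>+w. h (v, C *v s v + w) \<partial>gauss)"
      by (simp only: distr_gauss_degraded[OF CD])
  qed
  also have "\<dots> = (\<integral>\<^sup>+z. h (fst z, C *v s (fst z) + snd z) \<partial>(V \<Otimes>\<^sub>M gauss))"
    by (subst gauss.nn_integral_fst[symmetric]) auto
  finally show ?thesis .
qed

lemma distr_degraded_output:
  fixes C :: "complex ^ 'b ^ 'e" and D :: "complex ^ 'd ^ 'e"
  assumes CD: "C ** cadjoint C + D ** cadjoint D = mat 1"
    and ch: "gaussian_channel V s" "gaussian_channel V (\<lambda>v. C *v s v)"
  shows "distr (gaussian_channel.P V s \<Otimes>\<^sub>M gauss) borel (\<lambda>z. C *v fst z + D *v snd z)
    = gaussian_channel.P V (\<lambda>v. C *v s v)"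
proof -
  interpret Y: gaussian_channel V s by fact
  interpret Z: gaussian_channel V "\<lambda>v. C *v s v" by fact
  let ?k = "\<lambda>z. C *v fst z + D *v snd z"
  show ?thesis
  proof (rule measure_eqI)
    fix A assume "A \<in> sets (distr (Y.P \<Otimes>\<^sub>M gauss) borel ?k)"
    then have [measurable]: "A \<in> sets borel" by simp
    have "emeasure (distr (Y.P \<Otimes>\<^sub>M gauss) borel ?k) A = (\<integral>\<^sup>+z. indicator A z \<partial>distr (Y.P \<Otimes>\<^sub>M gauss) borel ?k)" by simp
    also have "\<dots> = (\<integral>\<^sup>+z. indicator A (?k z) \<partial>(Y.P \<Otimes>\<^sub>M gauss))" by (rule nn_integral_distr) auto
    also have "\<dots> = (\<integral>\<^sup>+y. \<integral>\<^sup>+w. indicator A (C *v y + D *v w) \<partial>gauss \<partial>Y.P)"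
      by (subst gauss.nn_integral_fst[symmetric]) auto
    also have "\<dots> = (\<integral>\<^sup>+z. \<integral>\<^sup>+w. indicator A (C *v (s (fst z) + snd z) + D *v w) \<partial>gauss \<partial>(V \<Otimes>\<^sub>M gauss))"
      by (rule Y.nn_integral_output_P[symmetric]) measurable
    also have "\<dots> = (\<integral>\<^sup>+z. indicator A (C *v s (fst z) + snd z) \<partial>(V \<Otimes>\<^sub>M gauss))"
      using nn_integral_degraded[OF CD Y.V.prob_space_axioms Y.s, of "\<lambda>z. indicator A (snd z)"] by simp
    also have "\<dots> = (\<integral>\<^sup>+z. indicator A z \<partial>Z.P)" by (rule Z.nn_integral_output_P) measurable
    finally show "emeasure (distr (Y.P \<Otimes>\<^sub>M gauss) borel ?k) A = emeasure Z.P A" by simp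
  qed simp
qed

text \<open>This is the premise \<open>link\<close> of \<open>data_processing\<close>. It is an
  equation of laws, so the noise of the degraded copy may be built from that of y although the
  noises of the true outputs are independent.\<close>

lemma degraded_joint_law:
  fixes C :: "complex ^ 'b ^ 'e" and D :: "complex ^ 'd ^ 'e"
  assumes CD: "C ** cadjoint C + D ** cadjoint D = mat 1"
    and ch: "gaussian_channel V s" "gaussian_channel V (\<lambda>v. C *v s v)"
  defines "J \<equiv> density (V \<Otimes>\<^sub>M gaussian_channel.P V s) (\<lambda>z. ennreal (gaussian_channel.\<rho> V s z))"
    and "J' \<equiv> density (V \<Otimes>\<^sub>M gaussian_channel.P V (\<lambda>v. C *v s v)) (\<lambda>z. ennreal (gaussian_channel.\<rho> V (\<lambda>v. C *v s v) z))"
  shows "J' = distr (J \<Otimes>\<^sub>M gauss) (V \<Otimes>\<^sub>M gaussian_channel.P V (\<lambda>v. C *v s v)) (\<lambda>((v, y), w). (v, C *v y + D *v w))"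
proof -
  interpret Y: gaussian_channel V s by fact
  interpret Z: gaussian_channel V "\<lambda>v. C *v s v" by fact
  have J: "J = distr (V \<Otimes>\<^sub>M gauss) (V \<Otimes>\<^sub>M borel) Y.out" unfolding J_def by (rule Y.joint_law)
  have J': "J' = distr (V \<Otimes>\<^sub>M gauss) (V \<Otimes>\<^sub>M borel) Z.out" unfolding J'_def by (rule Z.joint_law)
  have [measurable_cong]: "sets J = sets (V \<Otimes>\<^sub>M borel)" by (simp add: J)
  let ?k = "\<lambda>z. (fst (fst z), C *v snd (fst z) + D *v snd z)"
  have k [measurable]: "?k \<in> measurable (J \<Otimes>\<^sub>M gauss) (V \<Otimes>\<^sub>M borel)" by measurable
  have "J' = distr (J \<Otimes>\<^sub>M gauss) (V \<Otimes>\<^sub>M borel) ?k"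
  proof (rule measure_eqI)
    fix A assume "A \<in> sets J'"
    then have [measurable]: "A \<in> sets (V \<Otimes>\<^sub>M borel)" by (simp add: J')
    have "emeasure J' A = (\<integral>\<^sup>+z. indicator A z \<partial>J')" using \<open>A \<in> sets J'\<close> by simp
    also have "\<dots> = (\<integral>\<^sup>+z. indicator A (Z.out z) \<partial>(V \<Otimes>\<^sub>M gauss))"
      unfolding J' by (rule nn_integral_distr) auto
    also have "\<dots> = (\<integral>\<^sup>+z. \<integral>\<^sup>+w. indicator A (fst z, C *v (s (fst z) + snd z) + D *v w) \<partial>gauss \<partial>(V \<Otimes>\<^sub>M gauss))"
      unfolding Z.out_def by (rule nn_integral_degraded[OF CD Y.V.prob_space_axioms Y.s, symmetric]) measurable
    also have "\<dots> = (\<integral>\<^sup>+z. \<integral>\<^sup>+w. indicator A (?k (z, w)) \<partial>gauss \<partial>J)"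
      unfolding J by (subst nn_integral_distr) (auto simp: Y.out_def)
    also have "\<dots> = (\<integral>\<^sup>+z. indicator A (?k z) \<partial>(J \<Otimes>\<^sub>M gauss))"
      by (subst gauss.nn_integral_fst) auto
    also have "\<dots> = (\<integral>\<^sup>+z. indicator A z \<partial>distr (J \<Otimes>\<^sub>M gauss) (V \<Otimes>\<^sub>M borel) ?k)"
      by (rule nn_integral_distr[symmetric]) auto
    finally show "emeasure J' A = emeasure (distr (J \<Otimes>\<^sub>M gauss) (V \<Otimes>\<^sub>M borel) ?k) A" by simp
  qed (simp add: J')
  also have "\<dots> = distr (J \<Otimes>\<^sub>M gauss) (V \<Otimes>\<^sub>M Z.P) (\<lambda>((v, y), w). (v, C *v y + D *v w))"
    by (intro distr_cong) (auto simp: split_def)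
  finally show ?thesis .
qed

section \<open>The secrecy rate\<close>

text \<open>The rate in nats of the direct Gaussian input with covariance \<open>K\<close>. For
  positive semidefinite \<open>K\<close> the determinant is real and positive, so \<open>Re\<close>
  discards nothing.\<close>

definition ln_det :: "complex ^ 'a ^ 'a \<Rightarrow> complex ^ 'a ^ 'r \<Rightarrow> real" where
  "ln_det K H = ln (Re (det (mat 1 + H ** K ** cadjoint H)))"

lemma nat_info_diff_le:
  fixes X :: "'v \<Rightarrow> complex ^ 'a" and H :: "complex ^ 'a ^ 'b" and C :: "complex ^ 'b ^ 'e" and D :: "complex ^ 'e ^ 'e"
  assumes V: "prob_space V" and \<pi>: "\<pi> \<in> measurable V U" and cov: "has_cov V X K" and K: "pos_semidef K"
    and CD: "C ** cadjoint C + D ** cadjoint D = mat 1"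
  shows "nat_info V U \<pi> (\<lambda>v. H *v X v) - nat_info V U \<pi> (\<lambda>v. (C ** H) *v X v) \<le> ln_det K H - ln_det K (C ** H)"
proof -
  obtain A :: "complex ^ 'a ^ 'a" where A: "A ** cadjoint A = K" using pos_semidef_factorization[OF K] by metis
  have X [measurable]: "X \<in> borel_measurable V" and sq: "integrable V (\<lambda>v. (norm (X v))\<^sup>2)"
    using cov by (auto simp: has_cov_def)
  let ?s = "\<lambda>v. H *v X v" and ?s' = "\<lambda>v. C *v (H *v X v)"
  have s': "(\<lambda>v. (C ** H) *v X v) = ?s'" by (simp add: matrix_vector_mul_assoc)
  have chY: "gaussian_channel V ?s" by (rule gaussian_channel_input[OF V X sq])
  have chZ: "gaussian_channel V ?s'"
    using gaussian_channel_input[OF V X sq, of "C ** H"] unfolding s' .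
  interpret Y: gaussian_channel V ?s by (rule chY)
  interpret Z: gaussian_channel V ?s' by (rule chZ)
  define \<kappa> where "\<kappa> = (\<lambda>z :: (complex ^ 'b) \<times> (complex ^ 'e). C *v fst z + D *v snd z)"
  have [measurable]: "\<kappa> \<in> measurable (borel \<Otimes>\<^sub>M gauss) borel" unfolding \<kappa>_def by measurable

  \<comment> \<open>The message \<open>\<pi> v\<close> is replaced by the whole of \<open>v\<close>,
    which determines the transmitted vector.\<close>
  have dp: "nat_info V U \<pi> ?s - nat_info V U \<pi> ?s'
      \<le> (\<integral>z. ln (Y.\<rho> z) \<partial>density (V \<Otimes>\<^sub>M Y.P) (\<lambda>z. ennreal (Y.\<rho> z)))
        - (\<integral>z. ln (Z.\<rho> z) \<partial>density (V \<Otimes>\<^sub>M Z.P) (\<lambda>z. ennreal (Z.\<rho> z)))"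
  proof -
    have cdY: "channel_density V Y.P U \<pi> Y.\<rho>" by (rule Y.channel_density_output[OF \<pi>])
    have cdZ: "channel_density V Z.P U \<pi> Z.\<rho>" by (rule Z.channel_density_output[OF \<pi>])
    have "\<kappa> \<in> measurable (Y.P \<Otimes>\<^sub>M gauss) Z.P" by measurable
    moreover have "channel_density.J V Z.P Z.\<rho>
        = distr (channel_density.J V Y.P Y.\<rho> \<Otimes>\<^sub>M gauss) (V \<Otimes>\<^sub>M Z.P) (\<lambda>((v, y), w). (v, \<kappa> (y, w)))"
      unfolding channel_density.J_def[OF cdY] channel_density.J_def[OF cdZ] \<kappa>_def
      using degraded_joint_law[OF CD chY chZ] by simp
    ultimately show ?thesis
      unfolding nat_info_def channel_density.J_def[OF cdY, symmetric] channel_density.J_def[OF cdZ, symmetric]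
      by (rule data_processing[OF cdY cdZ prob_space_gauss])
  qed

  \<comment> \<open>Reference densities: the outputs of a Gaussian input with covariance
    \<open>K\<close> and the mean of \<open>X\<close>. Matching the mean centres the quadratic forms
    in their exponents.\<close>
  define g where "g = gaussian_channel.f gauss (\<lambda>w. H *v mean V X + (H ** A) *v w)"
  define g' where "g' = gaussian_channel.f gauss (\<lambda>w. (C ** H) *v mean V X + (C ** H ** A) *v w)"
  have chG: "gaussian_channel gauss (\<lambda>w. H *v mean V X + (H ** A) *v w)" by (rule gaussian_channel_linear)
  \<comment> \<open>The reference signal for z is \<open>C\<close> applied to the one for y, so the
    kernel \<kappa> links the references exactly as it links the true outputs.\<close>
  have eqG: "(\<lambda>w. (C ** H) *v mean V X + (C ** H ** A) *v w) = (\<lambda>w. C *v (H *v mean V X + (H ** A) *v w))"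
    by (simp add: matrix_vector_right_distrib matrix_vector_mul_assoc matrix_mul_assoc)
  have chG': "gaussian_channel gauss (\<lambda>w. C *v (H *v mean V X + (H ** A) *v w))"
    using gaussian_channel_linear[of "(C ** H) *v mean V X" "C ** H ** A"] unfolding eqG .
  interpret G: gaussian_channel gauss "\<lambda>w. H *v mean V X + (H ** A) *v w" by (rule chG)
  interpret G': gaussian_channel gauss "\<lambda>w. C *v (H *v mean V X + (H ** A) *v w)" by (rule chG')
  have cov': "has_cov V X (A ** cadjoint A)" using cov by (simp add: A)
  note g_int = integral_ln_gaussian_density[OF V cov', of H, folded g_def, unfolded A]
  note g'_int = integral_ln_gaussian_density[OF V cov', of "C ** H", folded g'_def, unfolded A s']

  have "(\<integral>z. ln (Z.f z) \<partial>Z.P) - (\<integral>z. ln (g' z) \<partial>Z.P) \<le> (\<integral>y. ln (Y.f y) \<partial>Y.P) - (\<integral>y. ln (g y) \<partial>Y.P)"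
    unfolding Y.P_def Z.P_def
  proof (rule kl_data_processing[where N = "gauss :: (complex ^ 'e) measure" and \<kappa> = \<kappa>])
    show "g \<in> borel_measurable borel" "\<And>y. 0 < g y" unfolding g_def by (auto simp: G.f_pos)
    show "g' \<in> borel_measurable borel" "\<And>z. 0 < g' z" unfolding g'_def eqG by (auto simp: G'.f_pos)
    show "prob_space (density lborel (\<lambda>y. ennreal (Y.f y)))" using Y.P.prob_space_axioms by (simp add: Y.P_def)
    show "prob_space (density lborel (\<lambda>y. ennreal (Z.f y)))" using Z.P.prob_space_axioms by (simp add: Z.P_def)
    show "prob_space (density lborel (\<lambda>y. ennreal (g y)))" using G.P.prob_space_axioms by (simp add: G.P_def g_def)
    show "distr (density lborel (\<lambda>y. ennreal (Y.f y)) \<Otimes>\<^sub>M gauss) borel \<kappa> = density lborel (\<lambda>z. ennreal (Z.f z))"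
      using distr_degraded_output[OF CD chY chZ] by (simp add: Y.P_def Z.P_def \<kappa>_def)
    show "distr (density lborel (\<lambda>y. ennreal (g y)) \<Otimes>\<^sub>M gauss) borel \<kappa> = density lborel (\<lambda>z. ennreal (g' z))"
      using distr_degraded_output[OF CD chG chG'] by (simp add: G.P_def G'.P_def \<kappa>_def g_def g'_def eqG)
    show "integrable (density lborel (\<lambda>y. ennreal (Y.f y))) (\<lambda>y. ln (Y.f y))"
      using Y.integrable_ln_f by (simp add: Y.P_def)
    show "integrable (density lborel (\<lambda>y. ennreal (Z.f y))) (\<lambda>y. ln (Z.f y))"
      using Z.integrable_ln_f by (simp add: Z.P_def)
    show "integrable (density lborel (\<lambda>y. ennreal (Y.f y))) (\<lambda>y. ln (g y))"
      using g_int(1) by (simp add: Y.P_def)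
    show "integrable (density lborel (\<lambda>y. ennreal (Z.f y))) (\<lambda>y. ln (g' y))"
      using g'_int(1) by (simp add: Z.P_def)
  qed (auto simp: Y.f_pos Z.f_pos prob_space_gauss)
  \<comment> \<open>The noise entropies of \<open>integral_ln_\<rho>\<close> cancel against the
    constants of the reference integrals, leaving the two logarithms of determinants.\<close>
  with dp show ?thesis
    unfolding Y.integral_ln_\<rho> Z.integral_ln_\<rho> g_int(2) g'_int(2) ln_det_def s' by simp
qed

text \<open>A singular \<open>A\<close> makes the message \<open>e (A *v w)\<close> coarser than
  \<open>w\<close>, but the likelihood depends on \<open>w\<close> only through
  \<open>A *v w\<close>, which \<open>inv e\<close> recovers. So \<open>integral_ln_r_eq\<close>
  applies, and the output is exactly Gaussian.\<close>

lemma nat_info_gaussian: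
  fixes A :: "complex ^ 'a ^ 'a" and H :: "complex ^ 'a ^ 'b" and e :: "complex ^ 'a \<Rightarrow> 'u"
  assumes e: "inj e"
  shows "nat_info gauss (direct_alphabet e) (\<lambda>w. e (A *v w)) (\<lambda>w. H *v (A *v w)) = ln_det (A ** cadjoint A) H"
proof -
  let ?s = "\<lambda>w. H *v (A *v w)"
  have cov: "has_cov gauss ((*v) A) (A ** cadjoint A)" and mean: "mean gauss ((*v) A) = 0"
    by (rule gauss_linear_cov)+
  have m: "(*v) A \<in> borel_measurable gauss" by measurable
  interpret gaussian_channel gauss ?s
    by (rule gaussian_channel_input[OF prob_space_gauss m integrable_gauss_linear_square])
  have em [measurable]: "e \<in> measurable borel (direct_alphabet e)"
    unfolding direct_alphabet_def using e by (rule measurable_embed_measure2)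
  have inv_em [measurable]: "inv e \<in> measurable (direct_alphabet e) borel"
    unfolding direct_alphabet_def using e by (intro measurable_embed_measure1) simp
  have \<pi>: "(\<lambda>w. e (A *v w)) \<in> measurable gauss (direct_alphabet e)" by measurable
  interpret channel_density gauss P "direct_alphabet e" "\<lambda>w. e (A *v w)" \<rho> by (rule channel_density_output[OF \<pi>])
  define \<rho>' where "\<rho>' z = gauss_density (snd z - H *v inv e (fst z)) / f (snd z)" for z
  have "nat_info gauss (direct_alphabet e) (\<lambda>w. e (A *v w)) ?s = (\<integral>z. ln (\<rho> z) \<partial>J)"
    unfolding nat_info_def
  proof (rule integral_ln_r_eq)
    show "\<rho>' \<in> borel_measurable (direct_alphabet e \<Otimes>\<^sub>M P)" unfolding \<rho>'_def[abs_def] by measurable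
    show "\<rho> z = \<rho>' (coarse z)" for z
      by (simp add: \<rho>'_def \<rho>_def coarse_def split_def inv_f_f[OF e])
  qed
  also have "\<dots> = - (CARD('b) * (1 + ln pi)) - (\<integral>y. ln (f y) \<partial>P)"
    unfolding J_def integral_ln_\<rho>(2) by simp
  also have "(\<integral>y. ln (f y) \<partial>P) = - (CARD('b) * (1 + ln pi)) - ln_det (A ** cadjoint A) H"
    using integral_ln_gaussian_density(2)[OF prob_space_gauss cov, of H]
    by (simp add: mean ln_det_def matrix_vector_mul_assoc)
  finally show ?thesis by simp
qed

lemma
  fixes A :: "complex ^ 'a ^ 'a" and e :: "complex ^ 'a \<Rightarrow> 'u"
  assumes e: "inj e"
  defines "\<mu> \<equiv> distr std_cgaussian borel (\<lambda>w. A *v w)"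
  shows direct_input_gaussian: "direct_input e \<mu> = distr gauss (direct_alphabet e \<Otimes>\<^sub>M borel) (\<lambda>w. (e (A *v w), A *v w))"
    and input_law_direct: "input_law (direct_alphabet e) (direct_input e \<mu>)"
    and has_cov_direct: "has_cov (direct_input e \<mu>) snd (A ** cadjoint A)"
    and inst_info_direct: "inst_info (direct_alphabet e) (direct_input e \<mu>) H = ereal (ln_det (A ** cadjoint A) H / ln 2)"
proof -
  have em [measurable]: "e \<in> measurable borel (direct_alphabet e)"
    unfolding direct_alphabet_def using e by (rule measurable_embed_measure2)
  show eq: "direct_input e \<mu> = distr gauss (direct_alphabet e \<Otimes>\<^sub>M borel) (\<lambda>w. (e (A *v w), A *v w))"
    unfolding direct_input_def \<mu>_def std_cgaussian_eq_gauss by (subst distr_distr) (auto simp: comp_def)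
  have m: "(\<lambda>w. (e (A *v w), A *v w)) \<in> measurable gauss (direct_alphabet e \<Otimes>\<^sub>M borel)" by measurable
  show "input_law (direct_alphabet e) (direct_input e \<mu>)"
    unfolding input_law_def eq using prob_space.prob_space_distr[OF prob_space_gauss m] by simp
  show "has_cov (direct_input e \<mu>) snd (A ** cadjoint A)"
  proof -
    have c: "has_cov gauss ((*v) A) (A ** cadjoint A)" by (rule gauss_linear_cov)
    have i: "(\<integral>z. h (snd z) \<partial>direct_input e \<mu>) = (\<integral>w. h (A *v w) \<partial>gauss)"
      if [measurable]: "h \<in> borel_measurable borel" for h :: "complex ^ 'a \<Rightarrow> complex"
      unfolding eq by (subst integral_distr[OF m]) auto
    have j: "(\<integral>z. snd z $ k \<partial>direct_input e \<mu>) = (\<integral>w. (A *v w) $ k \<partial>gauss)" for k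
      by (rule i) measurable
    have "integrable (direct_input e \<mu>) (\<lambda>z. (norm (snd z))\<^sup>2)"
      unfolding eq using c by (subst integrable_distr_eq[OF m]) (auto simp: has_cov_def)
    moreover have "snd \<in> borel_measurable (direct_input e \<mu>)" unfolding eq by measurable
    moreover have "(A ** cadjoint A) $ k $ l = (\<integral>z. (snd z $ k - (\<integral>z'. snd z' $ k \<partial>direct_input e \<mu>))
        * cnj (snd z $ l - (\<integral>z'. snd z' $ l \<partial>direct_input e \<mu>)) \<partial>direct_input e \<mu>)" for k l
      unfolding j using c by (subst i) (auto simp: has_cov_def)
    ultimately show ?thesis unfolding has_cov_def by blast
  qed
  show "inst_info (direct_alphabet e) (direct_input e \<mu>) H = ereal (ln_det (A ** cadjoint A) H / ln 2)"
  proof -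
    have "(\<lambda>w. e (A *v w)) \<in> measurable gauss (direct_alphabet e)" "(*v) A \<in> borel_measurable gauss" by measurable
    from inst_info_eq[OF prob_space_gauss this integrable_gauss_linear_square, of H]
    show ?thesis unfolding eq nat_info_gaussian[OF e] by simp
  qed
qed

text \<open>Every point outside the support lies in a null set of a countable basis, and the union
  of these sets is null. This turns the less-noisy hypothesis on the support into an almost sure
  statement.\<close>

lemma AE_law_support:
  fixes Q :: "'w::second_countable_topology measure"
  assumes sets: "sets Q = sets borel"
  shows "AE c in Q. c \<in> law_support Q"
proof -
  obtain B :: "'w set set" where B: "countable B" "topological_basis B"
    using ex_countable_basis by blast
  let ?N = "\<Union>{b \<in> B. emeasure Q b = 0}"
  have "?N \<in> null_sets Q"
    using B topological_basis_open[OF B(2)] sets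
    by (intro null_sets_UN'[where N="\<lambda>b. b" and I="{b \<in> B. emeasure Q b = 0}", simplified]) (auto simp: null_sets_def)
  then have "AE c in Q. c \<notin> ?N" by (rule AE_not_in)
  then show ?thesis
  proof eventually_elim
    case (elim c)
    show ?case unfolding law_support_def
    proof (safe)
      fix V assume V: "open V" "c \<in> V"
      then obtain b where b: "b \<in> B" "c \<in> b" "b \<subseteq> V" using topological_basisE[OF B(2)] by metis
      then have "0 < emeasure Q b" using elim by (auto simp: zero_less_iff_neq_zero)
      also have "\<dots> \<le> emeasure Q V" using b V sets by (intro emeasure_mono) auto
      finally show "0 < emeasure Q V" .
    qed
  qed
qed

lemma eexpectation_mono_AE:
  assumes "AE x in M. f x \<le> g x" shows "eexpectation M f \<le> eexpectation M g"
  unfolding eexpectation_def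
proof (rule ereal_minus_mono)
  show "enn2ereal (\<integral>\<^sup>+\<omega>. e2ennreal (f \<omega>) \<partial>M) \<le> enn2ereal (\<integral>\<^sup>+\<omega>. e2ennreal (g \<omega>) \<partial>M)"
    unfolding less_eq_ennreal.rep_eq[symmetric]
    by (rule nn_integral_mono_AE, use assms in eventually_elim) (rule e2ennreal_mono)
  show "enn2ereal (\<integral>\<^sup>+\<omega>. e2ennreal (- g \<omega>) \<partial>M) \<le> enn2ereal (\<integral>\<^sup>+\<omega>. e2ennreal (- f \<omega>) \<partial>M)"
    unfolding less_eq_ennreal.rep_eq[symmetric]
    by (rule nn_integral_mono_AE, use assms in eventually_elim) (intro e2ennreal_mono, simp)
qed

lemma log_det_ratio:
  assumes "pos_semidef K"
  shows "log 2 (Re (det (mat 1 + H ** K ** cadjoint H) / det (mat 1 + G ** K ** cadjoint G)))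
    = (ln_det K H - ln_det K G) / ln 2"
proof -
  obtain A :: "complex ^ 'a ^ 'a" where A: "A ** cadjoint A = K" using pos_semidef_factorization[OF assms] by metis
  have p: "posdef (mat 1 + L ** K ** cadjoint L)" for L :: "complex ^ 'a ^ 'k"
  proof -
    have "mat 1 + L ** K ** cadjoint L = mat 1 + (L ** A) ** cadjoint (L ** A)"
      by (simp add: A[symmetric] cadjoint_mult matrix_mul_assoc)
    then show ?thesis by (simp only: posdef_one_plus_gram)
  qed
  define a where "a = Re (det (mat 1 + H ** K ** cadjoint H))"
  define b where "b = Re (det (mat 1 + G ** K ** cadjoint G))"
  have "0 < a" "0 < b" unfolding a_def b_def by (intro posdef_gaussian_integral p)+
  moreover have "det (mat 1 + H ** K ** cadjoint H) / det (mat 1 + G ** K ** cadjoint G) = complex_of_real (a / b)"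
    unfolding of_real_divide a_def b_def posdef_gaussian_integral(1)[OF p, symmetric] ..
  ultimately show ?thesis
    by (simp add: ln_det_def a_def[symmetric] b_def[symmetric] log_def ln_div)
qed

text \<open>Gaussian inputs supported on the line through \<open>v\<close> compare the gains of the two channels along \<open>v\<close>.\<close>

lemma less_noisy_gain:
  fixes H :: "complex ^ 'a ^ 'b" and G :: "complex ^ 'a ^ 'e" and e :: "complex ^ 'a \<Rightarrow> 'u"
  assumes e: "inj e"
    and less_noisy: "\<And>(U :: 'u measure) p. input_law U p \<Longrightarrow> inst_info U p G \<le> inst_info U p H"
  shows "norm (G *v v) \<le> norm (H *v v)"
proof -
  obtain A :: "complex ^ 'a ^ 'a" where A: "A ** cadjoint A = outer v" using pos_semidef_factorization[OF pos_semidef_outer] by metis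
  \<comment> \<open>On the line through \<open>v\<close> the channel is scalar with power gain the
    squared norm of \<open>L *v v\<close>, and the rate increases with that gain.\<close>
  have ld: "ln_det (outer v) L = ln (1 + (norm (L *v v))\<^sup>2)" for L :: "complex ^ 'a ^ 'k"
    by (simp add: ln_det_def outer_congruence det_one_plus_outer del: of_real_add of_real_power)
  have "ln_det (outer v) G / ln 2 \<le> ln_det (outer v) H / ln 2"
    using less_noisy[OF input_law_direct[OF e, of A]] by (simp add: inst_info_direct[OF e] A)
  then have "ln (1 + (norm (G *v v))\<^sup>2) \<le> ln (1 + (norm (H *v v))\<^sup>2)"
    by (simp add: ld divide_le_cancel)
  then have "(norm (G *v v))\<^sup>2 \<le> (norm (H *v v))\<^sup>2"
    by (subst (asm) ln_le_cancel_iff) (auto intro: add_pos_nonneg)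
  then show ?thesis by (simp add: abs_le_square_iff[symmetric])
qed

lemma inst_info_diff_le:
  fixes H :: "complex ^ 'a ^ 'b" and G :: "complex ^ 'a ^ 'e"
  assumes gain: "\<And>v. norm (G *v v) \<le> norm (H *v v)" and K: "pos_semidef K"
    and p: "input_law U p" "has_cov p snd K"
  shows "inst_info U p H - inst_info U p G \<le> ereal ((ln_det K H - ln_det K G) / ln 2)"
proof -
  obtain C :: "complex ^ 'b ^ 'e" and D :: "complex ^ 'e ^ 'e" where
    G: "G = C ** H" and CD: "C ** cadjoint C + D ** cadjoint D = mat 1"
    using degradation[OF gain] by metis
  have pp: "prob_space p" and sp [measurable_cong]: "sets p = sets (U \<Otimes>\<^sub>M borel)" using p(1) by (auto simp: input_law_def)
  have m: "fst \<in> measurable p U" "snd \<in> borel_measurable p" by measurable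
  have sq: "integrable p (\<lambda>z. (norm (snd z))\<^sup>2)" using p(2) by (simp add: has_cov_def)
  have "distr p (U \<Otimes>\<^sub>M borel) (\<lambda>z. (fst z, snd z)) = p"
    using sp by (simp add: distr_id2)
  then have i: "inst_info U p L = ereal (nat_info p U fst (\<lambda>z. L *v snd z) / ln 2)" for L :: "complex ^ 'a ^ 'k"
    using inst_info_eq[OF pp m sq, of L] by simp
  have "nat_info p U fst (\<lambda>z. H *v snd z) - nat_info p U fst (\<lambda>z. G *v snd z) \<le> ln_det K H - ln_det K G"
    unfolding G by (rule nat_info_diff_le[OF pp m(1) p(2) K CD])
  then show ?thesis
    unfolding i by (simp add: diff_divide_distrib[symmetric] divide_right_mono)
qed

theorem theorem2:
  fixes Q :: "((complex ^ 'a ^ 'b) \<times> (complex ^ 'a ^ 'e)) measure"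
    and K :: "complex ^ 'a ^ 'a"
    and e :: "complex ^ 'a \<Rightarrow> 'u"
  assumes "prob_space Q" and "sets Q = sets borel"
    and "pos_semidef K"
    and "inj e"
    and "uniformly_less_noisy TYPE('u) Q"
  shows "(\<exists>\<mu>. cgaussian K \<mu>) \<and>
    (\<forall>\<mu>. cgaussian K \<mu> \<longrightarrow>
       is_arg_max (\<lambda>(U, p). EPSR Q U p) (\<lambda>i. i \<in> cov_inputs K)
         (direct_alphabet e, direct_input e \<mu>)) \<and>
    (SUP (U :: 'u measure, p) \<in> cov_inputs K. EPSR Q U p) =
      eexpectation Q (\<lambda>(H, G). ereal (log 2 (Re
        (det (mat 1 + H ** K ** cadjoint H) / det (mat 1 + G ** K ** cadjoint G)))))"
proof -
  note K = assms(3) and e = assms(4)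
  let ?rate = "\<lambda>(H, G). ereal (log 2 (Re
        (det (mat 1 + H ** K ** cadjoint H) / det (mat 1 + G ** K ** cadjoint G))))"
  have rate: "?rate = (\<lambda>(H, G). ereal ((ln_det K H - ln_det K G) / ln 2))"
    by (simp add: log_det_ratio[OF K])
  have less_noisy: "inst_info U p G \<le> inst_info U p H"
    if "(H, G) \<in> law_support Q" "input_law U p" for H G and U :: "'u measure" and p
    using assms(5) that unfolding uniformly_less_noisy_def by blast
  have supp: "AE c in Q. c \<in> law_support Q" by (rule AE_law_support[OF assms(2)])
  have gauss_in: "(direct_alphabet e, direct_input e \<mu>) \<in> cov_inputs K"
    and gauss_info: "\<And>H :: complex ^ 'a ^ 'b. inst_info (direct_alphabet e) (direct_input e \<mu>) H = ereal (ln_det K H / ln 2)"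
      "\<And>G :: complex ^ 'a ^ 'e. inst_info (direct_alphabet e) (direct_input e \<mu>) G = ereal (ln_det K G / ln 2)"
    if "cgaussian K \<mu>" for \<mu>
  proof -
    obtain A :: "complex ^ 'a ^ 'a" where A: "A ** cadjoint A = K" "\<mu> = distr std_cgaussian borel (\<lambda>w. A *v w)"
      using \<open>cgaussian K \<mu>\<close> unfolding cgaussian_def by blast
    show "(direct_alphabet e, direct_input e \<mu>) \<in> cov_inputs K"
      using input_law_direct[OF e, of A] has_cov_direct[OF e, of A] A by (simp add: cov_inputs_def)
    show "\<And>H :: complex ^ 'a ^ 'b. inst_info (direct_alphabet e) (direct_input e \<mu>) H = ereal (ln_det K H / ln 2)"
      "\<And>G :: complex ^ 'a ^ 'e. inst_info (direct_alphabet e) (direct_input e \<mu>) G = ereal (ln_det K G / ln 2)"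
      using inst_info_direct[OF e, of A] A by simp_all
  qed
  have ex: "\<exists>\<mu>. cgaussian K \<mu>"
    using pos_semidef_factorization[OF K] unfolding cgaussian_def by metis
  then obtain \<mu>\<^sub>0 where \<mu>\<^sub>0: "cgaussian K \<mu>\<^sub>0" by blast
  \<comment> \<open>The hypothesis applied to the Gaussian input itself. It bounds the 0 inside the
    positive part in \<open>upper\<close> and removes the positive part in
    \<open>attained\<close>.\<close>
  have rate_nonneg: "0 \<le> (ln_det K H - ln_det K G) / ln 2" if "(H, G) \<in> law_support Q" for H G
    using less_noisy[OF that, of "direct_alphabet e" "direct_input e \<mu>\<^sub>0"] gauss_in[OF \<mu>\<^sub>0]
    by (simp add: gauss_info[OF \<mu>\<^sub>0] cov_inputs_def divide_le_cancel)
  have upper: "EPSR Q U p \<le> eexpectation Q ?rate" if "(U, p) \<in> cov_inputs K" for U :: "'u measure" and p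
    unfolding EPSR_def rate
  proof (rule eexpectation_mono_AE, use supp in eventually_elim)
    case (elim c)
    obtain H G where c: "c = (H, G)" by force
    have "norm (G *v v) \<le> norm (H *v v)" for v
      using less_noisy_gain[OF e less_noisy] elim c by blast
    from inst_info_diff_le[OF this K] that rate_nonneg[of H G] elim
    show ?case by (auto simp: c cov_inputs_def)
  qed
  have attained: "EPSR Q (direct_alphabet e) (direct_input e \<mu>) = eexpectation Q ?rate" if "cgaussian K \<mu>" for \<mu>
  proof -
    have "AE c in Q. (\<lambda>(H, G). max 0 (inst_info (direct_alphabet e) (direct_input e \<mu>) H
        - inst_info (direct_alphabet e) (direct_input e \<mu>) G)) c = ?rate c"
      using supp
    proof eventually_elim
      case (elim c)
      obtain H G where c: "c = (H, G)" by force
      show ?case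
        using rate_nonneg[of H G] elim unfolding rate c
        by (simp add: gauss_info[OF that] diff_divide_distrib max_def zero_ereal_def)
    qed
    then have "eexpectation Q (\<lambda>(H, G). max 0 (inst_info (direct_alphabet e) (direct_input e \<mu>) H
        - inst_info (direct_alphabet e) (direct_input e \<mu>) G)) = eexpectation Q ?rate"
      by (intro antisym eexpectation_mono_AE) (auto elim: eventually_mono)
    then show ?thesis by (simp only: EPSR_def)
  qed
  have "is_arg_max (\<lambda>(U, p). EPSR Q U p) (\<lambda>i. i \<in> cov_inputs K) (direct_alphabet e, direct_input e \<mu>)"
    if "cgaussian K \<mu>" for \<mu>
    unfolding is_arg_max_def using gauss_in[OF that] attained[OF that] upper by (auto simp: not_less)
  moreover have "(SUP (U :: 'u measure, p) \<in> cov_inputs K. EPSR Q U p) = eexpectation Q ?rate"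
  proof (rule antisym)
    show "(SUP (U :: 'u measure, p) \<in> cov_inputs K. EPSR Q U p) \<le> eexpectation Q ?rate"
      using upper by (intro SUP_least) auto
    show "eexpectation Q ?rate \<le> (SUP (U :: 'u measure, p) \<in> cov_inputs K. EPSR Q U p)"
      using SUP_upper[OF gauss_in[OF \<mu>\<^sub>0], of "\<lambda>(U, p). EPSR Q U p"] attained[OF \<mu>\<^sub>0] by simp
  qed
  ultimately show ?thesis using ex by blast
qed

end
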